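(* Let $f:\mathbb{R}^n\to\mathbb{R}$ be locally Lipschitz continuous, $D_f:\mathbb{R}^n\rightrightarrows\mathbb{R}^n$ a set-valued mapping, $\phi:\mathbb{R}^n\to\mathbb{R}$ a function, $\{\eta_k\}$ a positive sequence, and $\{\delta_k\},\{\nu_k\}$ nonnegative sequences. Let $\{x_k\}$ be generated by the stochastic Bregman subgradient method (SBG): for each $k\ge0$, $x_{k+1}$ is a $\nu_k$-optimal solution of $$\min_{x\in\mathbb{R}^n}\left\{\langle g_k,x-x_k\rangle+\frac1{\eta_k}\mathcal{D}_\phi(x,x_k)\right\},\quad\text{i.e.}\quad \left\|g_k+\frac{1}{\eta_k}(\nabla\phi(x_{k+1})-\nabla\phi(x_k))\right\|\le\nu_k,$$ where $g_k=d_k+\xi_k$, $d_k\in D_f^{\delta_k}(x_k)$ and $\xi_k$ is stochastic noise. Suppose that: (1) $\phi$ is a supercoercive Legendre kernel function over $\mathbb{R}^n$, $\nabla\phi$ is differentiable almost everywhere, and for any absolutely continuous mapping $z(\cdot)\in\mathcal{C}(\mathbb{R}_+,\mathbb{R}^n)$, $\nabla^2\phi(z(s))$ is positive definite for almost all $s\ge0$; (2) $\{x_k\}$, $\{\nabla\phi(x_k)\}$ and $\{d_k\}$ are uniformly bounded almost surely; (3) $\{\xi_k\}$ is a martingale difference noise, i.e. $\mathbb{E}[\xi_{k+1}|\mathcal{F}_k]=0$ almost surely, $\sum_{k=0}^\infty\eta_k=\infty$, and one of the following holds: (a) $\{\xi_k\}$ is uniformly bounded and $\eta_k=o(1/\log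 k)$; (b) $\mathbb{E}[\|\xi_{k+1}\|^2|\mathcal{F}_k]\le\sigma^2<\infty$ and $\sum_{k=0}^\infty\eta_k^2<\infty$; (4) $\lim_{k\to\infty}\delta_k=0$ and $\lim_{k\to\infty}\nu_k=0$; (5) $f$ is bounded below and $D_f$ is a convex-valued conservative field for $f$; (6) the critical value set $\{f(x):0\in D_f(x)\}$ has empty interior in $\mathbb{R}$. Then, almost surely, any cluster point $x^*$ of $\{x_k\}$ is a $D_f$-stationary point (i.e. $0\in D_f(x^* )$), and the function values $\{f(x_k)\}$ converge.
   Context: $(\Omega,\mathcal{F},\mathbb{P})$ is a probability space and $\mathcal{F}_k=\sigma(\xi_0,\ldots,\xi_k)$. The Bregman distance is $\mathcal{D}_\phi(x,y)=\phi(x)-\phi(y)-\langle\nabla\phi(y),x-y\rangle$. A Legendre kernel function over $\mathbb{R}^n$ is a strictly convex $\phi\in\mathcal{C}^1(\mathbb{R}^n)$ such that $\|\nabla\phi(u_k)\|\to\infty$ whenever $\|u_k\|\to\infty$; it is supercoercive if $\lim_{\|u\|\to\infty}\phi(u)/\|u\|=\infty$. A $\nu$-optimal solution of $\min_x g(x)$, $g$ convex, is a point $x$ with $\mathrm{dist}(0,\partial g(x))\le\nu$. For a set-valued mapping $S:\mathbb{R}^n\rightrightarrows\mathbb{R}^n$ and $\delta\ge0$, $S^\delta(x)=\bigcup_{\|y-x\|\le\delta}(S(y)+\delta\mathbb{B}^n)$, $\mathbb{B}^n$ the unit ball. A conservative field for a locally Lipschitz $f$ is a nonempty-closed-valued,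 closed-graph mapping $D_f:\mathbb{R}^n\rightrightarrows\mathbb{R}^n$ such that for every absolutely continuous $\gamma:[0,1]\to\mathbb{R}^n$, $\frac{d}{dt}(f\circ\gamma)(t)=\langle v,\dot\gamma(t)\rangle$ for all $v\in D_f(\gamma(t))$ and almost all $t\in[0,1]$. *)

theory Defs
  imports "HOL-Probability.Probability" "HOL-Library.Landau_Symbols"
begin

definition locally_lipschitz :: "('a::metric_space \<Rightarrow> 'b::metric_space) \<Rightarrow> bool" where
  "locally_lipschitz f \<longleftrightarrow> (\<forall>x. \<exists>r>0. \<exists>L. L-lipschitz_on (ball x r) f)"

text \<open>
  The usual epsilon-delta definition: a division is a finite family of non-overlapping, nonempty
  compact intervals \<open>K = {Inf K..Sup K}\<close>.
\<close>
definition abs_continuous_on :: "real set \<Rightarrow> (real \<Rightarrow> 'a::real_normed_vector) \<Rightarrow> bool" where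
  "abs_continuous_on S \<gamma> \<longleftrightarrow>
     (\<forall>\<epsilon>>0. \<exists>\<delta>>0. \<forall>\<K>. \<K> division_of \<Union>\<K> \<and> \<Union>\<K> \<subseteq> S \<and> (\<Sum>K\<in>\<K>. Sup K - Inf K) < \<delta>
        \<longrightarrow> (\<Sum>K\<in>\<K>. norm (\<gamma> (Sup K) - \<gamma> (Inf K))) < \<epsilon>)"

definition conservative_field :: "((real^'n) \<Rightarrow> real) \<Rightarrow> ((real^'n) \<Rightarrow> (real^'n) set) \<Rightarrow> bool" where
  "conservative_field f D \<longleftrightarrow>
     (\<forall>x. D x \<noteq> {} \<and> closed (D x)) \<and>
     closed {(x, v). v \<in> D x} \<and>
     (\<forall>\<gamma>. abs_continuous_on {0..1} \<gamma> \<longrightarrow>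
        (AE t in lebesgue. t \<in> {0..1} \<longrightarrow>
           (\<exists>\<gamma>'. (\<gamma> has_vector_derivative \<gamma>') (at t within {0..1}) \<and>
              (\<forall>v\<in>D (\<gamma> t). ((f \<circ> \<gamma>) has_real_derivative v \<bullet> \<gamma>') (at t within {0..1})))))"

definition enlargement ::
    "((real^'n) \<Rightarrow> (real^'n) set) \<Rightarrow> real \<Rightarrow> real^'n \<Rightarrow> (real^'n) set" where
  "enlargement S \<delta> x = (\<Union>y\<in>{y. norm (y - x) \<le> \<delta>}. {v + \<delta> *\<^sub>R b |v b. v \<in> S y \<and> b \<in> cball 0 1})"

text \<open>Meaningful only at points where \<open>\<phi>\<close> is differentiable.\<close>
definition gradient :: "((real^'n) \<Rightarrow> real) \<Rightarrow> real^'n \<Rightarrow> real^'n" where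
  "gradient \<phi> x = (THE D. GDERIV \<phi> x :> D)"

text \<open>Meaningful only at points where \<open>gradient \<phi>\<close> is differentiable.\<close>
definition hessian :: "((real^'n) \<Rightarrow> real) \<Rightarrow> real^'n \<Rightarrow> real^'n^'n" where
  "hessian \<phi> x = matrix (frechet_derivative (gradient \<phi>) (at x))"

definition positive_definite :: "real^'n^'n \<Rightarrow> bool" where
  "positive_definite A \<longleftrightarrow> transpose A = A \<and> (\<forall>v. v \<noteq> 0 \<longrightarrow> v \<bullet> (A *v v) > 0)"

definition strictly_convex :: "('a::real_vector \<Rightarrow> real) \<Rightarrow> bool" where
  "strictly_convex \<phi> \<longleftrightarrow>
     (\<forall>x y. x \<noteq> y \<longrightarrow> (\<forall>t\<in>{0<..<1}. \<phi> ((1 - t) *\<^sub>R x + t *\<^sub>R y) < (1 - t) * \<phi> x + t * \<phi> y))"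

definition legendre_kernel :: "((real^'n) \<Rightarrow> real) \<Rightarrow> bool" where
  "legendre_kernel \<phi> \<longleftrightarrow>
     strictly_convex \<phi> \<and>
     (\<forall>x. \<phi> differentiable (at x)) \<and> continuous_on UNIV (gradient \<phi>) \<and>
     (\<forall>u::nat \<Rightarrow> real^'n. filterlim (\<lambda>k. norm (u k)) at_top sequentially \<longrightarrow>
        filterlim (\<lambda>k. norm (gradient \<phi> (u k))) at_top sequentially)"

definition supercoercive :: "((real^'n) \<Rightarrow> real) \<Rightarrow> bool" where
  "supercoercive \<phi> \<longleftrightarrow> filterlim (\<lambda>u. \<phi> u / norm u) at_top at_infinity"

definition bregman :: "((real^'n) \<Rightarrow> real) \<Rightarrow> real^'n \<Rightarrow> real^'n \<Rightarrow> real" where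
  "bregman \<phi> x y = \<phi> x - \<phi> y - gradient \<phi> y \<bullet> (x - y)"

definition subdifferential :: "('a::real_inner \<Rightarrow> real) \<Rightarrow> 'a \<Rightarrow> 'a set" where
  "subdifferential g x = {v. \<forall>y. g y \<ge> g x + v \<bullet> (y - x)}"

text \<open>
  Intended for convex \<open>g\<close>. The nonemptiness condition is there because \<open>infdist x {} = 0\<close>,
  whereas the distance to the empty set is infinite by convention.
\<close>
definition nu_optimal :: "real \<Rightarrow> ('a::real_inner \<Rightarrow> real) \<Rightarrow> 'a \<Rightarrow> bool" where
  "nu_optimal \<nu> g x \<longleftrightarrow> subdifferential g x \<noteq> {} \<and> infdist 0 (subdifferential g x) \<le> \<nu>"

definition sbg_objective ::
    "((real^'n) \<Rightarrow> real) \<Rightarrow> real \<Rightarrow> real^'n \<Rightarrow> real^'n \<Rightarrow> real^'n \<Rightarrow> real" where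
  "sbg_objective \<phi> \<eta> g x\<^sub>0 = (\<lambda>x. g \<bullet> (x - x\<^sub>0) + 1 / \<eta> * bregman \<phi> x x\<^sub>0)"

definition natural_filtration ::
    "'w measure \<Rightarrow> (nat \<Rightarrow> 'w \<Rightarrow> 'a::topological_space) \<Rightarrow> nat \<Rightarrow> 'w measure" where
  "natural_filtration M \<xi> k =
     sigma (space M) (\<Union>i\<le>k. {\<xi> i -` A \<inter> space M |A. A \<in> sets borel})"

definition vec_cond_exp ::
    "'w measure \<Rightarrow> 'w measure \<Rightarrow> ('w \<Rightarrow> real^'n) \<Rightarrow> 'w \<Rightarrow> real^'n" where
  "vec_cond_exp M F X \<omega> = (\<chi> i. real_cond_exp M F (\<lambda>\<omega>. X \<omega> $ i) \<omega>)"

text \<open>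
  Integrability has to be required explicitly, because \<^const>\<open>real_cond_exp\<close> is total and returns
  arbitrary values for non-integrable functions.
\<close>
definition martingale_difference_noise :: "'w measure \<Rightarrow> (nat \<Rightarrow> 'w \<Rightarrow> real^'n) \<Rightarrow> bool" where
  "martingale_difference_noise M \<xi> \<longleftrightarrow>
     (\<forall>k. integrable M (\<xi> (Suc k)) \<and>
          (AE \<omega> in M. vec_cond_exp M (natural_filtration M \<xi> k) (\<xi> (Suc k)) \<omega> = 0))"

definition cluster_point :: "(nat \<Rightarrow> 'a::topological_space) \<Rightarrow> 'a \<Rightarrow> bool" where
  "cluster_point u l \<longleftrightarrow> (\<exists>r. strict_mono r \<and> (u \<circ> r) \<longlonglongrightarrow> l)"

lemma gradient_gderiv:
  assumes "\<phi> differentiable (at x)"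
  shows "GDERIV \<phi> x :> gradient \<phi> x"
proof -
  obtain L where L: "(\<phi> has_derivative L) (at x)"
    using assms unfolding differentiable_def by blast
  interpret bounded_linear L using L by (rule has_derivative_bounded_linear)
  have "L h = h \<bullet> (\<Sum>i\<in>Basis. L i *\<^sub>R i)" for h
  proof -
    have "L h = L (\<Sum>i\<in>Basis. (h \<bullet> i) *\<^sub>R i)" by (simp add: euclidean_representation)
    also have "\<dots> = (\<Sum>i\<in>Basis. (h \<bullet> i) * L i)" by (simp only: sum scaleR real_scaleR_def)
    finally show ?thesis by (simp add: inner_sum_right mult.commute)
  qed
  then have "L = (\<lambda>h. h \<bullet> (\<Sum>i\<in>Basis. L i *\<^sub>R i))" by blast
  then have *: "GDERIV \<phi> x :> (\<Sum>i\<in>Basis. L i *\<^sub>R i)"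
    using L unfolding gderiv_def by simp
  show ?thesis unfolding gradient_def
  proof (rule theI[where P = "\<lambda>D. GDERIV \<phi> x :> D", OF *])
    fix D assume "GDERIV \<phi> x :> D"
    then have "(\<lambda>h. h \<bullet> D) = (\<lambda>h. h \<bullet> (\<Sum>i\<in>Basis. L i *\<^sub>R i))"
      using * unfolding gderiv_def by (rule has_derivative_unique)
    then show "D = (\<Sum>i\<in>Basis. L i *\<^sub>R i)"
      by (metis (no_types) vector_eq_ldot)
  qed
qed

lemma strictly_convex_tangent:
  assumes sc: "strictly_convex \<phi>" and D: "GDERIV \<phi> x :> D"
  shows "\<phi> y \<ge> \<phi> x + D \<bullet> (y - x)"
proof (cases "y = x")
  case False
  define c where "c = (\<lambda>t::real. \<phi> (x + t *\<^sub>R (y - x)))"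
  have D': "(\<phi> has_derivative (\<lambda>h. h \<bullet> D)) (at (x + 0 *\<^sub>R (y - x)))"
    using D unfolding gderiv_def by simp
  have "((\<lambda>t::real. x + t *\<^sub>R (y - x)) has_derivative (\<lambda>t. t *\<^sub>R (y - x))) (at 0)"
    by (auto intro!: derivative_eq_intros)
  from has_derivative_compose[OF this D'] have "(c has_derivative (\<lambda>t. t *\<^sub>R (y - x) \<bullet> D)) (at 0)"
    unfolding c_def by simp
  then have "(c has_real_derivative (y - x) \<bullet> D) (at 0)"
    by (simp add: has_field_derivative_def mult.commute[of _ "(y - x) \<bullet> D"])
  then have "((\<lambda>t. (c t - c 0) / (t - 0)) \<longlongrightarrow> (y - x) \<bullet> D) (at 0)"
    by (simp add: has_field_derivative_iff)
  then have lim: "((\<lambda>t. (c t - c 0) / t) \<longlongrightarrow> (y - x) \<bullet> D) (at_right 0)"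
    by (auto intro: tendsto_mono at_le)
  have "eventually (\<lambda>t. (c t - c 0) / t \<le> \<phi> y - \<phi> x) (at_right (0::real))"
    unfolding eventually_at_right_field
  proof (intro exI[of _ 1] conjI allI impI)
    fix t :: real assume t: "0 < t" "t < 1"
    have "\<phi> ((1 - t) *\<^sub>R x + t *\<^sub>R y) < (1 - t) * \<phi> x + t * \<phi> y"
      using sc False t unfolding strictly_convex_def by auto
    moreover have "(1 - t) *\<^sub>R x + t *\<^sub>R y = x + t *\<^sub>R (y - x)" by (simp add: algebra_simps)
    ultimately have "c t - c 0 \<le> t * (\<phi> y - \<phi> x)" unfolding c_def by (simp add: algebra_simps)
    then show "(c t - c 0) / t \<le> \<phi> y - \<phi> x" using t by (simp add: field_simps)
  qed simp
  from tendsto_upperbound[OF lim this] have "(y - x) \<bullet> D \<le> \<phi> y - \<phi> x" by simp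
  then show ?thesis by (simp add: inner_commute)
qed simp

text \<open>The explicit form of the step: approximate optimality is a bound on the gradient residual.\<close>
lemma nu_optimal_sbg_objective_iff:
  assumes \<phi>: "legendre_kernel \<phi>" and "\<eta> > 0"
  shows "nu_optimal \<nu> (sbg_objective \<phi> \<eta> g x\<^sub>0) x \<longleftrightarrow>
    norm (g + (1 / \<eta>) *\<^sub>R (gradient \<phi> x - gradient \<phi> x\<^sub>0)) \<le> \<nu>"
proof -
  define h where "h = sbg_objective \<phi> \<eta> g x\<^sub>0"
  define v where "v = g + (1 / \<eta>) *\<^sub>R (gradient \<phi> x - gradient \<phi> x\<^sub>0)"
  have G: "GDERIV \<phi> x :> gradient \<phi> x"
    using \<phi> gradient_gderiv unfolding legendre_kernel_def by blast
  have h_expand: "h y = g \<bullet> (y - x\<^sub>0) + (1 / \<eta>) * (\<phi> y - \<phi> x\<^sub>0 - gradient \<phi> x\<^sub>0 \<bullet> (y - x\<^sub>0))" for y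
    unfolding h_def sbg_objective_def bregman_def by simp
  have "subdifferential h x = {v}"
  proof (intro equalityI subsetI)
    fix w assume "w \<in> {v}"
    have "h y \<ge> h x + v \<bullet> (y - x)" for y
    proof -
      have "\<phi> y \<ge> \<phi> x + gradient \<phi> x \<bullet> (y - x)"
        using \<phi> G strictly_convex_tangent unfolding legendre_kernel_def by blast
      then have "(1 / \<eta>) * \<phi> y \<ge> (1 / \<eta>) * (\<phi> x + gradient \<phi> x \<bullet> (y - x))"
        using \<open>\<eta> > 0\<close> by (intro mult_left_mono) auto
      then show ?thesis
        unfolding h_expand v_def by (simp add: algebra_simps inner_add_left inner_diff_left)
    qed
    then show "w \<in> subdifferential h x"
      using \<open>w \<in> {v}\<close> unfolding subdifferential_def by simp
  next
    fix w assume w: "w \<in> subdifferential h x"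
    have \<phi>d: "(\<phi> has_derivative (\<lambda>k. k \<bullet> gradient \<phi> x)) (at x)"
      using G unfolding gderiv_def .
    have "((\<lambda>y. h y - w \<bullet> (y - x)) has_derivative (\<lambda>k. k \<bullet> (v - w))) (at x)"
      unfolding h_expand v_def
      by (rule derivative_eq_intros \<phi>d refl)+
        (simp add: fun_eq_iff algebra_simps inner_add_right inner_diff_right inner_commute)
    moreover have "h x - w \<bullet> (x - x) \<le> h y - w \<bullet> (y - x)" for y
      using w unfolding subdifferential_def by (auto simp: algebra_simps)
    ultimately have "(\<lambda>k. k \<bullet> (v - w)) = (\<lambda>k. 0)"
      by (intro has_derivative_local_min[of "\<lambda>y. h y - w \<bullet> (y - x)"]) auto
    then have "(v - w) \<bullet> (v - w) = 0" by metis
    then show "w \<in> {v}" by simp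
  qed
  then show ?thesis
    unfolding nu_optimal_def h_def[symmetric] v_def[symmetric] by simp
qed

end

theory Submission
  imports Defs "HOL-Complex_Analysis.Great_Picard"
begin

text \<open>
  Write \<open>G = \<nabla>\<phi>\<close> and \<open>y\<^sub>k = G x\<^sub>k\<close>. Approximate optimality of the step says
  \<open>y\<^bsub>k+1\<^esub> = y\<^sub>k - \<eta>\<^sub>k (d\<^sub>k + \<xi>\<^sub>k + e\<^sub>k)\<close> with \<open>norm e\<^sub>k \<le> \<nu>\<^sub>k\<close>, so in the dual variable the
  method is a perturbed Euler scheme for the differential inclusion \<open>y' \<in> - D x\<close>, \<open>y = G x\<close>. Along
  a solution the chain rule of the conservative field gives
  \<open>(f \<circ> x)' = - y' \<bullet> x' = - x' \<bullet> (\<nabla>\<^sup>2\<phi> x) x' \<le> 0\<close>, so that \<open>f\<close> decreases, and strictly so away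
  from stationary points.

  The noise enters additively with deterministic weights. Its sums \<open>\<Sum> \<eta>\<^sub>k \<xi>\<^sub>k\<close> over windows in
  which the step sizes add up to at most 2 tend to zero almost surely, by one maximal inequality
  for nonnegative supermartingales applied either to an exponential
  (\<open>vanishing_bounded_noise\<close>) or to a square plus the remaining variance
  (\<open>vanishing_square_integrable_noise\<close>). What remains is a statement about single paths.

  The dual path without its noise is equi-Lipschitz, so every sequence of starting times has a
  subsequence along which it converges to a Lipschitz curve; since \<open>D\<close> has closed graph and convex
  values, this curve solves the inclusion (\<open>limit_curve\<close>).

  The delicate point is the chain rule. The Hessian hypothesis, read on constant curves, says that
  \<open>G\<close> has a positive definite derivative at every point, but this derivative need not be continuous,
  and the inverse of \<open>G\<close> need not be locally Lipschitz. Hence the primal curve \<open>x\<close> need not be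
  absolutely continuous. It is, however, Lipschitz at each time with a constant that depends on the
  time. Such a curve is a countable patchwork of pieces of Lipschitz curves, so that the chain rule
  survives almost everywhere (\<open>conservative_field_chain_rule\<close>), and a function that is Lipschitz at
  each point and has a nonpositive derivative almost everywhere is nonincreasing
  (\<open>nonincreasing_if_derivative_nonpos_ae\<close>), because it maps the exceptional null set to a null set.

  If \<open>f x\<^sub>k\<close> did not converge, it would infinitely often rise from a noncritical level \<open>c\<close> to a fixed
  height above it, because the critical values contain no interval. The limiting curve obtained
  from the starting times of these crossings starts at level \<open>c\<close> at a nonstationary point, so it
  drops below \<open>c\<close> immediately, whereas the iterates remain above \<open>c\<close>. Once \<open>f x\<^sub>k\<close> converges, \<open>f\<close> is
  constant along every limiting curve, and therefore every cluster point is stationary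
  (\<open>converges_to_stationary_set\<close>).
\<close>

section \<open>Absolute continuity, monotonicity and Lipschitz extension on the line\<close>

lemma lipschitz_on_imp_abs_continuous_on:
  assumes "L-lipschitz_on S \<gamma>"
  shows "abs_continuous_on S \<gamma>"
  unfolding abs_continuous_on_def
proof (intro allI impI)
  fix \<epsilon> :: real assume "\<epsilon> > 0"
  have L: "L \<ge> 0" using assms lipschitz_on_nonneg by blast
  have "(\<Sum>K\<in>\<K>. norm (\<gamma> (Sup K) - \<gamma> (Inf K))) < \<epsilon>"
    if \<K>: "\<K> division_of \<Union>\<K> \<and> \<Union>\<K> \<subseteq> S \<and> (\<Sum>K\<in>\<K>. Sup K - Inf K) < \<epsilon> / (L + 1)" for \<K>
  proof -
    have "norm (\<gamma> (Sup K) - \<gamma> (Inf K)) \<le> L * (Sup K - Inf K)" if "K \<in> \<K>" for K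
    proof -
      have div: "\<K> division_of \<Union>\<K>" using \<K> by simp
      from division_ofD(4)[OF div that] obtain a b where ab: "K = cbox a b" by blast
      have "K \<noteq> {}" using division_ofD(3)[OF div that] .
      then have "a \<le> b" using ab by auto
      have "K \<subseteq> \<Union>\<K>" "\<Union>\<K> \<subseteq> S" using \<K> that by auto
      then have "K \<subseteq> S" by (rule order_trans)
      then have "{a, b} \<subseteq> S" using ab \<open>a \<le> b\<close> by (auto simp: subset_iff)
      then have "dist (\<gamma> b) (\<gamma> a) \<le> L * dist b a" using assms by (intro lipschitz_onD) auto
      then show ?thesis using ab \<open>a \<le> b\<close> by (simp add: dist_norm)
    qed
    then have "(\<Sum>K\<in>\<K>. norm (\<gamma> (Sup K) - \<gamma> (Inf K))) \<le> (\<Sum>K\<in>\<K>. L * (Sup K - Inf K))"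
      by (rule sum_mono)
    also have "\<dots> \<le> L * (\<epsilon> / (L + 1))"
      using \<K> L unfolding sum_distrib_left[symmetric] by (intro mult_left_mono) auto
    also have "\<dots> < \<epsilon>" using L \<open>\<epsilon> > 0\<close> by (simp add: field_simps)
    finally show ?thesis .
  qed
  then show "\<exists>\<delta>>0. \<forall>\<K>. \<K> division_of \<Union>\<K> \<and> \<Union>\<K> \<subseteq> S \<and> (\<Sum>K\<in>\<K>. Sup K - Inf K) < \<delta> \<longrightarrow>
      (\<Sum>K\<in>\<K>. norm (\<gamma> (Sup K) - \<gamma> (Inf K))) < \<epsilon>"
    using \<open>\<epsilon> > 0\<close> L by (intro exI[of _ "\<epsilon> / (L + 1)"]) auto
qed

text \<open>
  The constant \<open>B\<close> may depend on \<open>t\<close>: a function with this property at every point of \<open>S\<close>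
  is continuous on \<open>S\<close>, but in general neither Lipschitz nor absolutely continuous.
\<close>
definition pointwise_lipschitz_at :: "real set \<Rightarrow> (real \<Rightarrow> 'a::real_normed_vector) \<Rightarrow> real \<Rightarrow> bool" where
  "pointwise_lipschitz_at S \<gamma> t \<longleftrightarrow>
     (\<exists>B. eventually (\<lambda>s. norm (\<gamma> s - \<gamma> t) \<le> B * \<bar>s - t\<bar>) (at t within S))"

text \<open>
  If the values at the endpoints increased, then so would those of \<open>h t = g t - e (t - a)\<close> for a
  small \<open>e > 0\<close>. At the last time at which \<open>h\<close> attains an intermediate value \<open>c\<close> its derivative
  cannot be negative, so this time belongs to \<open>N\<close>. Hence the image of the null set \<open>N\<close> under \<open>h\<close>
  contains a whole interval, whereas a pointwise Lipschitz function maps null sets to null sets.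
\<close>
lemma nonincreasing_if_derivative_nonpos_ae:
  fixes g :: "real \<Rightarrow> real"
  assumes "a \<le> b" and cont: "continuous_on {a..b} g" and N: "negligible N"
    and lip: "\<And>t. t \<in> {a..b} \<Longrightarrow> pointwise_lipschitz_at {a..b} g t"
    and der: "\<And>t. t \<in> {a<..<b} - N \<Longrightarrow> \<exists>g'\<le>0. (g has_real_derivative g') (at t)"
  shows "g b \<le> g a"
proof (rule ccontr)
  assume "\<not> g b \<le> g a"
  then have ab: "g a < g b" "a < b" using \<open>a \<le> b\<close> by (auto simp: less_eq_real_def)
  define e where "e = (g b - g a) / (2 * (b - a))"
  have e: "e > 0" unfolding e_def using ab by auto
  define h where "h = (\<lambda>t. g t - e * (t - a))"
  have "e * (b - a) = (g b - g a) / 2" unfolding e_def using ab by (simp add: field_simps)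
  then have hab: "h a < h b" unfolding h_def using ab by simp
  have hc: "continuous_on {a..b} h" unfolding h_def by (intro continuous_intros cont)
  define Z where "Z = N \<inter> {a<..<b}"
  have negZ: "negligible Z" unfolding Z_def using N by (rule negligible_subset) auto
  have "negligible (h ` Z)"
  proof (rule negligible_locally_Lipschitz_image[OF _ negZ])
    fix t assume "t \<in> Z"
    then have t: "t \<in> {a<..<b}" unfolding Z_def by auto
    obtain B where B: "eventually (\<lambda>s. norm (g s - g t) \<le> B * \<bar>s - t\<bar>) (at t within {a..b})"
      using lip[of t] t unfolding pointwise_lipschitz_at_def by auto
    then obtain T where T: "open T" "t \<in> T"
      "\<And>s. s \<in> T \<Longrightarrow> s \<noteq> t \<Longrightarrow> s \<in> {a..b} \<Longrightarrow> norm (g s - g t) \<le> B * \<bar>s - t\<bar>"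
      unfolding eventually_at_topological by blast
    have "norm (h s - h t) \<le> (B + e) * norm (s - t)" if "s \<in> Z \<inter> T" for s
    proof -
      have "norm (g s - g t) \<le> B * \<bar>s - t\<bar>" using T(3)[of s] that unfolding Z_def by (cases "s = t") auto
      moreover have "h s - h t = (g s - g t) - e * (s - t)" unfolding h_def by (simp add: algebra_simps)
      then have "norm (h s - h t) \<le> norm (g s - g t) + norm (e * (s - t))"
        by (metis norm_triangle_ineq4)
      moreover have "norm (e * (s - t)) = e * \<bar>s - t\<bar>" using e by (simp add: abs_mult)
      ultimately show ?thesis by (simp add: distrib_right)
    qed
    then show "\<exists>T B. open T \<and> t \<in> T \<and> (\<forall>y\<in>Z \<inter> T. norm (h y - h t) \<le> B * norm (y - t))"
      using T by blast
  qed auto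
  moreover have "{h a<..<h b} \<subseteq> h ` Z"
  proof
    fix c assume c: "c \<in> {h a<..<h b}"
    define A where "A = {t \<in> {a..b}. h t = c}"
    have "compact A"
    proof -
      have "closed A" unfolding A_def
        using continuous_closed_preimage[OF hc, of "{c}"] by (simp add: vimage_def Int_def)
      moreover have "bounded A" by (rule bounded_subset[of "{a..b}"]) (auto simp: A_def)
      ultimately show ?thesis by (simp add: compact_eq_bounded_closed)
    qed
    moreover have "A \<noteq> {}"
      using IVT'[of h a c b] hc c \<open>a \<le> b\<close> unfolding A_def by auto
    ultimately obtain t where t: "t \<in> A" "\<And>s. s \<in> A \<Longrightarrow> s \<le> t"
      using compact_attains_sup by metis
    have tab: "t \<in> {a<..<b}" "h t = c" using t(1) c unfolding A_def
      by (auto simp: less_le)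
    have above: "h s > c" if "s \<in> {t<..b}" for s
    proof (rule ccontr)
      assume "\<not> h s > c"
      then have "h s \<le> c" by simp
      moreover have "c \<le> h b" "s \<le> b" using c that by auto
      moreover have "continuous_on {s..b} h" using hc that tab by (auto intro: continuous_on_subset)
      ultimately obtain r where "r \<ge> s" "r \<le> b" "h r = c"
        using IVT'[of h s c b] by blast
      then have "r \<in> A" unfolding A_def using that tab by auto
      with t(2) \<open>r \<ge> s\<close> that show False by force
    qed
    have "t \<in> N"
    proof (rule ccontr)
      assume "t \<notin> N"
      then obtain g' where g': "g' \<le> 0" "(g has_real_derivative g') (at t)" using der tab by auto
      have "(h has_real_derivative (g' - e)) (at t)"
        unfolding h_def using g'(2) by (auto intro!: derivative_eq_intros)
      then obtain d where d: "d > 0" "\<And>r. 0 < r \<Longrightarrow> r < d \<Longrightarrow> h (t + r) < h t"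
        using DERIV_neg_dec_right[of h "g' - e" t] g' e by auto
      define r where "r = min (d / 2) (b - t)"
      have "r > 0" "r < d" "t + r \<le> b" unfolding r_def using d tab by auto
      then have "h (t + r) < c" "h (t + r) > c" using d(2)[of r] above[of "t + r"] tab by auto
      then show False by simp
    qed
    then show "c \<in> h ` Z" unfolding Z_def using tab by auto
  qed
  ultimately have "negligible {h a<..<h b}" using negligible_subset by blast
  then show False using open_not_negligible[of "{h a<..<h b}"] hab by auto
qed

text \<open>
  Each isolated point is the only point of \<open>F\<close> in some member of a countable basis.
\<close>
lemma countable_isolated_in:
  fixes F :: "'a::second_countable_topology set"
  shows "countable {t \<in> F. \<not> t islimpt F}"
proof -
  obtain B :: "'a set set" where B: "countable B" "topological_basis B"
    using ex_countable_basis by blast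
  have "\<exists>U\<in>B. U \<inter> F = {t}" if "t \<in> F" "\<not> t islimpt F" for t
  proof -
    obtain T where T: "t \<in> T" "open T" "\<And>y. y \<in> F \<Longrightarrow> y \<in> T \<Longrightarrow> y = t"
      using \<open>\<not> t islimpt F\<close> unfolding islimpt_def by auto
    obtain U where "U \<in> B" "t \<in> U" "U \<subseteq> T" by (rule topological_basisE[OF B(2) T(2,1)])
    then show ?thesis using T(3) \<open>t \<in> F\<close> by (intro bexI[of _ U]) auto
  qed
  then have "\<forall>t\<in>{t \<in> F. \<not> t islimpt F}. \<exists>U\<in>B. U \<inter> F = {t}" by blast
  then obtain u where u: "\<And>t. t \<in> {t \<in> F. \<not> t islimpt F} \<Longrightarrow> u t \<in> B \<and> u t \<inter> F = {t}"
    by metis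
  have "inj_on u {t \<in> F. \<not> t islimpt F}" by (rule inj_onI) (metis (no_types, lifting) u singleton_inject)
  moreover have "countable (u ` {t \<in> F. \<not> t islimpt F})"
    by (rule countable_subset[OF _ B(1)]) (use u in auto)
  ultimately show ?thesis using countable_image_inj_on by blast
qed

text \<open>
  McShane's extension, the lower envelope of the cones with slope \<open>L\<close> that stand on the graph of \<open>g\<close>.
\<close>
lemma lipschitz_extension_real:
  fixes g :: "real \<Rightarrow> real"
  assumes g: "L-lipschitz_on F g"
  obtains h where "L-lipschitz_on UNIV h" "\<And>t. t \<in> F \<Longrightarrow> h t = g t"
proof (cases "F = {}")
  case True
  have "L-lipschitz_on UNIV (\<lambda>_::real. 0::real)"
    using lipschitz_on_nonneg[OF g] by (intro lipschitz_onI) auto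
  then show ?thesis using that True by blast
next
  case False
  then obtain s0 where s0: "s0 \<in> F" by blast
  have L: "L \<ge> 0" using lipschitz_on_nonneg[OF g] .
  define h where "h = (\<lambda>t. INF s\<in>F. g s + L * \<bar>t - s\<bar>)"
  have gl: "g s - g s' \<le> L * \<bar>s - s'\<bar>" if "s \<in> F" "s' \<in> F" for s s'
    using lipschitz_onD[OF g that] by (simp add: dist_real_def)
  have bdd: "bdd_below ((\<lambda>s. g s + L * \<bar>t - s\<bar>) ` F)" for t
  proof (rule bdd_belowI2[of _ "g s0 - L * \<bar>t - s0\<bar>"])
    fix s assume "s \<in> F"
    have "L * \<bar>s0 - s\<bar> \<le> L * (\<bar>t - s0\<bar> + \<bar>t - s\<bar>)" using L by (intro mult_left_mono) auto
    then show "g s0 - L * \<bar>t - s0\<bar> \<le> g s + L * \<bar>t - s\<bar>"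
      using gl[OF s0 \<open>s \<in> F\<close>] by (simp add: algebra_simps)
  qed
  have "h t = g t" if "t \<in> F" for t
    unfolding h_def
  proof (rule cInf_eq_minimum)
    show "g t \<in> (\<lambda>s. g s + L * \<bar>t - s\<bar>) ` F" using that by (intro image_eqI[of _ _ t]) auto
    fix y assume "y \<in> (\<lambda>s. g s + L * \<bar>t - s\<bar>) ` F"
    then show "g t \<le> y" using gl[OF that] by (force simp: algebra_simps)
  qed
  moreover have "L-lipschitz_on UNIV h"
  proof (rule lipschitz_onI[OF _ L])
    have half: "h t \<le> h t' + L * \<bar>t - t'\<bar>" for t t'
    proof -
      have "h t - L * \<bar>t - t'\<bar> \<le> g s + L * \<bar>t' - s\<bar>" if "s \<in> F" for s
      proof -
        have "h t \<le> g s + L * \<bar>t - s\<bar>" unfolding h_def using bdd that by (rule cINF_lower)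
        moreover have "L * \<bar>t - s\<bar> \<le> L * (\<bar>t - t'\<bar> + \<bar>t' - s\<bar>)" using L by (intro mult_left_mono) auto
        ultimately show ?thesis by (simp add: algebra_simps)
      qed
      then have "h t - L * \<bar>t - t'\<bar> \<le> (INF s\<in>F. g s + L * \<bar>t' - s\<bar>)"
        using False by (intro cINF_greatest)
      then have "h t - L * \<bar>t - t'\<bar> \<le> h t'" by (simp only: h_def)
      then show ?thesis by simp
    qed
    fix t t' :: real
    show "dist (h t) (h t') \<le> L * dist t t'"
      using half[of t t'] half[of t' t] by (simp add: dist_real_def abs_minus_commute abs_le_iff)
  qed
  ultimately show ?thesis using that by blast
qed

text \<open>
  Extending the coordinates separately costs a dimensional factor in the constant; only the
  existence of some constant matters below.
\<close>
lemma lipschitz_extension_vec: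
  fixes g :: "real \<Rightarrow> real^'n"
  assumes g: "L-lipschitz_on F g"
  obtains h where "(real CARD('n) * L)-lipschitz_on UNIV h" "\<And>t. t \<in> F \<Longrightarrow> h t = g t"
proof -
  have "\<exists>h. L-lipschitz_on UNIV h \<and> (\<forall>t\<in>F. h t = g t $ i)" for i
  proof -
    have "L-lipschitz_on F (\<lambda>t. g t $ i)"
    proof (rule lipschitz_onI)
      fix t t' assume "t \<in> F" "t' \<in> F"
      then show "dist (g t $ i) (g t' $ i) \<le> L * dist t t'"
        using lipschitz_onD[OF g] by (intro order_trans[OF dist_vec_nth_le])
    qed (rule lipschitz_on_nonneg[OF g])
    then obtain h where "L-lipschitz_on UNIV h" "\<And>t. t \<in> F \<Longrightarrow> h t = g t $ i"
      using lipschitz_extension_real by blast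
    then show ?thesis by blast
  qed
  then have "\<forall>i. \<exists>h. L-lipschitz_on UNIV h \<and> (\<forall>t\<in>F. h t = g t $ i)" by blast
  from choice[OF this] obtain H where
    H: "\<And>i. L-lipschitz_on UNIV (H i)" "\<And>i t. t \<in> F \<Longrightarrow> H i t = g t $ i" by blast
  define h where "h = (\<lambda>t. \<chi> i. H i t)"
  have "(real CARD('n) * L)-lipschitz_on UNIV h"
  proof (rule lipschitz_onI)
    fix t t' :: real
    have "dist (h t) (h t') \<le> (\<Sum>i\<in>UNIV. \<bar>(h t - h t') $ i\<bar>)" unfolding dist_norm by (rule norm_le_l1_cart)
    also have "\<dots> \<le> (\<Sum>i\<in>(UNIV::'n set). L * dist t t')"
      using lipschitz_onD[OF H(1)] by (intro sum_mono) (auto simp: h_def dist_real_def)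
    finally show "dist (h t) (h t') \<le> real CARD('n) * L * dist t t'" by simp
  qed (use lipschitz_on_nonneg[OF g] in auto)
  moreover have "h t = g t" if "t \<in> F" for t using H(2)[OF that] by (simp add: h_def vec_eq_iff)
  ultimately show ?thesis using that by blast
qed

section \<open>The chain rule along pointwise Lipschitz curves\<close>

lemma negligible_if_AE_lebesgue:
  assumes "AE t in lebesgue. P (t::real)"
  shows "negligible {t. \<not> P t}"
proof -
  obtain N where "N \<in> null_sets lebesgue" "{t \<in> space lebesgue. \<not> P t} \<subseteq> N"
    using assms unfolding eventually_ae_filter by blast
  then show ?thesis using negligible_subset[of N] by (auto simp: negligible_iff_null_sets)
qed

lemma negligible_if_countable:
  fixes S :: "real set"
  assumes "countable S"
  shows "negligible S"
  using countable_imp_null_set_lborel[OF assms] by (simp add: negligible_iff_null_sets null_sets_completionI)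

text \<open>
  A derivative at a limit point of \<open>F\<close> is determined by the values on \<open>F\<close>; this compares a curve
  with a Lipschitz curve that agrees with it on \<open>F\<close> only.
\<close>
lemma vector_derivative_unique_along:
  fixes p q :: "real \<Rightarrow> 'a::real_normed_vector"
  assumes t: "t islimpt F" "t \<in> F" and eq: "\<And>s. s \<in> F \<Longrightarrow> p s = q s"
    and p: "(p has_vector_derivative a) (at t)" and q: "(q has_vector_derivative b) (at t)"
  shows "a = b"
proof -
  have p': "(p has_vector_derivative a) (at t within F)"
    and "(q has_vector_derivative b) (at t within F)"
    using p q has_vector_derivative_at_within by blast+
  then have "(p has_vector_derivative b) (at t within F)"
    using has_vector_derivative_transform[OF t(2), of p q] eq by metis
  then show ?thesis
    using p' vector_derivative_unique_within t(1) trivial_limit_within by metis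
qed

lemma locally_lipschitz_at:
  assumes "locally_lipschitz f"
  obtains r L where "r > 0" "L \<ge> 0" "\<And>u v. u \<in> ball x r \<Longrightarrow> v \<in> ball x r \<Longrightarrow> dist (f u) (f v) \<le> L * dist u v"
  using assms lipschitz_onD lipschitz_on_nonneg unfolding locally_lipschitz_def by metis

lemma locally_lipschitz_imp_continuous:
  assumes "locally_lipschitz f"
  shows "continuous_on S f"
proof -
  have "isCont f x" for x
  proof -
    obtain r L where "r > 0" "L-lipschitz_on (ball x r) f"
      using assms unfolding locally_lipschitz_def by blast
    then have "continuous_on (ball x r) f" using lipschitz_on_continuous_on by blast
    then show ?thesis using \<open>r > 0\<close> by (simp add: continuous_on_eq_continuous_at)
  qed
  then show ?thesis by (simp add: continuous_at_imp_continuous_on)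
qed

text \<open>
  Two curves that touch to first order at \<open>t\<close> differ by \<open>o(s - t)\<close>, and so do their images under
  a locally Lipschitz function, which itself may fail to be differentiable at \<open>p t\<close>.
\<close>
lemma has_real_derivative_compose_tangent:
  fixes f :: "'a::real_normed_vector \<Rightarrow> real"
  assumes f: "locally_lipschitz f"
    and p: "(p has_vector_derivative a) (at t)" and q: "(q has_vector_derivative a) (at t)" and pq: "p t = q t"
    and der: "((f \<circ> p) has_real_derivative D) (at t)"
  shows "((f \<circ> q) has_real_derivative D) (at t)"
proof -
  obtain r L where rL: "r > 0" "L \<ge> 0"
    "\<And>u v. u \<in> ball (p t) r \<Longrightarrow> v \<in> ball (p t) r \<Longrightarrow> dist (f u) (f v) \<le> L * dist u v"
    using locally_lipschitz_at[OF f] by blast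
  have "((\<lambda>s. p s - q s) has_vector_derivative 0) (at t)"
    using has_vector_derivative_diff[OF p q] by simp
  then have "((\<lambda>s. (1 / norm (s - t)) *\<^sub>R (p s - q s)) \<longlongrightarrow> 0) (at t)"
    unfolding has_vector_derivative_def has_derivative_at2 using pq by simp
  then have "((\<lambda>s. L * norm ((1 / norm (s - t)) *\<^sub>R (p s - q s))) \<longlongrightarrow> 0) (at t)"
    by (intro tendsto_mult_right_zero tendsto_norm_zero)
  moreover have "eventually (\<lambda>s. norm (((f \<circ> q) s - (f \<circ> p) s) / (s - t)) \<le>
      L * norm ((1 / norm (s - t)) *\<^sub>R (p s - q s))) (at t)"
  proof -
    have "isCont p t" "isCont q t" using p q has_vector_derivative_continuous by blast+
    then have "eventually (\<lambda>s. p s \<in> ball (p t) r) (at t)" "eventually (\<lambda>s. q s \<in> ball (q t) r) (at t)"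
      unfolding isCont_def using rL(1) by (metis topological_tendstoD open_ball centre_in_ball)+
    then show ?thesis
    proof eventually_elim
      case (elim s)
      then have "\<bar>f (q s) - f (p s)\<bar> \<le> L * norm (p s - q s)"
        using rL(3)[of "q s" "p s"] pq by (simp add: dist_norm norm_minus_commute)
      then have "\<bar>f (q s) - f (p s)\<bar> / \<bar>s - t\<bar> \<le> L * norm (p s - q s) / \<bar>s - t\<bar>"
        by (rule divide_right_mono) simp
      then show ?case by (simp add: abs_divide)
    qed
  qed
  ultimately have "((\<lambda>s. ((f \<circ> q) s - (f \<circ> p) s) / (s - t)) \<longlongrightarrow> 0) (at t)"
    by (rule Lim_null_comparison[rotated])
  moreover have "((\<lambda>s. ((f \<circ> p) s - (f \<circ> p) t) / (s - t)) \<longlongrightarrow> D) (at t)"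
    using der by (simp add: has_field_derivative_iff)
  ultimately have "((\<lambda>s. ((f \<circ> q) s - (f \<circ> p) s) / (s - t) + ((f \<circ> p) s - (f \<circ> p) t) / (s - t)) \<longlongrightarrow> 0 + D) (at t)"
    by (rule tendsto_add)
  moreover have "((f \<circ> q) s - (f \<circ> p) s) / (s - t) + ((f \<circ> p) s - (f \<circ> p) t) / (s - t) =
      ((f \<circ> q) s - (f \<circ> q) t) / (s - t)" for s
    unfolding add_divide_distrib[symmetric] using pq by simp
  ultimately show ?thesis
    unfolding has_field_derivative_iff by simp
qed

text \<open>
  Besides the chain rule this yields that a Lipschitz curve is differentiable almost everywhere,
  since the existence of the velocity is part of the definition of a conservative field.
\<close>
lemma conservative_field_lipschitz_curve:
  assumes D: "conservative_field f D" and \<gamma>: "L-lipschitz_on {0..1} \<gamma>"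
  obtains N where "negligible N"
    "\<And>t. t \<in> {0<..<1} - N \<Longrightarrow> \<exists>v. (\<gamma> has_vector_derivative v) (at t) \<and>
        (\<forall>w\<in>D (\<gamma> t). ((f \<circ> \<gamma>) has_real_derivative w \<bullet> v) (at t))"
proof -
  define good where "good = (\<lambda>t. t \<in> {0..1} \<longrightarrow>
           (\<exists>\<gamma>'. (\<gamma> has_vector_derivative \<gamma>') (at t within {0..1}) \<and>
              (\<forall>v\<in>D (\<gamma> t). ((f \<circ> \<gamma>) has_real_derivative v \<bullet> \<gamma>') (at t within {0..1}))))"
  define N where "N = {t. \<not> good t}"
  have "AE t in lebesgue. good t"
    using D lipschitz_on_imp_abs_continuous_on[OF \<gamma>] unfolding conservative_field_def good_def by blast
  then have "negligible N" unfolding N_def by (rule negligible_if_AE_lebesgue)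
  have "at t within {0..1} = at t" if "t \<in> {0<..<1}" for t :: real
    using that by (intro at_within_interior) auto
  then have "\<exists>v. (\<gamma> has_vector_derivative v) (at t) \<and>
        (\<forall>w\<in>D (\<gamma> t). ((f \<circ> \<gamma>) has_real_derivative w \<bullet> v) (at t))" if "t \<in> {0<..<1} - N" for t
    using that unfolding N_def good_def by auto
  then show ?thesis by (rule that[OF \<open>negligible N\<close>])
qed

text \<open>
  The definition of a conservative field covers absolutely continuous curves only. The set
  \<open>F m\<close> collects the times at which \<open>X\<close> is Lipschitz with constant \<open>m\<close> at scale \<open>1 / (m + 1)\<close>.
  These sets cover the unit interval, and on each of them \<open>X\<close> agrees with a Lipschitz curve \<open>Z\<close>, to
  which the definition applies. At a limit point of \<open>F m\<close> both curves have the same velocity, so the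
  derivative of \<open>f \<circ> Z\<close> is also one of \<open>f \<circ> X\<close>; the other points of \<open>F m\<close> are countably many.
\<close>
lemma conservative_field_chain_rule:
  fixes X :: "real \<Rightarrow> real^'n"
  assumes f: "locally_lipschitz f" and D: "conservative_field f D"
    and cont: "continuous_on {0..1} X"
    and plip: "\<And>t. t \<in> {0..1} \<Longrightarrow> pointwise_lipschitz_at {0..1} X t"
  obtains N where "negligible N"
    "\<And>t v w. t \<in> {0<..<1} - N \<Longrightarrow> (X has_vector_derivative v) (at t) \<Longrightarrow> w \<in> D (X t) \<Longrightarrow>
       ((f \<circ> X) has_real_derivative w \<bullet> v) (at t)"
proof -
  define F where "F = (\<lambda>m::nat. {t \<in> {0..1::real}. \<forall>s\<in>{0..1}. \<bar>s - t\<bar> < 1 / real (Suc m) \<longrightarrow>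
      norm (X s - X t) \<le> real m * \<bar>s - t\<bar>})"
  have cover: "\<exists>m. t \<in> F m" if t: "t \<in> {0..1}" for t
  proof -
    obtain B where "eventually (\<lambda>s. norm (X s - X t) \<le> B * \<bar>s - t\<bar>) (at t within {0..1})"
      using plip[OF t] unfolding pointwise_lipschitz_at_def by blast
    then obtain d where d: "d > 0" "\<And>s. s \<in> {0..1} \<Longrightarrow> s \<noteq> t \<Longrightarrow> \<bar>s - t\<bar> < d \<Longrightarrow> norm (X s - X t) \<le> B * \<bar>s - t\<bar>"
      unfolding eventually_at dist_real_def by blast
    obtain m where m: "real m > max B (1 / d)" using reals_Archimedean2 by blast
    have "1 / real (Suc m) < d" using m d(1) by (simp add: field_simps)
    have "norm (X s - X t) \<le> real m * \<bar>s - t\<bar>" if "s \<in> {0..1}" "\<bar>s - t\<bar> < 1 / real (Suc m)" for s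
    proof (cases "s = t")
      case False
      have "norm (X s - X t) \<le> B * \<bar>s - t\<bar>" using d(2)[of s] that False \<open>1 / real (Suc m) < d\<close> by linarith
      also have "\<dots> \<le> real m * \<bar>s - t\<bar>" using m by (intro mult_right_mono) auto
      finally show ?thesis .
    qed simp
    then show ?thesis using t unfolding F_def by blast
  qed
  have "\<exists>N. negligible N \<and> (\<forall>t v w. t \<in> ({0<..<1} \<inter> F m) - N \<longrightarrow> (X has_vector_derivative v) (at t) \<longrightarrow>
      w \<in> D (X t) \<longrightarrow> ((f \<circ> X) has_real_derivative w \<bullet> v) (at t))" for m
  proof -
    have "compact (X ` {0..1})" using cont by (rule compact_continuous_image) simp
    then obtain C where C: "C > 0" "\<And>t. t \<in> {0..1} \<Longrightarrow> norm (X t) \<le> C"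
      using compact_imp_bounded bounded_pos by (metis imageI)
    define K where "K = real m + 2 * C * real (Suc m)"
    have "K-lipschitz_on (F m) X"
    proof (rule lipschitz_onI)
      \<comment> \<open>nearby times are handled by the definition of \<open>F m\<close>, distant ones by the boundedness of \<open>X\<close>\<close>
      show "K \<ge> 0" unfolding K_def using C by auto
      fix s t assume st: "s \<in> F m" "t \<in> F m"
      show "dist (X s) (X t) \<le> K * dist s t"
      proof (cases "\<bar>s - t\<bar> < 1 / real (Suc m)")
        case True
        then have "norm (X s - X t) \<le> real m * \<bar>s - t\<bar>" using st unfolding F_def by blast
        also have "\<dots> \<le> K * \<bar>s - t\<bar>" unfolding K_def using C by (intro mult_right_mono) auto
        finally show ?thesis by (simp add: dist_norm)
      next
        case False
        then have "1 \<le> real (Suc m) * \<bar>s - t\<bar>" by (simp add: field_simps)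
        then have "2 * C * 1 \<le> 2 * C * (real (Suc m) * \<bar>s - t\<bar>)" using C by (intro mult_left_mono) auto
        also have "\<dots> \<le> K * \<bar>s - t\<bar>" unfolding K_def by (simp add: algebra_simps)
        finally have "2 * C \<le> K * \<bar>s - t\<bar>" by simp
        moreover have "norm (X s - X t) \<le> norm (X s) + norm (X t)" by (rule norm_triangle_ineq4)
        moreover have "norm (X s) \<le> C" "norm (X t) \<le> C" using C(2) st unfolding F_def by auto
        ultimately show ?thesis by (simp add: dist_norm)
      qed
    qed
    then obtain Z where Z: "(real CARD('n) * K)-lipschitz_on UNIV Z" "\<And>t. t \<in> F m \<Longrightarrow> Z t = X t"
      using lipschitz_extension_vec by blast
    have "(real CARD('n) * K)-lipschitz_on {0..1} Z" using Z(1) by (rule lipschitz_on_subset) simp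
    from conservative_field_lipschitz_curve[OF D this] obtain N where N: "negligible N"
      "\<And>t. t \<in> {0<..<1} - N \<Longrightarrow> \<exists>v. (Z has_vector_derivative v) (at t) \<and>
        (\<forall>w\<in>D (Z t). ((f \<circ> Z) has_real_derivative w \<bullet> v) (at t))" by blast
    define N' where "N' = N \<union> {t \<in> F m. \<not> t islimpt F m}"
    have "negligible N'" unfolding N'_def
      by (intro negligible_Un N(1) negligible_if_countable countable_isolated_in)
    moreover have "((f \<circ> X) has_real_derivative w \<bullet> v) (at t)"
      if t: "t \<in> ({0<..<1} \<inter> F m) - N'" and v: "(X has_vector_derivative v) (at t)" and w: "w \<in> D (X t)" for t v w
    proof -
      have tF: "t \<in> F m" "t islimpt F m" using t unfolding N'_def by auto
      have "t \<in> {0<..<1} - N" using t unfolding N'_def by auto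
      then obtain v' where v': "(Z has_vector_derivative v') (at t)"
        "\<forall>w\<in>D (Z t). ((f \<circ> Z) has_real_derivative w \<bullet> v') (at t)" using N(2) by blast
      have "v' = v" using vector_derivative_unique_along[OF tF(2,1) Z(2) v'(1) v] .
      then show ?thesis
        using has_real_derivative_compose_tangent[OF f v'(1)] v v'(2) w Z(2)[OF tF(1)] by simp
    qed
    ultimately show ?thesis by blast
  qed
  then have "\<forall>m. \<exists>N. negligible N \<and> (\<forall>t v w. t \<in> ({0<..<1} \<inter> F m) - N \<longrightarrow> (X has_vector_derivative v) (at t) \<longrightarrow>
      w \<in> D (X t) \<longrightarrow> ((f \<circ> X) has_real_derivative w \<bullet> v) (at t))" by blast
  from choice[OF this] obtain N where N: "\<And>m. negligible (N m)"
     "\<And>m t v w. t \<in> ({0<..<1} \<inter> F m) - N m \<Longrightarrow> (X has_vector_derivative v) (at t) \<Longrightarrow>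
      w \<in> D (X t) \<Longrightarrow> ((f \<circ> X) has_real_derivative w \<bullet> v) (at t)" by blast
  have "negligible (\<Union>m. N m)" using N(1) by (intro negligible_countable_Union) auto
  moreover have "((f \<circ> X) has_real_derivative w \<bullet> v) (at t)"
    if "t \<in> {0<..<1} - (\<Union>m. N m)" "(X has_vector_derivative v) (at t)" "w \<in> D (X t)" for t v w
  proof -
    have "t \<in> {0..1}" using that by auto
    then obtain m where "t \<in> F m" using cover by blast
    then show ?thesis using N(2)[of t m v w] that by auto
  qed
  ultimately show ?thesis using that by blast
qed

section \<open>Descent along solutions of the dual inclusion\<close>

text \<open>
  At almost every time \<open>Y' = H X'\<close> for the positive definite derivative \<open>H\<close> of \<open>G\<close> at \<open>X t\<close>, and
  \<open>- Y'\<close> belongs to \<open>D (X t)\<close>, so the chain rule gives \<open>(f \<circ> X)' = - (H X') \<bullet> X' \<le> 0\<close>, with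
  equality only for \<open>Y' = 0\<close>. If \<open>f\<close> takes the same value at the times 0 and \<open>h\<close>, it is constant
  in between, so \<open>0 \<in> D (X t)\<close> for almost all \<open>t < h\<close>, and the closed graph carries this over to \<open>t = 0\<close>.
\<close>
lemma descent_along_dual_solution:
  fixes X Y :: "real \<Rightarrow> real^'n" and G :: "real^'n \<Rightarrow> real^'n"
  assumes f: "locally_lipschitz f" and D: "conservative_field f D"
    and G: "\<And>u. \<exists>H. (G has_derivative H) (at u) \<and> (\<forall>v. v \<noteq> 0 \<longrightarrow> v \<bullet> H v > 0)"
    and X: "continuous_on {0..1} X" and Y: "L-lipschitz_on {0..1} Y"
    and GX: "\<And>t. t \<in> {0..1} \<Longrightarrow> G (X t) = Y t"
    and sol: "\<And>t p. t \<in> {0<..<1} \<Longrightarrow> (Y has_vector_derivative p) (at t) \<Longrightarrow> - p \<in> D (X t)"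
  shows "\<And>s t. 0 \<le> s \<Longrightarrow> s \<le> t \<Longrightarrow> t \<le> 1 \<Longrightarrow> f (X t) \<le> f (X s)"
    and "\<And>h. 0 < h \<Longrightarrow> h \<le> 1 \<Longrightarrow> f (X h) = f (X 0) \<Longrightarrow> 0 \<in> D (X 0)"
proof -
  have L: "L \<ge> 0" using lipschitz_on_nonneg[OF Y] .
  have injH: "\<exists>B>0. \<forall>v. B * norm v \<le> norm (H v)"
    if "(G has_derivative H) (at u)" "\<forall>v. v \<noteq> 0 \<longrightarrow> v \<bullet> H v > 0" for H u
  proof -
    have "linear H" using that(1) has_derivative_linear by blast
    moreover have "inj H"
      unfolding linear_injective_0[OF \<open>linear H\<close>] using that(2) by (metis inner_zero_right less_irrefl)
    ultimately show ?thesis using linear_inj_bounded_below_pos by metis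
  qed
  \<comment> \<open>a nondegenerate derivative of \<open>G\<close> turns the Lipschitz bound on \<open>Y\<close> into one on \<open>X\<close>\<close>
  have plip: "pointwise_lipschitz_at {0..1} X t" if t: "t \<in> {0..1}" for t
  proof -
    obtain H where H: "(G has_derivative H) (at (X t))" "\<forall>v. v \<noteq> 0 \<longrightarrow> v \<bullet> H v > 0" using G by blast
    then obtain B where B: "B > 0" "\<And>v. B * norm v \<le> norm (H v)" using injH by blast
    then obtain d where d: "d > 0" "\<And>y. norm (y - X t) < d \<Longrightarrow> norm (G y - G (X t) - H (y - X t)) \<le> B / 2 * norm (y - X t)"
      using H(1) unfolding has_derivative_at_alt by (metis half_gt_zero)
    have "(X \<longlongrightarrow> X t) (at t within {0..1})" using X t by (simp add: continuous_on_def)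
    then have "eventually (\<lambda>s. dist (X s) (X t) < d) (at t within {0..1})" using d(1) by (rule tendstoD)
    moreover have "eventually (\<lambda>s. s \<in> {0..1}) (at t within {0..1})" by (simp add: eventually_at_filter)
    ultimately have "eventually (\<lambda>s. norm (X s - X t) \<le> (2 * L / B) * \<bar>s - t\<bar>) (at t within {0..1})"
    proof eventually_elim
      case (elim s)
      have "B * norm (X s - X t) \<le> norm (H (X s - X t))" by (rule B(2))
      also have "\<dots> \<le> norm (G (X s) - G (X t)) + norm (G (X s) - G (X t) - H (X s - X t))"
        using norm_triangle_ineq4[of "G (X s) - G (X t)" "G (X s) - G (X t) - H (X s - X t)"] by simp
      also have "norm (G (X s) - G (X t)) \<le> L * \<bar>s - t\<bar>"
        using lipschitz_onD[OF Y] elim t GX by (simp add: dist_norm dist_real_def)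
      also have "norm (G (X s) - G (X t) - H (X s - X t)) \<le> B / 2 * norm (X s - X t)"
        using d(2)[of "X s"] elim by (simp add: dist_norm)
      finally show ?case using B(1) by (simp add: field_simps)
    qed
    then show ?thesis unfolding pointwise_lipschitz_at_def by blast
  qed
  \<comment> \<open>the same nondegeneracy makes \<open>X\<close> differentiable where \<open>Y\<close> is: the inverse function rule along a curve\<close>
  have derX: "\<exists>v. (X has_vector_derivative v) (at t) \<and> H v = p"
    if t: "t \<in> {0<..<1}" and p: "(Y has_vector_derivative p) (at t)"
      and H: "(G has_derivative H) (at (X t))" "\<forall>v. v \<noteq> 0 \<longrightarrow> v \<bullet> H v > 0" for t p H
  proof -
    have lin: "linear H" using H(1) has_derivative_linear by blast
    obtain B where B: "B > 0" "\<And>v. B * norm v \<le> norm (H v)" using injH H by blast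
    have "inj H"
      unfolding linear_injective_0[OF lin] using H(2) by (metis inner_zero_right less_irrefl)
    then obtain v where v: "H v = p" using linear_injective_imp_surjective[OF lin] by (metis surj_def)
    have at: "at t within {0..1} = at t" using t by (intro at_within_interior) auto
    obtain K where K: "eventually (\<lambda>s. norm (X s - X t) \<le> K * \<bar>s - t\<bar>) (at t)"
      using plip[of t] t at unfolding pointwise_lipschitz_at_def by auto
    have in01: "eventually (\<lambda>s. s \<in> {0..1}) (at t)" unfolding at[symmetric] by (simp add: eventually_at_filter)
    have Xt: "(X \<longlongrightarrow> X t) (at t)" using X t at unfolding continuous_on_def by (metis atLeastAtMost_iff greaterThanLessThan_iff less_imp_le)
    have "(X has_derivative (\<lambda>h. h *\<^sub>R v)) (at t)"
      unfolding has_derivative_at_alt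
    proof (intro conjI allI impI)
      show "bounded_linear (\<lambda>h. h *\<^sub>R v)" by (rule bounded_linear_scaleR_left)
      fix e :: real assume "e > 0"
      \<comment> \<open>after division by the lower bound \<open>B\<close> of \<open>H\<close>, each of the two remainders contributes \<open>e / 2\<close>\<close>
      define e1 where "e1 = e * B / 2"
      define e2 where "e2 = e * B / (2 * (\<bar>K\<bar> + 1))"
      have e12: "e1 > 0" "e2 > 0" unfolding e1_def e2_def using \<open>e > 0\<close> B(1) by auto
      obtain d1 where d1: "d1 > 0" "\<And>y. norm (y - X t) < d1 \<Longrightarrow> norm (G y - G (X t) - H (y - X t)) \<le> e2 * norm (y - X t)"
        using H(1) e12(2) unfolding has_derivative_at_alt by metis
      obtain d2 where d2: "d2 > 0" "\<And>s. norm (s - t) < d2 \<Longrightarrow> norm (Y s - Y t - (s - t) *\<^sub>R p) \<le> e1 * norm (s - t)"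
        using p e12(1) unfolding has_vector_derivative_def has_derivative_at_alt by metis
      have "eventually (\<lambda>s. dist (X s) (X t) < d1) (at t)" using Xt d1(1) by (rule tendstoD)
      moreover have "eventually (\<lambda>s. dist s t < d2) (at t)" using tendsto_ident_at d2(1) by (rule tendstoD)
      ultimately have "eventually (\<lambda>s. norm (X s - X t - (s - t) *\<^sub>R v) \<le> e * norm (s - t)) (at t)"
        using K in01
      proof eventually_elim
        case (elim s)
        have Hs: "H (X s - X t - (s - t) *\<^sub>R v) = H (X s - X t) - (s - t) *\<^sub>R p"
          using lin v by (simp add: linear_diff linear_scale)
        have "B * norm (X s - X t - (s - t) *\<^sub>R v) \<le> norm (H (X s - X t) - (s - t) *\<^sub>R p)"
          using B(2)[of "X s - X t - (s - t) *\<^sub>R v"] unfolding Hs .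
        also have "\<dots> = norm ((Y s - Y t - (s - t) *\<^sub>R p) - (G (X s) - G (X t) - H (X s - X t)))"
          using GX[of s] GX[of t] elim t by (simp add: algebra_simps)
        also have "\<dots> \<le> norm (Y s - Y t - (s - t) *\<^sub>R p) + norm (G (X s) - G (X t) - H (X s - X t))"
          by (rule norm_triangle_ineq4)
        also have "norm (Y s - Y t - (s - t) *\<^sub>R p) \<le> e1 * norm (s - t)"
          using d2(2)[of s] elim by (simp add: dist_norm)
        also have "norm (G (X s) - G (X t) - H (X s - X t)) \<le> e2 * norm (X s - X t)"
          using d1(2)[of "X s"] elim by (simp add: dist_norm)
        also have "e2 * norm (X s - X t) \<le> e2 * ((\<bar>K\<bar> + 1) * norm (s - t))"
        proof -
          have "K * \<bar>s - t\<bar> \<le> (\<bar>K\<bar> + 1) * \<bar>s - t\<bar>" by (intro mult_right_mono) auto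
          then have "norm (X s - X t) \<le> (\<bar>K\<bar> + 1) * norm (s - t)" using elim(3) by simp
          then show ?thesis using e12 by (intro mult_left_mono) auto
        qed
        also have "e2 * ((\<bar>K\<bar> + 1) * norm (s - t)) = e1 * norm (s - t)"
          unfolding e1_def e2_def by (simp add: field_simps)
        also have "e1 * norm (s - t) + e1 * norm (s - t) = B * (e * norm (s - t))"
          unfolding e1_def by simp
        finally show ?case using B(1) by simp
      qed
      then obtain d where "d > 0" "\<And>s. s \<noteq> t \<Longrightarrow> dist s t < d \<Longrightarrow> norm (X s - X t - (s - t) *\<^sub>R v) \<le> e * norm (s - t)"
        unfolding eventually_at by blast
      then have "norm (X s - X t - (s - t) *\<^sub>R v) \<le> e * norm (s - t)" if "norm (s - t) < d" for s
        using that by (cases "s = t") (auto simp: dist_norm)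
      then show "\<exists>d>0. \<forall>s. norm (s - t) < d \<longrightarrow> norm (X s - X t - (s - t) *\<^sub>R v) \<le> e * norm (s - t)"
        using \<open>d > 0\<close> by blast
    qed
    then show ?thesis using v unfolding has_vector_derivative_def by blast
  qed
  obtain N1 where N1: "negligible N1" "\<And>t. t \<in> {0<..<1} - N1 \<Longrightarrow> \<exists>v. (Y has_vector_derivative v) (at t) \<and>
        (\<forall>w\<in>D (Y t). ((f \<circ> Y) has_real_derivative w \<bullet> v) (at t))"
    using conservative_field_lipschitz_curve[OF D Y] by blast
  obtain N2 where N2: "negligible N2" "\<And>t v w. t \<in> {0<..<1} - N2 \<Longrightarrow> (X has_vector_derivative v) (at t) \<Longrightarrow> w \<in> D (X t) \<Longrightarrow>
       ((f \<circ> X) has_real_derivative w \<bullet> v) (at t)"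
    using conservative_field_chain_rule[OF f D X plip] by blast
  define N where "N = N1 \<union> N2"
  have N: "negligible N" unfolding N_def using N1(1) N2(1) by (rule negligible_Un)
  have der: "\<exists>p. - p \<in> D (X t) \<and> (\<exists>g'\<le>0. ((f \<circ> X) has_real_derivative g') (at t) \<and> (g' = 0 \<longrightarrow> p = 0))"
    if t: "t \<in> {0<..<1} - N" for t
  proof -
    obtain p where p: "(Y has_vector_derivative p) (at t)" using N1(2)[of t] t unfolding N_def by auto
    then have mem: "- p \<in> D (X t)" using sol t by blast
    obtain H where H: "(G has_derivative H) (at (X t))" "\<forall>v. v \<noteq> 0 \<longrightarrow> v \<bullet> H v > 0" using G by blast
    obtain v where v: "(X has_vector_derivative v) (at t)" "H v = p" using derX[OF _ p H] t by blast
    have "((f \<circ> X) has_real_derivative - p \<bullet> v) (at t)" using N2(2)[OF _ v(1) mem] t unfolding N_def by auto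
    moreover have "- p \<bullet> v \<le> 0 \<and> (- p \<bullet> v = 0 \<longrightarrow> p = 0)"
    proof (cases "v = 0")
      case True
      then have "p = 0" using v(2) H(1) has_derivative_linear linear_0 by blast
      then show ?thesis by simp
    next
      case False
      then have "v \<bullet> p > 0" using H(2) v(2) by auto
      then show ?thesis by (simp add: inner_commute)
    qed
    ultimately show ?thesis using mem by blast
  qed
  have plipf: "pointwise_lipschitz_at {s..r} (f \<circ> X) t"
    if "0 \<le> s" "r \<le> 1" "t \<in> {s..r}" for s r t
  proof -
    obtain \<rho> K where K: "\<rho> > 0" "K \<ge> 0"
      "\<And>u v. u \<in> ball (X t) \<rho> \<Longrightarrow> v \<in> ball (X t) \<rho> \<Longrightarrow> dist (f u) (f v) \<le> K * dist u v"
      using locally_lipschitz_at[OF f] by blast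
    have t: "t \<in> {0..1}" using that by auto
    obtain B where B: "eventually (\<lambda>s. norm (X s - X t) \<le> B * \<bar>s - t\<bar>) (at t within {0..1})"
      using plip[OF t] unfolding pointwise_lipschitz_at_def by blast
    have "(X \<longlongrightarrow> X t) (at t within {0..1})" using X t by (simp add: continuous_on_def)
    then have "eventually (\<lambda>s. dist (X s) (X t) < \<rho>) (at t within {0..1})" using K(1) by (rule tendstoD)
    with B have "eventually (\<lambda>s. norm ((f \<circ> X) s - (f \<circ> X) t) \<le> (K * B) * \<bar>s - t\<bar>) (at t within {0..1})"
    proof eventually_elim
      case (elim s)
      have "dist (f (X s)) (f (X t)) \<le> K * dist (X s) (X t)"
        using K(1) elim(2) by (intro K(3)) (auto simp: dist_commute)
      also have "\<dots> \<le> K * (B * \<bar>s - t\<bar>)" using elim(1) K(2) by (intro mult_left_mono) (auto simp: dist_norm)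
      finally show ?case by (simp add: dist_norm mult.assoc)
    qed
    moreover have "at t within {s..r} \<le> at t within {0..1}" by (rule at_le) (use that in auto)
    ultimately show ?thesis unfolding pointwise_lipschitz_at_def using filter_leD by blast
  qed
  have mono: "f (X t) \<le> f (X s)" if st: "0 \<le> s" "s \<le> t" "t \<le> 1" for s t
  proof -
    have "(f \<circ> X) t \<le> (f \<circ> X) s"
    proof (rule nonincreasing_if_derivative_nonpos_ae[OF st(2) _ N])
      show "continuous_on {s..t} (f \<circ> X)"
        by (rule continuous_on_compose)
          (use X st in \<open>auto intro: continuous_on_subset locally_lipschitz_imp_continuous[OF f]\<close>)
      show "pointwise_lipschitz_at {s..t} (f \<circ> X) r" if "r \<in> {s..t}" for r using plipf st that by blast
      fix r assume "r \<in> {s<..<t} - N"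
      then have "r \<in> {0<..<1} - N" using st by auto
      from der[OF this] show "\<exists>g'\<le>0. ((f \<circ> X) has_real_derivative g') (at r)" by blast
    qed
    then show ?thesis by simp
  qed
  then show "\<And>s t. 0 \<le> s \<Longrightarrow> s \<le> t \<Longrightarrow> t \<le> 1 \<Longrightarrow> f (X t) \<le> f (X s)" .
  show "0 \<in> D (X 0)" if h: "0 < h" "h \<le> 1" "f (X h) = f (X 0)" for h
  proof -
    have const: "f (X t) = f (X 0)" if "t \<in> {0..h}" for t
      using mono[of 0 t] mono[of t h] that h by auto
    have "\<exists>t\<in>{0<..<min h (1 / real (Suc n))}. 0 \<in> D (X t)" for n
    proof -
      define b where "b = min h (1 / real (Suc n))"
      have "b > 0" "b \<le> h" unfolding b_def using h by auto
      have "\<not> {0<..<b} \<subseteq> N"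
        using open_not_negligible[of "{0<..<b}"] negligible_subset[OF N] \<open>b > 0\<close> by auto
      then obtain t where t: "t \<in> {0<..<b}" "t \<notin> N" by blast
      then have "t \<in> {0<..<1} - N" using \<open>b \<le> h\<close> h by auto
      then obtain p g' where p: "- p \<in> D (X t)" "((f \<circ> X) has_real_derivative g') (at t)" "g' = 0 \<Longrightarrow> p = 0"
        using der by blast
      have "((f \<circ> X) has_real_derivative 0) (at t)"
      proof (rule has_field_derivative_transform_within_open[where S = "{0<..<b}" and f = "\<lambda>_. f (X 0)"])
        show "f (X 0) = (f \<circ> X) s" if "s \<in> {0<..<b}" for s using const[of s] that \<open>b \<le> h\<close> by simp
      qed (use t in \<open>auto simp: const\<close>)
      then have "g' = 0" using p(2) DERIV_unique by blast
      then show ?thesis using p t unfolding b_def by auto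
    qed
    then obtain \<tau> where \<tau>: "\<And>n. \<tau> n \<in> {0<..<min h (1 / real (Suc n))}" "\<And>n. 0 \<in> D (X (\<tau> n))" by metis
    have "\<tau> \<longlonglongrightarrow> 0"
    proof (rule tendsto_sandwich)
      show "(\<lambda>_::nat. 0::real) \<longlonglongrightarrow> 0" by simp
      show "(\<lambda>n. 1 / real (Suc n)) \<longlonglongrightarrow> 0" by (rule LIMSEQ_Suc[OF lim_1_over_n])
    qed (use \<tau>(1) in \<open>auto intro!: always_eventually less_imp_le\<close>)
    then have "(\<lambda>n. X (\<tau> n)) \<longlonglongrightarrow> X 0"
      using X \<tau>(1) h(2) unfolding continuous_on_sequentially
      by (auto simp: o_def less_imp_le dest!: bspec[of _ _ 0] spec[of _ \<tau>]) (meson \<tau> less_le_trans less_imp_le greaterThanLessThan_iff min.bounded_iff min_less_iff_conj)+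
    then have "(\<lambda>n. (X (\<tau> n), 0)) \<longlonglongrightarrow> (X 0, 0)" by (intro tendsto_Pair tendsto_const)
    moreover have "closed {(x, v). v \<in> D x}" using D unfolding conservative_field_def by blast
    ultimately have "(X 0, 0) \<in> {(x, v). v \<in> D x}"
      using \<tau>(2) closed_sequentially by (metis (mono_tags, lifting) case_prodI mem_Collect_eq)
    then show ?thesis by simp
  qed
qed

section \<open>Limiting curves of the perturbed dual iteration\<close>

text \<open>
  One path of the method: the step is written in the dual variable \<open>G x\<close>, and the perturbation
  \<open>r\<close> is only required to cancel out over windows in which the step sizes add up to at most 2. Limiting
  curves are taken on the unit interval, which such windows cover.
\<close>
locale perturbed_dual_iteration =
  fixes G :: "real^'n \<Rightarrow> real^'n" and D :: "real^'n \<Rightarrow> (real^'n) set"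
    and \<eta> \<delta> :: "nat \<Rightarrow> real" and x d r :: "nat \<Rightarrow> real^'n" and R :: real
  assumes \<eta>_pos: "\<And>k. 0 < \<eta> k" and \<eta>_lim: "\<eta> \<longlonglongrightarrow> 0"
    and \<eta>_sum: "filterlim (\<lambda>n. \<Sum>k<n. \<eta> k) at_top sequentially"
    and G_cont: "continuous_on UNIV G" and G_inj: "inj G"
    and step: "\<And>k. G (x (Suc k)) = G (x k) - \<eta> k *\<^sub>R (d k + r k)"
    and noise: "\<And>\<epsilon>. \<epsilon> > 0 \<Longrightarrow> \<exists>N. \<forall>s\<ge>N. \<forall>i\<ge>s. (\<Sum>k\<in>{s..<i}. \<eta> k) \<le> 2 \<longrightarrow>
          norm (\<Sum>k\<in>{s..<i}. \<eta> k *\<^sub>R r k) \<le> \<epsilon>"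
    and x_bdd: "bounded (range x)" and d_bdd: "\<And>k. norm (d k) \<le> R"
    and d_mem: "\<And>k. d k \<in> enlargement D (\<delta> k) (x k)"
    and \<delta>_nonneg: "\<And>k. 0 \<le> \<delta> k" and \<delta>_lim: "\<delta> \<longlonglongrightarrow> 0"
    and D_graph: "closed {(x, v). v \<in> D x}" and D_closed: "\<And>y. closed (D y)" and D_convex: "\<And>y. convex (D y)"
begin

text \<open>
  Upper semicontinuity of \<open>D\<close> along the iterates. It follows from the closed graph by compactness,
  because the directions \<open>d k\<close> are bounded; the values of \<open>D\<close> themselves may be unbounded.
\<close>
lemma d_near_D:
  assumes "\<epsilon> > 0"
  obtains \<rho> N where "\<rho> > 0" "\<And>k. k \<ge> N \<Longrightarrow> dist (x k) u < \<rho> \<Longrightarrow> \<exists>v\<in>D u. norm (d k - v) \<le> \<epsilon>"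
proof (rule ccontr)
  assume "\<not> thesis"
  then have "\<not> (\<forall>k. k \<ge> n \<longrightarrow> dist (x k) u < 1 / real (Suc n) \<longrightarrow> (\<exists>v\<in>D u. norm (d k - v) \<le> \<epsilon>))" for n :: nat
    using that[of "1 / real (Suc n)" n] by (metis divide_pos_pos of_nat_0_less_iff zero_less_Suc zero_less_one)
  then have "\<exists>k\<ge>n. dist (x k) u < 1 / real (Suc n) \<and> (\<forall>v\<in>D u. norm (d k - v) > \<epsilon>)" for n :: nat
    by (meson not_le)
  then obtain \<kappa> where \<kappa>: "\<And>n. \<kappa> n \<ge> n" "\<And>n. dist (x (\<kappa> n)) u < 1 / real (Suc n)"
    "\<And>n v. v \<in> D u \<Longrightarrow> norm (d (\<kappa> n) - v) > \<epsilon>" by metis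
  have \<kappa>_top: "filterlim \<kappa> at_top sequentially"
    using \<kappa>(1) by (intro filterlim_at_top_mono[OF filterlim_ident]) auto
  have "\<exists>y v b. norm (y - x k) \<le> \<delta> k \<and> v \<in> D y \<and> norm b \<le> 1 \<and> d k = v + \<delta> k *\<^sub>R b" for k
    using d_mem[of k] unfolding enlargement_def by auto
  then obtain y v b where yvb: "\<And>k. norm (y k - x k) \<le> \<delta> k" "\<And>k. v k \<in> D (y k)"
    "\<And>k. norm (b k) \<le> 1" "\<And>k. d k = v k + \<delta> k *\<^sub>R b k" by metis
  have \<delta>b: "(\<lambda>k. \<delta> k *\<^sub>R b k) \<longlonglongrightarrow> 0"
  proof (rule Lim_null_comparison[OF _ \<delta>_lim])
    have "norm (\<delta> k *\<^sub>R b k) \<le> \<delta> k" for k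
      using mult_left_mono[OF yvb(3) \<delta>_nonneg, of k k] \<delta>_nonneg[of k] by simp
    then show "eventually (\<lambda>k. norm (\<delta> k *\<^sub>R b k) \<le> \<delta> k) sequentially" by simp
  qed
  have "compact (cball (0::real^'n) R)" by simp
  moreover have "\<forall>n. d (\<kappa> n) \<in> cball 0 R" using d_bdd by simp
  ultimately obtain w \<sigma> where \<sigma>: "strict_mono \<sigma>" "((d \<circ> \<kappa>) \<circ> \<sigma>) \<longlonglongrightarrow> w"
    unfolding compact_def by (metis comp_apply)
  define \<tau> where "\<tau> = (\<lambda>n. \<kappa> (\<sigma> n))"
  have \<sigma>_top: "filterlim \<sigma> at_top sequentially" using \<sigma>(1) by (rule filterlim_subseq)
  have \<tau>_top: "filterlim \<tau> at_top sequentially" unfolding \<tau>_def using filterlim_compose[OF \<kappa>_top \<sigma>_top] .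
  have dw: "(\<lambda>n. d (\<tau> n)) \<longlonglongrightarrow> w" using \<sigma>(2) unfolding \<tau>_def o_def .
  have "(\<lambda>n. d (\<tau> n) - \<delta> (\<tau> n) *\<^sub>R b (\<tau> n)) \<longlonglongrightarrow> w - 0"
    by (intro tendsto_diff dw filterlim_compose[OF \<delta>b \<tau>_top])
  then have vw: "(\<lambda>n. v (\<tau> n)) \<longlonglongrightarrow> w" using yvb(4) by simp
  have "(\<lambda>n. x (\<kappa> n) - u) \<longlonglongrightarrow> 0"
  proof (rule Lim_null_comparison)
    show "eventually (\<lambda>n. norm (x (\<kappa> n) - u) \<le> 1 / real (Suc n)) sequentially"
      using \<kappa>(2) by (auto simp: dist_norm less_imp_le)
    show "(\<lambda>n. 1 / real (Suc n)) \<longlonglongrightarrow> 0" by (rule LIMSEQ_Suc[OF lim_1_over_n])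
  qed
  then have xu: "(\<lambda>n. x (\<tau> n) - u) \<longlonglongrightarrow> 0" unfolding \<tau>_def by (rule filterlim_compose[OF _ \<sigma>_top])
  have "(\<lambda>k. y k - x k) \<longlonglongrightarrow> 0" by (rule Lim_null_comparison[OF _ \<delta>_lim]) (use yvb(1) in simp)
  then have "(\<lambda>n. y (\<tau> n) - x (\<tau> n)) \<longlonglongrightarrow> 0" by (rule filterlim_compose[OF _ \<tau>_top])
  from tendsto_add[OF this xu] have "(\<lambda>n. y (\<tau> n) - u) \<longlonglongrightarrow> 0" by simp
  then have "(\<lambda>n. y (\<tau> n)) \<longlonglongrightarrow> u" by (simp add: LIM_zero_iff)
  from tendsto_Pair[OF this vw] have "(\<lambda>n. (y (\<tau> n), v (\<tau> n))) \<longlonglongrightarrow> (u, w)" .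
  then have "(u, w) \<in> {(x, v). v \<in> D x}"
    by (rule closed_sequentially[OF D_graph, rotated]) (use yvb(2) in auto)
  then have "w \<in> D u" by simp
  have "eventually (\<lambda>n. dist (d (\<tau> n)) w < \<epsilon>) sequentially" using dw \<open>\<epsilon> > 0\<close> by (rule tendstoD)
  then obtain n where "dist (d (\<tau> n)) w < \<epsilon>" by (auto simp: eventually_sequentially)
  then show False using \<kappa>(3)[OF \<open>w \<in> D u\<close>, of "\<sigma> n"] unfolding \<tau>_def by (simp add: dist_norm)
qed

definition elapsed :: "nat \<Rightarrow> real" where "elapsed n = (\<Sum>k<n. \<eta> k)"

lemma elapsed_Suc: "elapsed (Suc n) = elapsed n + \<eta> n"
  unfolding elapsed_def by simp

lemma elapsed_mono: "m \<le> n \<Longrightarrow> elapsed m \<le> elapsed n"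
  by (rule lift_Suc_mono_le) (use \<eta>_pos in \<open>auto simp: elapsed_Suc less_imp_le\<close>)

lemma elapsed_diff: "s \<le> i \<Longrightarrow> elapsed i - elapsed s = (\<Sum>k\<in>{s..<i}. \<eta> k)"
  unfolding elapsed_def by (simp add: sum_diff_nat_ivl lessThan_atLeast0)

lemma elapsed_unbounded: "\<exists>n\<ge>s. elapsed n \<ge> c"
proof -
  have "eventually (\<lambda>n. elapsed n \<ge> c) sequentially"
    using \<eta>_sum unfolding elapsed_def filterlim_at_top by blast
  then obtain N where "\<And>n. n \<ge> N \<Longrightarrow> elapsed n \<ge> c" unfolding eventually_sequentially by blast
  then show ?thesis by (intro exI[of _ "max s N"]) auto
qed

lemma index_at_time:
  assumes "elapsed s \<le> \<tau>"
  obtains i where "i \<ge> s" "elapsed i \<le> \<tau>" "\<tau> < elapsed (Suc i)"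
proof -
  obtain n where n: "n \<ge> s" "elapsed n \<ge> \<tau> + 1" using elapsed_unbounded by blast
  define A where "A = {i. i \<ge> s \<and> elapsed i \<le> \<tau>}"
  have "A \<subseteq> {..n}"
  proof
    fix i assume "i \<in> A"
    then have "\<not> n \<le> i" using elapsed_mono[of n i] n unfolding A_def by auto
    then show "i \<in> {..n}" by simp
  qed
  then have fin: "finite A" using finite_subset by blast
  have "s \<in> A" unfolding A_def using assms by simp
  then have "Max A \<in> A" using Max_in[OF fin] by blast
  moreover have "Suc (Max A) \<notin> A" using Max_ge[OF fin, of "Suc (Max A)"] by auto
  ultimately show ?thesis using that[of "Max A"] unfolding A_def by auto
qed

lemma dual_iterate: "s \<le> i \<Longrightarrow> G (x i) = G (x s) - (\<Sum>k\<in>{s..<i}. \<eta> k *\<^sub>R d k) - (\<Sum>k\<in>{s..<i}. \<eta> k *\<^sub>R r k)"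
  by (induction i rule: dec_induct) (auto simp: step scaleR_add_right)

text \<open>
  For \<open>\<tau> \<ge> 0\<close> this is the length of the part of \<open>{0..\<tau>}\<close> inside the time slot
  \<open>{elapsed i..elapsed (Suc i)}\<close> of the \<open>i\<close>-th step. Written as a difference it telescopes.
\<close>
definition overlap :: "nat \<Rightarrow> real \<Rightarrow> real" where
  "overlap i \<tau> = min \<tau> (elapsed (Suc i)) - min \<tau> (elapsed i)"

lemma overlap_mono: "a \<le> b \<Longrightarrow> overlap i a \<le> overlap i b"
  unfolding overlap_def using elapsed_mono[of i "Suc i"] by auto

lemma sum_overlap: "s \<le> n \<Longrightarrow> (\<Sum>i\<in>{s..<n}. overlap i \<tau>) = min \<tau> (elapsed n) - min \<tau> (elapsed s)"
  unfolding overlap_def by (rule sum_Suc_diff')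

text \<open>
  The piecewise linear path, in the time that has passed since step \<open>s\<close>, that starts at the dual
  iterate \<open>G (x s)\<close> and has velocity \<open>- d i\<close> during the \<open>i\<close>-th step. It is stopped after step \<open>n\<close> only
  to keep the sum finite.
\<close>
definition noise_free_path :: "nat \<Rightarrow> nat \<Rightarrow> real \<Rightarrow> real^'n" where
  "noise_free_path s n h = G (x s) - (\<Sum>i\<in>{s..<n}. overlap i (elapsed s + h) *\<^sub>R d i)"

lemma noise_free_path_diff:
  "noise_free_path s n a - noise_free_path s n b =
     (\<Sum>i\<in>{s..<n}. (overlap i (elapsed s + b) - overlap i (elapsed s + a)) *\<^sub>R d i)"
  unfolding noise_free_path_def by (simp add: scaleR_diff_left sum_subtractf)

text \<open>
  The increments of the overlaps are nonnegative and add up to at most the elapsed time.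
\<close>
lemma noise_free_path_lipschitz:
  assumes "s \<le> n"
  shows "norm (noise_free_path s n a - noise_free_path s n b) \<le> R * \<bar>a - b\<bar>"
proof -
  have R: "R \<ge> 0" using d_bdd[of 0] norm_ge_zero order_trans by blast
  have le: "norm (noise_free_path s n a - noise_free_path s n b) \<le> R * (b - a)" if "a \<le> b" for a b
  proof -
    have "norm ((overlap i (elapsed s + b) - overlap i (elapsed s + a)) *\<^sub>R d i)
        \<le> (overlap i (elapsed s + b) - overlap i (elapsed s + a)) * R" for i
      using overlap_mono[of "elapsed s + a" "elapsed s + b" i] that d_bdd[of i]
      by (auto intro!: mult_left_mono)
    then have "norm (noise_free_path s n a - noise_free_path s n b) \<le>
        (\<Sum>i\<in>{s..<n}. (overlap i (elapsed s + b) - overlap i (elapsed s + a)) * R)"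
      unfolding noise_free_path_diff by (intro sum_norm_le)
    also have "\<dots> = ((\<Sum>i\<in>{s..<n}. overlap i (elapsed s + b)) - (\<Sum>i\<in>{s..<n}. overlap i (elapsed s + a))) * R"
      by (simp add: sum_distrib_right[symmetric] sum_subtractf)
    also have "\<dots> \<le> (b - a) * R"
      unfolding sum_overlap[OF assms] by (intro mult_right_mono R) (use that in auto)
    finally show ?thesis by (simp add: mult.commute)
  qed
  show ?thesis
  proof (cases "a \<le> b")
    case True
    then show ?thesis using le[of a b] by simp
  next
    case False
    then show ?thesis using le[of b a] by (simp add: norm_minus_commute)
  qed
qed

lemma noise_free_path_node:
  assumes "s \<le> i" "i \<le> n"
  shows "G (x i) = noise_free_path s n (elapsed i - elapsed s) - (\<Sum>k\<in>{s..<i}. \<eta> k *\<^sub>R r k)"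
proof -
  have "(\<Sum>k\<in>{s..<n}. overlap k (elapsed i) *\<^sub>R d k) = (\<Sum>k\<in>{s..<i}. overlap k (elapsed i) *\<^sub>R d k)"
  proof (rule sum.mono_neutral_right)
    show "\<forall>k\<in>{s..<n} - {s..<i}. overlap k (elapsed i) *\<^sub>R d k = 0"
    proof
      fix k assume "k \<in> {s..<n} - {s..<i}"
      then have "i \<le> k" by auto
      then show "overlap k (elapsed i) *\<^sub>R d k = 0"
        using elapsed_mono[of i k] elapsed_mono[of i "Suc k"] by (simp add: overlap_def)
    qed
  qed (use assms in auto)
  also have "\<dots> = (\<Sum>k\<in>{s..<i}. \<eta> k *\<^sub>R d k)"
  proof (rule sum.cong)
    fix k assume "k \<in> {s..<i}"
    then have "Suc k \<le> i" "k \<le> i" by auto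
    then show "overlap k (elapsed i) *\<^sub>R d k = \<eta> k *\<^sub>R d k"
      using elapsed_mono[of "Suc k" i] elapsed_mono[of k i] by (simp add: overlap_def elapsed_Suc)
  qed simp
  finally show ?thesis unfolding noise_free_path_def dual_iterate[OF assms(1)] by simp
qed

text \<open>
  The noise-free paths started at the times \<open>s j\<close> are equi-Lipschitz, so a subsequence converges
  uniformly to a curve \<open>Y\<close> by Arzela and Ascoli; the dual iterates follow the same limit because the
  noise vanishes over the window. Since \<open>G\<close> is a homeomorphism on a compact ball that contains the
  iterates, \<open>Y\<close> lifts to a continuous primal curve \<open>X\<close>. A difference quotient of \<open>- Y\<close> is a limit
  of convex combinations of directions \<open>d i\<close> at iterates close to \<open>X t\<close>. These directions lie in a
  small closed convex neighbourhood of \<open>D (X t)\<close>, and so does the derivative.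
\<close>
lemma limit_curve:
  fixes s :: "nat \<Rightarrow> nat"
  assumes s: "strict_mono s"
  obtains \<kappa> X Y where "strict_mono (\<kappa> :: nat \<Rightarrow> nat)" "continuous_on {0..1} X" "R-lipschitz_on {0..1} Y"
    "\<And>h. h \<in> {0..1} \<Longrightarrow> G (X h) = Y h"
    "\<And>t p. t \<in> {0<..<1} \<Longrightarrow> (Y has_vector_derivative p) (at t) \<Longrightarrow> - p \<in> D (X t)"
    "\<And>\<epsilon>. \<epsilon> > 0 \<Longrightarrow> \<exists>J. \<forall>j\<ge>J. \<forall>i\<ge>s (\<kappa> j). elapsed i - elapsed (s (\<kappa> j)) \<le> 1 \<longrightarrow>
        norm (x i - X (elapsed i - elapsed (s (\<kappa> j)))) < \<epsilon>"
proof -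
  have R: "R \<ge> 0" using d_bdd[of 0] norm_ge_zero order_trans by blast
  obtain C where C: "\<And>k. norm (x k) \<le> C" using x_bdd unfolding bounded_iff by auto
  define K where "K = cball (0::real^'n) C"
  have xK: "x k \<in> K" for k unfolding K_def using C by simp
  have K: "compact K" unfolding K_def by simp
  have GK: "continuous_on K G" using G_cont continuous_on_subset by blast
  have injK: "inj_on G K" using G_inj inj_on_subset by blast
  have compGK: "compact (G ` K)" using compact_continuous_image[OF GK K] .
  then obtain M where M: "\<And>y. y \<in> G ` K \<Longrightarrow> norm y \<le> M" using compact_imp_bounded bounded_iff by metis
  have "\<forall>a. \<exists>n\<ge>a. elapsed n \<ge> elapsed a + 1" using elapsed_unbounded by blast
  then obtain last where last: "\<And>a. last a \<ge> a" "\<And>a. elapsed (last a) \<ge> elapsed a + 1" by metis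
  define Z where "Z = (\<lambda>j. noise_free_path (s j) (last (s j)))"
  have Zlip: "norm (Z j a - Z j b) \<le> R * \<bar>a - b\<bar>" for j a b
    unfolding Z_def by (rule noise_free_path_lipschitz[OF last(1)])
  have Z0: "Z j 0 = G (x (s j))" for j
  proof -
    have "Z j 0 = G (x (s j)) + (\<Sum>k\<in>{s j..<s j}. \<eta> k *\<^sub>R r k)"
      using noise_free_path_node[of "s j" "s j" "last (s j)"] last(1) unfolding Z_def by simp
    then show ?thesis by simp
  qed
  obtain Y \<kappa> where Y0: "continuous_on {0..1} Y" and \<kappa>: "strict_mono (\<kappa> :: nat \<Rightarrow> nat)"
    and unif: "\<And>e. 0 < e \<Longrightarrow> \<exists>N. \<forall>n h. n \<ge> N \<and> h \<in> {0..1} \<longrightarrow> norm (Z (\<kappa> n) h - Y h) < e"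
  proof (rule Arzela_Ascoli[of "{0..1::real}" Z "M + R"])
    show "norm (Z j h) \<le> M + R" if "h \<in> {0..1}" for j h
    proof -
      have "norm (Z j h) \<le> norm (Z j 0) + norm (Z j h - Z j 0)" by (metis add.commute diff_add_cancel norm_triangle_ineq)
      also have "norm (Z j 0) \<le> M" using M xK Z0 by auto
      also have "norm (Z j h - Z j 0) \<le> R * \<bar>h - 0\<bar>" by (rule Zlip)
      also have "R * \<bar>h - 0\<bar> \<le> R * 1" using that R by (intro mult_left_mono) auto
      finally show ?thesis by simp
    qed
    show "\<exists>d>0. \<forall>n y. y \<in> {0..1} \<and> norm (h - y) < d \<longrightarrow> norm (Z n h - Z n y) < e" if "0 < e" for h e
    proof (intro exI[of _ "e / (R + 1)"] conjI allI impI)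
      show "e / (R + 1) > 0" using that R by simp
      fix n y assume "y \<in> {0..1} \<and> norm (h - y) < e / (R + 1)"
      then have "R * \<bar>h - y\<bar> \<le> R * (e / (R + 1))" using R by (intro mult_left_mono) auto
      also have "\<dots> < e" using R that by (simp add: field_simps)
      finally show "norm (Z n h - Z n y) < e" using Zlip[of n h y] by simp
    qed
  qed (use that in auto)
  have Zlim: "(\<lambda>n. Z (\<kappa> n) h) \<longlonglongrightarrow> Y h" if "h \<in> {0..1}" for h
    using unif that unfolding LIMSEQ_iff by metis
  have Ylip: "R-lipschitz_on {0..1} Y"
  proof (rule lipschitz_onI[OF _ R])
    fix a b :: real assume ab: "a \<in> {0..1}" "b \<in> {0..1}"
    have "(\<lambda>n. norm (Z (\<kappa> n) a - Z (\<kappa> n) b)) \<longlonglongrightarrow> norm (Y a - Y b)"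
      using ab by (intro tendsto_norm tendsto_diff Zlim)
    then have "norm (Y a - Y b) \<le> R * \<bar>a - b\<bar>" by (rule LIMSEQ_le_const2) (use Zlip in auto)
    then show "dist (Y a) (Y b) \<le> R * dist a b" by (simp add: dist_norm)
  qed
  define q where "q = (\<lambda>j. s (\<kappa> j))"
  have q: "q j \<ge> j" for j unfolding q_def using strict_mono_imp_increasing[OF s] strict_mono_imp_increasing[OF \<kappa>] order_trans by blast
  have node: "\<exists>J. \<forall>j\<ge>J. \<forall>i\<ge>q j. elapsed i - elapsed (q j) \<le> 1 \<longrightarrow>
      norm (G (x i) - Y (elapsed i - elapsed (q j))) < \<epsilon>" if "\<epsilon> > 0" for \<epsilon>
  proof -
    obtain N where N: "\<forall>a\<ge>N. \<forall>i\<ge>a. (\<Sum>k\<in>{a..<i}. \<eta> k) \<le> 2 \<longrightarrow> norm (\<Sum>k\<in>{a..<i}. \<eta> k *\<^sub>R r k) \<le> \<epsilon> / 2"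
      using noise[OF half_gt_zero[OF \<open>\<epsilon> > 0\<close>]] by blast
    obtain N' where N': "\<And>n h. n \<ge> N' \<Longrightarrow> h \<in> {0..1} \<Longrightarrow> norm (Z (\<kappa> n) h - Y h) < \<epsilon> / 2"
      using unif[OF half_gt_zero[OF \<open>\<epsilon> > 0\<close>]] by blast
    have "norm (G (x i) - Y (elapsed i - elapsed (q j))) < \<epsilon>"
      if j: "j \<ge> max N N'" and i: "i \<ge> q j" "elapsed i - elapsed (q j) \<le> 1" for i j
    proof -
      define h where "h = elapsed i - elapsed (q j)"
      have h: "h \<in> {0..1}" unfolding h_def using i elapsed_mono[OF i(1)] by simp
      have "i \<le> last (q j)"
      proof (rule ccontr)
        assume "\<not> i \<le> last (q j)"
        then have "Suc (last (q j)) \<le> i" by simp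
        then have "elapsed (Suc (last (q j))) \<le> elapsed i" by (rule elapsed_mono)
        then show False using i(2) last(2)[of "q j"] \<eta>_pos[of "last (q j)"] by (simp add: elapsed_Suc)
      qed
      then have eq: "G (x i) = Z (\<kappa> j) h - (\<Sum>k\<in>{q j..<i}. \<eta> k *\<^sub>R r k)"
        using noise_free_path_node[OF i(1)] unfolding Z_def q_def h_def by simp
      have "norm (G (x i) - Y h) \<le> norm (Z (\<kappa> j) h - Y h) + norm (\<Sum>k\<in>{q j..<i}. \<eta> k *\<^sub>R r k)"
        unfolding eq using norm_triangle_ineq4[of "Z (\<kappa> j) h - Y h" "\<Sum>k\<in>{q j..<i}. \<eta> k *\<^sub>R r k"]
        by (simp add: algebra_simps)
      moreover have "norm (\<Sum>k\<in>{q j..<i}. \<eta> k *\<^sub>R r k) \<le> \<epsilon> / 2"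
        using N q[of j] j i elapsed_diff[OF i(1)] by auto
      moreover have "norm (Z (\<kappa> j) h - Y h) < \<epsilon> / 2" using N' j h by auto
      ultimately show ?thesis unfolding h_def by linarith
    qed
    then show ?thesis by blast
  qed
  have \<eta>_small: "\<exists>J. \<forall>j\<ge>J. \<eta> j < e" if "e > 0" for e
    using order_tendstoD(2)[OF \<eta>_lim that] unfolding eventually_sequentially .
  have YGK: "Y h \<in> G ` K" if h: "h \<in> {0..1}" for h
  proof -
    have "\<exists>y\<in>G ` K. dist y (Y h) < \<epsilon>" if "\<epsilon> > 0" for \<epsilon>
    proof -
      obtain J where J: "\<forall>j\<ge>J. \<forall>i\<ge>q j. elapsed i - elapsed (q j) \<le> 1 \<longrightarrow>
          norm (G (x i) - Y (elapsed i - elapsed (q j))) < \<epsilon> / 2" using node[of "\<epsilon> / 2"] \<open>\<epsilon> > 0\<close> by auto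
      obtain J' where J': "\<forall>j\<ge>J'. \<eta> j < \<epsilon> / (2 * (R + 1))" using \<eta>_small[of "\<epsilon> / (2 * (R + 1))"] \<open>\<epsilon> > 0\<close> R by auto
      define j where "j = max J J'"
      have "elapsed (q j) \<le> elapsed (q j) + h" using h by simp
      then obtain i where i: "i \<ge> q j" "elapsed i \<le> elapsed (q j) + h" "elapsed (q j) + h < elapsed (Suc i)"
        by (rule index_at_time)
      define a where "a = elapsed i - elapsed (q j)"
      have a: "a \<in> {0..1}" unfolding a_def using i h elapsed_mono[OF i(1)] by auto
      have "i \<ge> J'" using i(1) q[of j] unfolding j_def by simp
      then have "\<eta> i < \<epsilon> / (2 * (R + 1))" using J' by blast
      moreover have "\<bar>a - h\<bar> \<le> \<eta> i" using i unfolding a_def by (simp add: elapsed_Suc)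
      ultimately have "R * \<bar>a - h\<bar> \<le> R * (\<epsilon> / (2 * (R + 1)))" using R by (intro mult_left_mono) auto
      also have "\<dots> < \<epsilon> / 2" using R \<open>\<epsilon> > 0\<close> by (simp add: field_simps)
      finally have "dist (Y a) (Y h) < \<epsilon> / 2" using lipschitz_onD[OF Ylip a h] by (simp add: dist_real_def)
      moreover have "dist (G (x i)) (Y a) < \<epsilon> / 2"
        using J i a unfolding a_def j_def by (auto simp: dist_norm)
      ultimately have "dist (G (x i)) (Y h) < \<epsilon>" using dist_triangle[of "G (x i)" "Y h" "Y a"] by linarith
      then show ?thesis using xK by blast
    qed
    then have "Y h \<in> closure (G ` K)" unfolding closure_approachable by blast
    then show ?thesis using compact_imp_closed[OF compGK] by simp
  qed
  define X where "X = (\<lambda>h. inv_into K G (Y h))"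
  have XK: "X h \<in> K" and GX: "G (X h) = Y h" if "h \<in> {0..1}" for h
    unfolding X_def using YGK[OF that] by (auto intro: inv_into_into f_inv_into_f)
  have invc: "continuous_on (G ` K) (inv_into K G)" using GK K injK by (intro continuous_on_inv) auto
  have Xcont: "continuous_on {0..1} X"
    unfolding X_def by (rule continuous_on_compose2[OF invc Y0]) (use YGK in auto)
  have unif_inv: "\<exists>\<theta>>0. \<forall>u\<in>K. \<forall>v\<in>K. dist (G u) (G v) < \<theta> \<longrightarrow> dist u v < \<epsilon>" if "\<epsilon> > 0" for \<epsilon>
  proof -
    have "uniformly_continuous_on (G ` K) (inv_into K G)" using invc compGK by (rule compact_uniformly_continuous)
    then obtain \<theta> where \<theta>: "\<theta> > 0" "\<And>a b. a \<in> G ` K \<Longrightarrow> b \<in> G ` K \<Longrightarrow> dist b a < \<theta> \<Longrightarrow> dist (inv_into K G b) (inv_into K G a) < \<epsilon>"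
      using \<open>\<epsilon> > 0\<close> unfolding uniformly_continuous_on_def by meson
    have "dist u v < \<epsilon>" if "u \<in> K" "v \<in> K" "dist (G u) (G v) < \<theta>" for u v
      using \<theta>(2)[of "G v" "G u"] that injK by simp
    then show ?thesis using \<theta>(1) by blast
  qed
  have close: "\<exists>J. \<forall>j\<ge>J. \<forall>i\<ge>q j. elapsed i - elapsed (q j) \<le> 1 \<longrightarrow>
        norm (x i - X (elapsed i - elapsed (q j))) < \<epsilon>" if "\<epsilon> > 0" for \<epsilon>
  proof -
    obtain \<theta> where \<theta>: "\<theta> > 0" "\<forall>u\<in>K. \<forall>v\<in>K. dist (G u) (G v) < \<theta> \<longrightarrow> dist u v < \<epsilon>" using unif_inv[OF \<open>\<epsilon> > 0\<close>] by blast
    obtain J where J: "\<forall>j\<ge>J. \<forall>i\<ge>q j. elapsed i - elapsed (q j) \<le> 1 \<longrightarrow>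
      norm (G (x i) - Y (elapsed i - elapsed (q j))) < \<theta>" using node[OF \<theta>(1)] by blast
    have "norm (x i - X (elapsed i - elapsed (q j))) < \<epsilon>"
      if "j \<ge> J" "i \<ge> q j" "elapsed i - elapsed (q j) \<le> 1" for i j
    proof -
      have h: "elapsed i - elapsed (q j) \<in> {0..1}" using that elapsed_mono[of "q j" i] by simp
      have "dist (G (x i)) (G (X (elapsed i - elapsed (q j)))) < \<theta>"
        unfolding GX[OF h] dist_norm using J that by blast
      then show ?thesis using \<theta>(2) xK[of i] XK[OF h] by (metis dist_norm)
    qed
    then show ?thesis by blast
  qed
  have sol: "- p \<in> D (X t)" if t: "t \<in> {0<..<1}" and p: "(Y has_vector_derivative p) (at t)" for t p
  proof -
    have t01: "t \<in> {0..1}" using t by auto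
    have "\<exists>v\<in>D (X t). norm (- p - v) \<le> \<epsilon>" if "\<epsilon> > 0" for \<epsilon>
    proof -
      define S where "S = (\<Union>a\<in>D (X t). \<Union>b\<in>cball 0 \<epsilon>. {a + b})"
      have Sc: "convex S"
        unfolding S_def by (rule convex_sums[OF D_convex convex_cball])
      have Scl: "closed S"
        unfolding S_def by (rule closed_compact_sums[OF D_closed compact_cball])
      obtain \<rho> N where \<rho>: "\<rho> > 0" "\<And>k. k \<ge> N \<Longrightarrow> dist (x k) (X t) < \<rho> \<Longrightarrow> \<exists>v\<in>D (X t). norm (d k - v) \<le> \<epsilon>"
        using d_near_D[OF \<open>\<epsilon> > 0\<close>] by blast
      have dS: "d k \<in> S" if "k \<ge> N" "dist (x k) (X t) < \<rho>" for k
      proof -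
        from \<rho>(2)[OF that] obtain v where "v \<in> D (X t)" "norm (d k - v) \<le> \<epsilon>" by blast
        then show ?thesis unfolding S_def by (intro UN_I[of v] UN_I[of "d k - v"]) auto
      qed
      obtain \<theta> where \<theta>: "\<theta> > 0" "\<forall>u\<in>K. \<forall>v\<in>K. dist (G u) (G v) < \<theta> \<longrightarrow> dist u v < \<rho>" using unif_inv[OF \<rho>(1)] by blast
      define c where "c = \<theta> / (2 * (R + 1))"
      have c: "c > 0" "R * c < \<theta> / 2" unfolding c_def using \<theta>(1) R by (auto simp: field_simps)
      obtain J where J: "\<forall>j\<ge>J. \<forall>i\<ge>q j. elapsed i - elapsed (q j) \<le> 1 \<longrightarrow>
          norm (G (x i) - Y (elapsed i - elapsed (q j))) < \<theta> / 2" using node[of "\<theta> / 2"] \<theta>(1) by auto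
      obtain J' where J': "\<forall>j\<ge>J'. \<eta> j < c" using \<eta>_small c by blast
      have quot: "- ((1 / h) *\<^sub>R (Y (t + h) - Y t)) \<in> S" if h: "0 < h" "h < c" "t + h < 1" for h
      proof -
        have th: "t + h \<in> {0..1}" using t h by auto
        have "- ((1 / h) *\<^sub>R (Z (\<kappa> j) (t + h) - Z (\<kappa> j) t)) \<in> S" if j: "j \<ge> max N (max J J')" for j
        proof -
          \<comment> \<open>the share of the window \<open>{t..t + h}\<close> that is spent in the \<open>i\<close>-th step\<close>
          define w where "w = (\<lambda>i. (overlap i (elapsed (q j) + (t + h)) - overlap i (elapsed (q j) + t)) / h)"
          define I where "I = {i \<in> {q j..<last (q j)}. w i \<noteq> 0}"
          have "Z (\<kappa> j) t - Z (\<kappa> j) (t + h) = (\<Sum>i\<in>{q j..<last (q j)}. (h * w i) *\<^sub>R d i)"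
            unfolding Z_def noise_free_path_diff w_def using h by (simp add: q_def)
          also have "\<dots> = h *\<^sub>R (\<Sum>i\<in>{q j..<last (q j)}. w i *\<^sub>R d i)" by (simp add: scaleR_sum_right)
          also have "(\<Sum>i\<in>{q j..<last (q j)}. w i *\<^sub>R d i) = (\<Sum>i\<in>I. w i *\<^sub>R d i)"
            unfolding I_def by (rule sum.mono_neutral_right) auto
          finally have 1: "- ((1 / h) *\<^sub>R (Z (\<kappa> j) (t + h) - Z (\<kappa> j) t)) = (\<Sum>i\<in>I. w i *\<^sub>R d i)"
            using h by (simp flip: scaleR_minus_right)
          have "sum w I = sum w {q j..<last (q j)}"
            unfolding I_def by (rule sum.mono_neutral_left) auto
          also have "\<dots> = ((\<Sum>i\<in>{q j..<last (q j)}. overlap i (elapsed (q j) + (t + h))) -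
              (\<Sum>i\<in>{q j..<last (q j)}. overlap i (elapsed (q j) + t))) / h"
            unfolding w_def by (simp add: sum_divide_distrib[symmetric] sum_subtractf)
          also have "\<dots> = 1"
            unfolding sum_overlap[OF last(1)] using last(2)[of "q j"] t h by (simp add: min_def)
          finally have w1: "sum w I = 1" .
          have w0: "w i \<ge> 0" for i unfolding w_def using overlap_mono h by simp
          have "d i \<in> S" if i: "i \<in> I" for i
          proof -
            have iq: "i \<ge> q j" using i unfolding I_def by simp
            have "overlap i (elapsed (q j) + (t + h)) \<noteq> overlap i (elapsed (q j) + t)"
              using i unfolding I_def w_def by auto
            then have lo: "elapsed i < elapsed (q j) + (t + h)" and hi: "elapsed (Suc i) > elapsed (q j) + t"
              using h elapsed_mono[of i "Suc i"] unfolding overlap_def by (auto simp: min_def split: if_splits)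
            define a where "a = elapsed i - elapsed (q j)"
            have a: "a \<in> {0..1}" unfolding a_def using elapsed_mono[OF iq] lo h by auto
            have "i \<ge> N" "i \<ge> J'" using iq q[of j] j by auto
            have "\<bar>a - t\<bar> \<le> c" using lo hi h J' \<open>i \<ge> J'\<close> c(1) unfolding a_def by (auto simp: elapsed_Suc abs_le_iff)
            then have "R * \<bar>a - t\<bar> \<le> R * c" using R by (rule mult_left_mono)
            then have "dist (Y a) (Y t) < \<theta> / 2" using lipschitz_onD[OF Ylip a t01] c(2) by (simp add: dist_real_def)
            moreover have "dist (G (x i)) (Y a) < \<theta> / 2"
              using J j iq a unfolding a_def by (auto simp: dist_norm)
            ultimately have "dist (G (x i)) (Y t) < \<theta>" using dist_triangle[of "G (x i)" "Y t" "Y a"] by linarith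
            then have "dist (x i) (X t) < \<rho>" using \<theta>(2) xK[of i] XK[OF t01] GX[OF t01] by metis
            then show ?thesis using dS \<open>i \<ge> N\<close> by blast
          qed
          then have "(\<Sum>i\<in>I. w i *\<^sub>R d i) \<in> S"
            by (intro convex_sum Sc w1 w0) (auto simp: I_def)
          then show ?thesis unfolding 1 .
        qed
        moreover have "(\<lambda>j. - ((1 / h) *\<^sub>R (Z (\<kappa> j) (t + h) - Z (\<kappa> j) t))) \<longlonglongrightarrow> - ((1 / h) *\<^sub>R (Y (t + h) - Y t))"
          by (intro tendsto_minus tendsto_scaleR tendsto_const tendsto_diff Zlim th t01)
        ultimately show ?thesis
          using Lim_in_closed_set[OF Scl] by (metis (mono_tags, lifting) eventually_sequentially trivial_limit_sequentially)
      qed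
      have "((\<lambda>s. (1 / norm (s - t)) *\<^sub>R (Y s - (Y t + (s - t) *\<^sub>R p))) \<longlongrightarrow> 0) (at t)"
        using p unfolding has_vector_derivative_def has_derivative_at2 by simp
      then have "((\<lambda>s. (1 / norm (s - t)) *\<^sub>R (Y s - (Y t + (s - t) *\<^sub>R p))) \<longlongrightarrow> 0) (at_right t)"
        by (rule filterlim_mono) (auto intro: at_le)
      then have lim0: "((\<lambda>s. (1 / norm (s - t)) *\<^sub>R (Y s - (Y t + (s - t) *\<^sub>R p)) + p) \<longlongrightarrow> 0 + p) (at_right t)"
        by (intro tendsto_add tendsto_const)
      have lim: "((\<lambda>s. - ((1 / norm (s - t)) *\<^sub>R (Y s - (Y t + (s - t) *\<^sub>R p)) + p)) \<longlongrightarrow> - p) (at_right t)"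
        using tendsto_minus[OF lim0] by simp
      have ev: "eventually (\<lambda>s. - ((1 / norm (s - t)) *\<^sub>R (Y s - (Y t + (s - t) *\<^sub>R p)) + p) \<in> S) (at_right t)"
        unfolding eventually_at_right_field
      proof (intro exI[of _ "min (t + c) 1"] conjI allI impI)
        show "t < min (t + c) 1" using t c by auto
        fix s assume s: "t < s" "s < min (t + c) 1"
        have "(1 / norm (s - t)) *\<^sub>R (Y s - (Y t + (s - t) *\<^sub>R p)) + p = (1 / (s - t)) *\<^sub>R (Y (t + (s - t)) - Y t)"
        proof -
          have "(1 / norm (s - t)) *\<^sub>R ((s - t) *\<^sub>R p) = p" using s by simp
          then show ?thesis using s by (simp add: scaleR_diff_right scaleR_add_right)
        qed
        then show "- ((1 / norm (s - t)) *\<^sub>R (Y s - (Y t + (s - t) *\<^sub>R p)) + p) \<in> S"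
          using quot[of "s - t"] s by simp
      qed
      have "- p \<in> S" by (rule Lim_in_closed_set[OF Scl ev _ lim]) simp
      then obtain a b where "a \<in> D (X t)" "norm b \<le> \<epsilon>" "- p = a + b" unfolding S_def by auto
      then show ?thesis by (intro bexI[of _ a]) auto
    qed
    then have "- p \<in> closure (D (X t))"
      unfolding closure_approachable by (metis dense dist_commute dist_norm le_less_trans)
    then show ?thesis using D_closed by simp
  qed
  show ?thesis
    by (rule that[OF \<kappa> Xcont Ylip GX sol]) (use close in \<open>auto simp: q_def\<close>)
qed

end

section \<open>Convergence of the values and stationarity of cluster points\<close>

context perturbed_dual_iteration
begin

lemma iterate_differences_tendsto_0: "(\<lambda>k. G (x (Suc k)) - G (x k)) \<longlonglongrightarrow> 0"
proof (rule tendstoI)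
  fix e :: real assume e: "e > 0"
  obtain N where N: "\<forall>s\<ge>N. \<forall>i\<ge>s. (\<Sum>k\<in>{s..<i}. \<eta> k) \<le> 2 \<longrightarrow> norm (\<Sum>k\<in>{s..<i}. \<eta> k *\<^sub>R r k) \<le> e / 3"
    using noise[of "e / 3"] e by (metis divide_pos_pos zero_less_numeral)
  have R: "R \<ge> 0" using d_bdd[of 0] norm_ge_zero order_trans by blast
  have "eventually (\<lambda>k. \<eta> k < min 2 (e / (3 * (R + 1)))) sequentially"
    using order_tendstoD(2)[OF \<eta>_lim, of "min 2 (e / (3 * (R + 1)))"] e R by simp
  then show "eventually (\<lambda>k. dist (G (x (Suc k)) - G (x k)) 0 < e) sequentially"
    using eventually_ge_at_top[of N]
  proof eventually_elim
    case (elim k)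
    have "norm (\<eta> k *\<^sub>R d k) \<le> \<eta> k * R" using d_bdd[of k] \<eta>_pos[of k] by simp
    also have "\<dots> \<le> e / (3 * (R + 1)) * R" using elim R by (intro mult_right_mono) auto
    also have "\<dots> \<le> e / 3" using R e by (simp add: field_simps)
    finally have 1: "norm (\<eta> k *\<^sub>R d k) \<le> e / 3" .
    have "norm (\<eta> k *\<^sub>R r k) \<le> e / 3" using N[rule_format, of k "Suc k"] elim by simp
    with 1 have "norm (\<eta> k *\<^sub>R d k + \<eta> k *\<^sub>R r k) \<le> 2 * e / 3"
      by (intro order_trans[OF norm_triangle_ineq]) simp
    then have "norm (\<eta> k *\<^sub>R (d k + r k)) < e" using e by (simp add: scaleR_add_right)
    then show ?case unfolding step by simp
  qed
qed

text \<open>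
  Limiting curves exist for every choice of starting times. The two claims use two
  choices: upcrossings of a noncritical level for the convergence of the values, and times of
  approach to \<open>l\<close> for the stationarity of a cluster point \<open>l\<close>.
\<close>
theorem converges_to_stationary_set:
  assumes f: "locally_lipschitz f" and D: "conservative_field f D"
    and G': "\<And>u. \<exists>H. (G has_derivative H) (at u) \<and> (\<forall>v. v \<noteq> 0 \<longrightarrow> v \<bullet> H v > 0)"
    and crit: "interior {f y |y. 0 \<in> D y} = {}"
  shows "convergent (\<lambda>k. f (x k))" and "\<And>l. cluster_point x l \<Longrightarrow> 0 \<in> D l"
proof -
  have fc: "continuous_on UNIV f" using locally_lipschitz_imp_continuous[OF f] .
  obtain C where C: "\<And>k. norm (x k) \<le> C" using x_bdd unfolding bounded_iff by auto
  define K where "K = cball (0::real^'n) (C + 1)"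
  have K: "compact K" unfolding K_def by simp
  have xK: "x k \<in> K" for k unfolding K_def using C[of k] by simp
  have fu: "uniformly_continuous_on K f"
    using compact_uniformly_continuous[OF continuous_on_subset[OF fc] K] by simp
  \<comment> \<open>every sequence of starting times admits a limiting curve that the values of \<open>f\<close> follow\<close>
  have limit: "\<exists>\<kappa> X. strict_mono (\<kappa>::nat \<Rightarrow> nat) \<and> continuous_on {0..1} X \<and>
      (\<forall>a b. 0 \<le> a \<longrightarrow> a \<le> b \<longrightarrow> b \<le> 1 \<longrightarrow> f (X b) \<le> f (X a)) \<and>
      (\<forall>h. 0 < h \<longrightarrow> h \<le> 1 \<longrightarrow> f (X h) = f (X 0) \<longrightarrow> 0 \<in> D (X 0)) \<and>
      (\<forall>\<epsilon>>0. \<exists>J. \<forall>j\<ge>J. \<forall>i\<ge>s (\<kappa> j). elapsed i - elapsed (s (\<kappa> j)) \<le> 1 \<longrightarrow>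
          norm (x i - X (elapsed i - elapsed (s (\<kappa> j)))) < \<epsilon> \<and>
          \<bar>f (x i) - f (X (elapsed i - elapsed (s (\<kappa> j))))\<bar> < \<epsilon>)"
    if s: "strict_mono s" for s :: "nat \<Rightarrow> nat"
  proof -
    obtain \<kappa> X Y where \<kappa>: "strict_mono (\<kappa> :: nat \<Rightarrow> nat)" and X: "continuous_on {0..1} X" and Y: "R-lipschitz_on {0..1} Y"
      and GX: "\<And>h. h \<in> {0..1} \<Longrightarrow> G (X h) = Y h"
      and sol: "\<And>t p. t \<in> {0<..<1} \<Longrightarrow> (Y has_vector_derivative p) (at t) \<Longrightarrow> - p \<in> D (X t)"
      and close: "\<And>\<epsilon>. \<epsilon> > 0 \<Longrightarrow> \<exists>J. \<forall>j\<ge>J. \<forall>i\<ge>s (\<kappa> j). elapsed i - elapsed (s (\<kappa> j)) \<le> 1 \<longrightarrow>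
        norm (x i - X (elapsed i - elapsed (s (\<kappa> j)))) < \<epsilon>"
      using limit_curve[OF s] by blast
    note descent = descent_along_dual_solution[OF f D G' X Y GX sol]
    have both: "\<exists>J. \<forall>j\<ge>J. \<forall>i\<ge>s (\<kappa> j). elapsed i - elapsed (s (\<kappa> j)) \<le> 1 \<longrightarrow>
          norm (x i - X (elapsed i - elapsed (s (\<kappa> j)))) < \<epsilon> \<and>
          \<bar>f (x i) - f (X (elapsed i - elapsed (s (\<kappa> j))))\<bar> < \<epsilon>" if "\<epsilon> > 0" for \<epsilon>
    proof -
      obtain \<theta> where \<theta>: "\<theta> > 0" "\<And>u v. u \<in> K \<Longrightarrow> v \<in> K \<Longrightarrow> dist v u < \<theta> \<Longrightarrow> dist (f v) (f u) < \<epsilon>"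
        using fu \<open>\<epsilon> > 0\<close> unfolding uniformly_continuous_on_def by meson
      obtain J where J: "\<forall>j\<ge>J. \<forall>i\<ge>s (\<kappa> j). elapsed i - elapsed (s (\<kappa> j)) \<le> 1 \<longrightarrow>
        norm (x i - X (elapsed i - elapsed (s (\<kappa> j)))) < min 1 (min \<theta> \<epsilon>)"
        using close[of "min 1 (min \<theta> \<epsilon>)"] \<theta>(1) \<open>\<epsilon> > 0\<close> by auto
      have "norm (x i - X h) < \<epsilon> \<and> \<bar>f (x i) - f (X h)\<bar> < \<epsilon>" if "norm (x i - X h) < min 1 (min \<theta> \<epsilon>)" for i h
      proof -
        have "norm (X h) \<le> norm (x i) + norm (x i - X h)" using norm_triangle_ineq4[of "x i" "x i - X h"] by simp
        then have "X h \<in> K" unfolding K_def using C[of i] that by simp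
        then have "dist (f (x i)) (f (X h)) < \<epsilon>" using \<theta>(2)[of "X h" "x i"] xK that by (simp add: dist_norm)
        then show ?thesis using that by (simp add: dist_real_def)
      qed
      then show ?thesis using J by blast
    qed
    show ?thesis
      by (intro exI[of _ \<kappa>] exI[of _ X] conjI allI impI) (use \<kappa> X descent both in \<open>blast+\<close>)
  qed
  \<comment> \<open>the increments of the dual iterates vanish, and on a compact set \<open>f\<close> is a uniformly continuous
      function of the dual variable\<close>
  have Finc: "(\<lambda>k. f (x (Suc k)) - f (x k)) \<longlonglongrightarrow> 0"
  proof (rule tendstoI)
    fix e :: real assume e: "e > 0"
    have GK: "continuous_on K G" using G_cont continuous_on_subset by blast
    have "continuous_on (G ` K) (f \<circ> inv_into K G)"
    proof (rule continuous_on_compose)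
      show "continuous_on (G ` K) (inv_into K G)"
        using GK K G_inj by (intro continuous_on_inv) (auto intro!: inv_into_f_f inj_on_subset[OF G_inj])
    qed (use fc continuous_on_subset in blast)
    then have "uniformly_continuous_on (G ` K) (f \<circ> inv_into K G)"
      by (rule compact_uniformly_continuous) (rule compact_continuous_image[OF GK K])
    then obtain \<theta> where \<theta>: "\<theta> > 0" "\<And>u v. u \<in> G ` K \<Longrightarrow> v \<in> G ` K \<Longrightarrow> dist v u < \<theta> \<Longrightarrow>
        dist ((f \<circ> inv_into K G) v) ((f \<circ> inv_into K G) u) < e"
      using e unfolding uniformly_continuous_on_def by meson
    have inv: "(f \<circ> inv_into K G) (G (x k)) = f (x k)" for k
      using xK inv_into_f_f[OF inj_on_subset[OF G_inj]] by (simp add: o_def)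
    have "eventually (\<lambda>k. dist (G (x (Suc k)) - G (x k)) 0 < \<theta>) sequentially"
      using iterate_differences_tendsto_0 \<theta>(1) by (rule tendstoD)
    then show "eventually (\<lambda>k. dist (f (x (Suc k)) - f (x k)) 0 < e) sequentially"
    proof eventually_elim
      case (elim k)
      then have "dist (G (x (Suc k))) (G (x k)) < \<theta>" by (simp add: dist_norm)
      from \<theta>(2)[OF _ _ this] xK have "dist (f (x (Suc k))) (f (x k)) < e" unfolding inv by blast
      then show ?case by (simp add: dist_norm)
    qed
  qed
  have Fbdd: "\<exists>B. \<forall>k. \<bar>f (x k)\<bar> \<le> B"
  proof -
    have "bounded (f ` K)" using compact_continuous_image[OF continuous_on_subset[OF fc] K] compact_imp_bounded by blast
    then show ?thesis using xK unfolding bounded_iff by (metis imageI real_norm_def)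
  qed
  have no_crossing: False
    if c: "c \<notin> {f y |y. 0 \<in> D y}" "\<epsilon> > 0" and low: "\<And>n. \<exists>k\<ge>n. f (x k) \<le> c" and high: "\<And>n. \<exists>k\<ge>n. f (x k) \<ge> c + \<epsilon>"
    for c \<epsilon>
  proof -
    have "\<exists>s>n. \<exists>e>s. f (x s) \<le> c \<and> f (x e) \<ge> c + \<epsilon> \<and> (\<forall>k. s < k \<longrightarrow> k \<le> e \<longrightarrow> f (x k) > c)" for n
    proof -
      obtain a where a: "a \<ge> Suc n" "f (x a) \<le> c" using low by blast
      obtain e where e: "e \<ge> a" "f (x e) \<ge> c + \<epsilon>" using high by blast
      define A where "A = {k \<in> {a..e}. f (x k) \<le> c}"
      have fin: "finite A" unfolding A_def by simp
      have "a \<in> A" unfolding A_def using a e by simp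
      then have "Max A \<in> A" "a \<le> Max A" using Max_in[OF fin] Max_ge[OF fin] by auto
      then have s: "Max A \<ge> a" "Max A \<le> e" "f (x (Max A)) \<le> c" unfolding A_def by auto
      have "Max A \<noteq> e" using s(3) e(2) c(2) by auto
      then have "Max A < e" using s by simp
      moreover have "f (x k) > c" if "Max A < k" "k \<le> e" for k
      proof (rule ccontr)
        assume "\<not> f (x k) > c"
        then have "k \<in> A" unfolding A_def using that s by auto
        then show False using Max_ge[OF fin] that by force
      qed
      ultimately show ?thesis using s a e by (intro exI[of _ "Max A"] exI[of _ e] conjI) auto
    qed
    then obtain S E where SE: "\<And>n. S n > n" "\<And>n. E n > S n" "\<And>n. f (x (S n)) \<le> c" "\<And>n. f (x (E n)) \<ge> c + \<epsilon>"
      "\<And>n k. S n < k \<Longrightarrow> k \<le> E n \<Longrightarrow> f (x k) > c" by metis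
    define t where "t = rec_nat 0 (\<lambda>_ m. S m)"
    have t_Suc: "t (Suc n) = S (t n)" for n unfolding t_def by simp
    define s where "s = (\<lambda>n. t (Suc n))"
    define e where "e = (\<lambda>n. E (t n))"
    have s: "strict_mono s" unfolding s_def by (rule strict_monoI_Suc) (metis t_Suc SE(1))
    have se: "e n > s n" "f (x (s n)) \<le> c" "f (x (e n)) \<ge> c + \<epsilon>" "\<And>k. s n < k \<Longrightarrow> k \<le> e n \<Longrightarrow> f (x k) > c" for n
      unfolding s_def e_def t_Suc using SE by auto
    obtain \<kappa> X where \<kappa>: "strict_mono (\<kappa>::nat \<Rightarrow> nat)" and X: "continuous_on {0..1} X"
      and mono: "\<And>a b. 0 \<le> a \<Longrightarrow> a \<le> b \<Longrightarrow> b \<le> 1 \<Longrightarrow> f (X b) \<le> f (X a)"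
      and strict: "\<And>h. 0 < h \<Longrightarrow> h \<le> 1 \<Longrightarrow> f (X h) = f (X 0) \<Longrightarrow> 0 \<in> D (X 0)"
      and close: "\<And>\<epsilon>. \<epsilon> > 0 \<Longrightarrow> \<exists>J. \<forall>j\<ge>J. \<forall>i\<ge>s (\<kappa> j). elapsed i - elapsed (s (\<kappa> j)) \<le> 1 \<longrightarrow>
          norm (x i - X (elapsed i - elapsed (s (\<kappa> j)))) < \<epsilon> \<and>
          \<bar>f (x i) - f (X (elapsed i - elapsed (s (\<kappa> j))))\<bar> < \<epsilon>"
      using limit[OF s] by blast
    define q where "q = (\<lambda>j. s (\<kappa> j))"
    have q_ge: "q j \<ge> j" for j
      unfolding q_def using strict_mono_imp_increasing[OF s] strict_mono_imp_increasing[OF \<kappa>] order_trans by blast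
    have X0: "f (X 0) = c"
    proof -
      have "\<bar>f (X 0) - c\<bar> \<le> \<theta>" if \<theta>: "\<theta> > 0" for \<theta>
      proof -
        obtain J where J: "\<forall>j\<ge>J. \<forall>i\<ge>q j. elapsed i - elapsed (q j) \<le> 1 \<longrightarrow>
          norm (x i - X (elapsed i - elapsed (q j))) < \<theta> / 2 \<and>
          \<bar>f (x i) - f (X (elapsed i - elapsed (q j)))\<bar> < \<theta> / 2"
          using close[of "\<theta> / 2"] \<theta> unfolding q_def by auto
        obtain J' where J': "\<forall>k\<ge>J'. \<bar>f (x (Suc k)) - f (x k)\<bar> < \<theta> / 2"
          using tendstoD[OF Finc, of "\<theta> / 2"] \<theta> unfolding eventually_sequentially by auto
        define j where "j = max J J'"
        have "\<bar>f (x (q j)) - f (X 0)\<bar> < \<theta> / 2" using J[rule_format, of j "q j"] unfolding j_def by simp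
        moreover have "\<bar>f (x (Suc (q j))) - f (x (q j))\<bar> < \<theta> / 2" using J' q_ge[of j] unfolding j_def by auto
        moreover have "f (x (q j)) \<le> c" unfolding q_def by (rule se(2))
        moreover have "f (x (Suc (q j))) > c" using se(4)[of "\<kappa> j" "Suc (q j)"] se(1)[of "\<kappa> j"] unfolding q_def by simp
        ultimately show ?thesis by linarith
      qed
      then show ?thesis using field_le_epsilon[of "\<bar>f (X 0) - c\<bar>" 0] by simp
    qed
    have "0 \<notin> D (X 0)" using c(1) X0 by blast
    \<comment> \<open>the limiting curve leaves the level \<open>c\<close> downwards at once, the upcrossings stay above \<open>c\<close>\<close>
    define g where "g = c - f (X (1 / 2))"
    have "f (X (1 / 2)) \<noteq> c" using strict[of "1 / 2"] X0 \<open>0 \<notin> D (X 0)\<close> by auto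
    then have g: "g > 0" unfolding g_def using mono[of 0 "1 / 2"] X0 by simp
    define \<theta> where "\<theta> = min g \<epsilon>"
    have \<theta>: "\<theta> > 0" unfolding \<theta>_def using g c(2) by simp
    obtain J where J: "\<forall>j\<ge>J. \<forall>i\<ge>q j. elapsed i - elapsed (q j) \<le> 1 \<longrightarrow>
          norm (x i - X (elapsed i - elapsed (q j))) < \<theta> \<and>
          \<bar>f (x i) - f (X (elapsed i - elapsed (q j)))\<bar> < \<theta>"
      using close[OF \<theta>] unfolding q_def by auto
    obtain J' where J': "\<forall>j\<ge>J'. \<eta> j < 1 / 2"
      using order_tendstoD(2)[OF \<eta>_lim, of "1 / 2"] unfolding eventually_sequentially by auto
    define j where "j = max J J'"
    have late: "elapsed (e (\<kappa> j)) - elapsed (q j) > 1"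
    proof (rule ccontr)
      assume "\<not> elapsed (e (\<kappa> j)) - elapsed (q j) > 1"
      then have le: "elapsed (e (\<kappa> j)) - elapsed (q j) \<le> 1" by simp
      have eq: "e (\<kappa> j) \<ge> q j" using se(1)[of "\<kappa> j"] unfolding q_def by simp
      have "\<bar>f (x (e (\<kappa> j))) - f (X (elapsed (e (\<kappa> j)) - elapsed (q j)))\<bar> < \<theta>"
        using J eq le unfolding j_def by simp
      moreover have "f (X (elapsed (e (\<kappa> j)) - elapsed (q j))) \<le> c"
        using mono[of 0 "elapsed (e (\<kappa> j)) - elapsed (q j)"] elapsed_mono[OF eq] le X0 by simp
      moreover have "f (x (e (\<kappa> j))) \<ge> c + \<epsilon>" by (rule se(3))
      ultimately show False unfolding \<theta>_def by linarith
    qed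
    have "elapsed (q j) \<le> elapsed (q j) + 1" by simp
    then obtain i where i: "i \<ge> q j" "elapsed i \<le> elapsed (q j) + 1" "elapsed (q j) + 1 < elapsed (Suc i)"
      by (rule index_at_time)
    have "\<eta> i < 1 / 2" using J' i(1) q_ge[of j] unfolding j_def by auto
    then have half: "elapsed i - elapsed (q j) \<ge> 1 / 2" using i(3) by (simp add: elapsed_Suc)
    have "\<not> e (\<kappa> j) \<le> i" using late i(2) elapsed_mono[of "e (\<kappa> j)" i] by auto
    moreover have "i \<noteq> q j" using half by auto
    ultimately have "f (x i) > c" using se(4)[of "\<kappa> j" i] i(1) unfolding q_def by simp
    moreover have "\<bar>f (x i) - f (X (elapsed i - elapsed (q j)))\<bar> < \<theta>"
      using J i unfolding j_def by simp
    moreover have "f (X (elapsed i - elapsed (q j))) \<le> f (X (1 / 2))"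
      using mono[of "1 / 2" "elapsed i - elapsed (q j)"] half i(2) by simp
    ultimately show False unfolding \<theta>_def g_def by linarith
  qed
  show conv: "convergent (\<lambda>k. f (x k))"
  proof (rule ccontr)
    assume nc: "\<not> convergent (\<lambda>k. f (x k))"
    obtain B where B: "\<And>k. \<bar>f (x k)\<bar> \<le> B" using Fbdd by blast
    have bdd: "bounded (range (\<lambda>k. f (x k)))" unfolding bounded_iff using B by (auto intro: exI[of _ B])
    then obtain l1 \<sigma> where \<sigma>: "strict_mono (\<sigma>::nat \<Rightarrow> nat)" "((\<lambda>k. f (x k)) \<circ> \<sigma>) \<longlonglongrightarrow> l1"
      using bounded_imp_convergent_subsequence by blast
    have "\<not> (\<lambda>k. f (x k)) \<longlonglongrightarrow> l1" using nc unfolding convergent_def by blast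
    then obtain \<epsilon> where \<epsilon>: "\<epsilon> > 0" "\<And>n. \<exists>k\<ge>n. \<bar>f (x k) - l1\<bar> \<ge> \<epsilon>"
      unfolding LIMSEQ_iff by (auto simp: not_less)
    have near: "\<exists>k\<ge>n. \<bar>f (x k) - l1\<bar> < \<theta>" if \<theta>: "\<theta> > 0" for \<theta> n
    proof -
      obtain N where "\<And>k. k \<ge> N \<Longrightarrow> \<bar>f (x (\<sigma> k)) - l1\<bar> < \<theta>" using \<sigma>(2) \<theta> unfolding LIMSEQ_iff by auto
      moreover have "\<sigma> (max n N) \<ge> n" using strict_mono_imp_increasing[OF \<sigma>(1), of "max n N"] by simp
      ultimately show ?thesis by (intro exI[of _ "\<sigma> (max n N)"]) auto
    qed
    have noncrit: "\<exists>c. a < c \<and> c < b \<and> c \<notin> {f y |y. 0 \<in> D y}" if "a < b" for a b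
    proof (rule ccontr)
      assume "\<not> (\<exists>c. a < c \<and> c < b \<and> c \<notin> {f y |y. 0 \<in> D y})"
      then have "{a<..<b} \<subseteq> {f y |y. 0 \<in> D y}" by auto
      then have "{a<..<b} \<subseteq> interior {f y |y. 0 \<in> D y}" by (rule interior_maximal) simp
      then show False using crit that by auto
    qed
    consider (up) "\<And>n. \<exists>k\<ge>n. f (x k) \<ge> l1 + \<epsilon>" | (down) "\<And>n. \<exists>k\<ge>n. f (x k) \<le> l1 - \<epsilon>"
    proof (cases "\<forall>n. \<exists>k\<ge>n. f (x k) \<ge> l1 + \<epsilon>")
      case False
      then obtain n where n: "\<And>k. k \<ge> n \<Longrightarrow> f (x k) < l1 + \<epsilon>" by (meson not_le)
      have "\<exists>k\<ge>m. f (x k) \<le> l1 - \<epsilon>" for m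
      proof -
        obtain k where "k \<ge> max m n" "\<bar>f (x k) - l1\<bar> \<ge> \<epsilon>" using \<epsilon>(2) by blast
        then show ?thesis using n[of k] by (intro exI[of _ k]) auto
      qed
      then show ?thesis by (rule down)
    qed (use up in blast)
    then show False
    proof cases
      case up
      obtain c where c: "l1 < c" "c < l1 + \<epsilon>" "c \<notin> {f y |y. 0 \<in> D y}" using noncrit[of l1 "l1 + \<epsilon>"] \<epsilon>(1) by auto
      show False
      proof (rule no_crossing[OF c(3), of "l1 + \<epsilon> - c"])
        show "\<exists>k\<ge>n. f (x k) \<le> c" for n
        proof -
          obtain k where "k \<ge> n" "\<bar>f (x k) - l1\<bar> < c - l1" using near[of "c - l1" n] c(1) by auto
          then show ?thesis by (intro exI[of _ k]) auto
        qed
      qed (use c up in auto)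
    next
      case down
      obtain c where c: "l1 - \<epsilon> < c" "c < l1" "c \<notin> {f y |y. 0 \<in> D y}" using noncrit[of "l1 - \<epsilon>" l1] \<epsilon>(1) by auto
      show False
      proof (rule no_crossing[OF c(3), of "(l1 - c) / 2"])
        show "\<exists>k\<ge>n. f (x k) \<le> c" for n
        proof -
          obtain k where "k \<ge> n" "f (x k) \<le> l1 - \<epsilon>" using down by blast
          then show ?thesis using c by (intro exI[of _ k]) auto
        qed
        show "\<exists>k\<ge>n. f (x k) \<ge> c + (l1 - c) / 2" for n
        proof -
          obtain k where "k \<ge> n" "\<bar>f (x k) - l1\<bar> < (l1 - c) / 2" using near[of "(l1 - c) / 2" n] c(2) by auto
          moreover from this have "f (x k) \<ge> c + (l1 - c) / 2" by argo
          ultimately show ?thesis by blast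
        qed
      qed (use c in auto)
    qed
  qed
  then obtain F where F: "(\<lambda>k. f (x k)) \<longlonglongrightarrow> F" unfolding convergent_def by blast
  show "0 \<in> D l" if "cluster_point x l" for l
  proof -
    obtain s where s: "strict_mono s" "(x \<circ> s) \<longlonglongrightarrow> l" using \<open>cluster_point x l\<close> unfolding cluster_point_def by blast
    obtain \<kappa> X where \<kappa>: "strict_mono (\<kappa>::nat \<Rightarrow> nat)" and X: "continuous_on {0..1} X"
      and strict: "\<And>h. 0 < h \<Longrightarrow> h \<le> 1 \<Longrightarrow> f (X h) = f (X 0) \<Longrightarrow> 0 \<in> D (X 0)"
      and close: "\<And>\<epsilon>. \<epsilon> > 0 \<Longrightarrow> \<exists>J. \<forall>j\<ge>J. \<forall>i\<ge>s (\<kappa> j). elapsed i - elapsed (s (\<kappa> j)) \<le> 1 \<longrightarrow>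
          norm (x i - X (elapsed i - elapsed (s (\<kappa> j)))) < \<epsilon> \<and>
          \<bar>f (x i) - f (X (elapsed i - elapsed (s (\<kappa> j))))\<bar> < \<epsilon>"
      using limit[OF s(1)] by blast
    define q where "q = (\<lambda>j. s (\<kappa> j))"
    have q: "strict_mono q" unfolding q_def using s(1) \<kappa> by (auto simp: strict_mono_def)
    have q_ge: "q j \<ge> j" for j using strict_mono_imp_increasing[OF q] .
    have FX: "f (X h) = F" if h: "h \<in> {0..1}" for h
    proof -
      have "\<exists>i. i \<ge> q j \<and> elapsed i \<le> elapsed (q j) + h \<and> elapsed (q j) + h < elapsed (Suc i)" for j
      proof -
        have "elapsed (q j) \<le> elapsed (q j) + h" using h by simp
        then show ?thesis using index_at_time by blast
      qed
      then obtain i where i: "\<And>j. i j \<ge> q j" "\<And>j. elapsed (i j) \<le> elapsed (q j) + h"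
        "\<And>j. elapsed (q j) + h < elapsed (Suc (i j))" by metis
      have "j \<le> i j" for j using i(1)[of j] q_ge[of j] by simp
      then have itop: "filterlim i at_top sequentially"
        by (intro filterlim_at_top_mono[OF filterlim_ident]) (auto intro!: always_eventually)
      define a where "a = (\<lambda>j. elapsed (i j) - elapsed (q j))"
      have a: "a j \<in> {0..1}" for j unfolding a_def using i(2)[of j] h elapsed_mono[OF i(1)[of j]] by auto
      have "(\<lambda>j. a j - h) \<longlonglongrightarrow> 0"
      proof (rule Lim_null_comparison)
        show "eventually (\<lambda>j. norm (a j - h) \<le> \<eta> (i j)) sequentially"
          using i(2,3) unfolding a_def by (auto simp: elapsed_Suc abs_le_iff algebra_simps less_imp_le)
        show "(\<lambda>j. \<eta> (i j)) \<longlonglongrightarrow> 0" by (rule filterlim_compose[OF \<eta>_lim itop])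
      qed
      then have "a \<longlonglongrightarrow> h" by (simp add: LIM_zero_iff)
      moreover have "continuous_on {0..1} (\<lambda>h. f (X h))"
        by (rule continuous_on_compose2[OF fc X]) auto
      ultimately have 1: "(\<lambda>j. f (X (a j))) \<longlonglongrightarrow> f (X h)"
        using continuous_on_tendsto_compose[of "{0..1}" "\<lambda>h. f (X h)" a h] h a by auto
      have "(\<lambda>j. f (x (i j)) - f (X (a j))) \<longlonglongrightarrow> 0"
      proof (rule tendstoI)
        fix \<theta> :: real assume "\<theta> > 0"
        then obtain J where J: "\<forall>j\<ge>J. \<forall>i\<ge>q j. elapsed i - elapsed (q j) \<le> 1 \<longrightarrow>
          norm (x i - X (elapsed i - elapsed (q j))) < \<theta> \<and>
          \<bar>f (x i) - f (X (elapsed i - elapsed (q j)))\<bar> < \<theta>"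
          using close unfolding q_def by blast
        have "dist (f (x (i j)) - f (X (a j))) 0 < \<theta>" if "j \<ge> J" for j
          using J that i(1)[of j] a[of j] unfolding a_def by simp
        then show "eventually (\<lambda>j. dist (f (x (i j)) - f (X (a j))) 0 < \<theta>) sequentially"
          unfolding eventually_sequentially by blast
      qed
      from tendsto_add[OF this 1] have "(\<lambda>j. f (x (i j))) \<longlonglongrightarrow> f (X h)" by simp
      moreover have "(\<lambda>j. f (x (i j))) \<longlonglongrightarrow> F" by (rule filterlim_compose[OF F itop])
      ultimately show ?thesis by (rule LIMSEQ_unique)
    qed
    have "X 0 = l"
    proof -
      have "(\<lambda>j. x (q j) - X 0) \<longlonglongrightarrow> 0"
      proof (rule tendstoI)
        fix \<theta> :: real assume "\<theta> > 0"
        then obtain J where J: "\<forall>j\<ge>J. \<forall>i\<ge>q j. elapsed i - elapsed (q j) \<le> 1 \<longrightarrow>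
          norm (x i - X (elapsed i - elapsed (q j))) < \<theta> \<and>
          \<bar>f (x i) - f (X (elapsed i - elapsed (q j)))\<bar> < \<theta>"
          using close unfolding q_def by blast
        have "dist (x (q j) - X 0) 0 < \<theta>" if "j \<ge> J" for j
          using J[rule_format, of j "q j"] that by simp
        then show "eventually (\<lambda>j. dist (x (q j) - X 0) 0 < \<theta>) sequentially"
          unfolding eventually_sequentially by blast
      qed
      then have "(\<lambda>j. x (q j)) \<longlonglongrightarrow> X 0" by (simp add: LIM_zero_iff)
      moreover have "(\<lambda>j. x (q j)) \<longlonglongrightarrow> l"
        using LIMSEQ_subseq_LIMSEQ[OF s(2) \<kappa>] unfolding q_def o_def .
      ultimately show ?thesis by (rule LIMSEQ_unique)
    qed
    then show ?thesis using strict[of 1] FX[of 1] FX[of 0] by simp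
  qed
qed

end

section \<open>Martingale noise over windows of bounded length\<close>

context prob_space
begin

text \<open>
  Integrability and the decrease of expectations are asked for on the event that the process has
  stayed below \<open>c\<close>, where \<open>Y n\<close> is bounded. Induction on \<open>n\<close> shows that
  \<open>c\<close> times the probability of having reached \<open>c\<close> by time \<open>n\<close>, plus the expectation of \<open>Y n\<close> on the
  complementary event, never exceeds the initial value.
\<close>
lemma supermartingale_maximal_inequality:
  fixes Y :: "nat \<Rightarrow> 'a \<Rightarrow> real"
  assumes meas [measurable]: "\<And>n. Y n \<in> borel_measurable M"
    and nonneg: "\<And>n \<omega>. 0 \<le> Y n \<omega>" and init: "\<And>\<omega>. Y 0 \<omega> = y\<^sub>0" and "c > 0"
    and int: "\<And>n. integrable M (\<lambda>\<omega>. indicator {\<omega> \<in> space M. \<forall>j\<le>n. Y j \<omega> < c} \<omega> * Y (Suc n) \<omega>)"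
    and step: "\<And>n. expectation (\<lambda>\<omega>. indicator {\<omega> \<in> space M. \<forall>j\<le>n. Y j \<omega> < c} \<omega> * Y (Suc n) \<omega>) \<le>
      expectation (\<lambda>\<omega>. indicator {\<omega> \<in> space M. \<forall>j\<le>n. Y j \<omega> < c} \<omega> * Y n \<omega>)"
  shows "c * prob {\<omega> \<in> space M. \<exists>n. Y n \<omega> \<ge> c} \<le> y\<^sub>0"
proof -
  define A where "A = (\<lambda>n. {\<omega> \<in> space M. \<forall>j\<le>n. Y j \<omega> < c})"
  define B where "B = (\<lambda>n. {\<omega> \<in> space M. \<exists>j\<le>n. Y j \<omega> \<ge> c})"
  have [measurable]: "A n \<in> sets M" "B n \<in> sets M" for n unfolding A_def B_def by measurable
  have intA: "integrable M (\<lambda>\<omega>. indicator (A n) \<omega> * Y n \<omega>)" for n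
  proof (rule integrable_const_bound[of _ c])
    show "AE \<omega> in M. norm (indicator (A n) \<omega> * Y n \<omega>) \<le> c"
      using nonneg \<open>c > 0\<close> by (auto simp: A_def indicator_def less_imp_le)
  qed measurable
  have intB: "integrable M (\<lambda>\<omega>. c * indicator (B n) \<omega>)" for n
    by (intro integrable_mult_right integrable_real_indicator) (auto simp: emeasure_eq_measure)
  have bound: "c * prob (B n) + expectation (\<lambda>\<omega>. indicator (A n) \<omega> * Y n \<omega>) \<le> y\<^sub>0" for n
  proof (induction n)
    case 0
    have "c * prob (B 0) + expectation (\<lambda>\<omega>. indicator (A 0) \<omega> * Y 0 \<omega>) =
        expectation (\<lambda>\<omega>. c * indicator (B 0) \<omega> + indicator (A 0) \<omega> * Y 0 \<omega>)"
      by (simp only: Bochner_Integration.integral_add[OF intB intA]) simp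
    also have "\<dots> \<le> expectation (\<lambda>\<omega>. y\<^sub>0)"
    proof (rule integral_mono)
      show "integrable M (\<lambda>\<omega>. c * indicator (B 0) \<omega> + indicator (A 0) \<omega> * Y 0 \<omega>)"
        using intA intB by (rule Bochner_Integration.integrable_add[rotated])
      show "c * indicator (B 0) \<omega> + indicator (A 0) \<omega> * Y 0 \<omega> \<le> y\<^sub>0" if "\<omega> \<in> space M" for \<omega>
        using that init[of \<omega>] nonneg[of 0 \<omega>] by (auto simp: A_def B_def indicator_def)
    qed simp
    finally show ?case by (simp add: prob_space)
  next
    case (Suc n)
    have int': "integrable M (\<lambda>\<omega>. indicator (A n) \<omega> * Y (Suc n) \<omega>)" using int[of n] unfolding A_def .
    have "c * prob (B (Suc n)) + expectation (\<lambda>\<omega>. indicator (A (Suc n)) \<omega> * Y (Suc n) \<omega>) =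
        expectation (\<lambda>\<omega>. c * indicator (B (Suc n)) \<omega> + indicator (A (Suc n)) \<omega> * Y (Suc n) \<omega>)"
      by (simp only: Bochner_Integration.integral_add[OF intB intA]) simp
    also have "\<dots> \<le> expectation (\<lambda>\<omega>. c * indicator (B n) \<omega> + indicator (A n) \<omega> * Y (Suc n) \<omega>)"
    proof (rule integral_mono)
      show "integrable M (\<lambda>\<omega>. c * indicator (B (Suc n)) \<omega> + indicator (A (Suc n)) \<omega> * Y (Suc n) \<omega>)"
        using intA intB by (rule Bochner_Integration.integrable_add[rotated])
      show "integrable M (\<lambda>\<omega>. c * indicator (B n) \<omega> + indicator (A n) \<omega> * Y (Suc n) \<omega>)"
        using int' intB by (rule Bochner_Integration.integrable_add[rotated])
      fix \<omega> assume \<omega>: "\<omega> \<in> space M"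
      show "c * indicator (B (Suc n)) \<omega> + indicator (A (Suc n)) \<omega> * Y (Suc n) \<omega> \<le>
          c * indicator (B n) \<omega> + indicator (A n) \<omega> * Y (Suc n) \<omega>"
      proof (cases "\<omega> \<in> A n")
        case True
        then have "\<omega> \<notin> B n" unfolding A_def B_def by force
        have "\<omega> \<in> A (Suc n) \<longleftrightarrow> Y (Suc n) \<omega> < c" using True unfolding A_def by (auto simp: le_Suc_eq)
        moreover have "\<omega> \<in> B (Suc n) \<longleftrightarrow> Y (Suc n) \<omega> \<ge> c"
          using \<open>\<omega> \<notin> B n\<close> \<omega> unfolding B_def by (auto simp: le_Suc_eq)
        ultimately show ?thesis using True \<open>\<omega> \<notin> B n\<close> by (auto simp: indicator_def)
      next
        case False
        then have "\<omega> \<in> B n" "\<omega> \<in> B (Suc n)" "\<omega> \<notin> A (Suc n)"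
          using \<omega> unfolding A_def B_def by (auto simp: not_less le_Suc_eq)
        then show ?thesis using False by simp
      qed
    qed
    also have "\<dots> = c * prob (B n) + expectation (\<lambda>\<omega>. indicator (A n) \<omega> * Y (Suc n) \<omega>)"
      by (simp only: Bochner_Integration.integral_add[OF intB int']) simp
    also have "\<dots> \<le> y\<^sub>0" using Suc step[of n] unfolding A_def by linarith
    finally show ?case .
  qed
  have le: "c * prob (B n) \<le> y\<^sub>0" for n
  proof -
    have "0 \<le> expectation (\<lambda>\<omega>. indicator (A n) \<omega> * Y n \<omega>)"
      using nonneg by (intro integral_nonneg_AE) auto
    then show ?thesis using bound[of n] by linarith
  qed
  have "incseq B" unfolding incseq_def B_def using order_trans by blast
  then have "(\<lambda>n. prob (B n)) \<longlonglongrightarrow> prob (\<Union>n. B n)" by (intro finite_Lim_measure_incseq) auto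
  moreover have "(\<Union>n. B n) = {\<omega> \<in> space M. \<exists>n. Y n \<omega> \<ge> c}" unfolding B_def by auto
  ultimately have "(\<lambda>n. c * prob (B n)) \<longlonglongrightarrow> c * prob {\<omega> \<in> space M. \<exists>n. Y n \<omega> \<ge> c}"
    by (intro tendsto_mult_left) simp
  then show ?thesis by (rule LIMSEQ_le_const2) (use le in auto)
qed

end

lemma exp_le_quadratic:
  fixes x :: real
  assumes "\<bar>x\<bar> \<le> 1"
  shows "exp x \<le> 1 + x + x\<^sup>2"
proof (cases "x \<ge> 0")
  case True
  then show ?thesis using exp_bound[of x] assms by simp
next
  case False
  define y where "y = - x"
  have y: "0 \<le> y" "y \<le> 1" unfolding y_def using False assms by auto
  have "(1 - y + y\<^sup>2) * (1 + y) = 1 + y ^ 3" by algebra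
  then have "1 \<le> (1 - y + y\<^sup>2) * (1 + y)" using y by simp
  also have "\<dots> \<le> (1 - y + y\<^sup>2) * exp y"
    using y by (intro mult_left_mono exp_ge_add_one_self) auto
  finally have "1 \<le> (1 - y + y\<^sup>2) * exp y" .
  then have "exp (- y) \<le> 1 - y + y\<^sup>2" by (simp add: exp_minus field_simps)
  then show ?thesis unfolding y_def by simp
qed

locale martingale_noise = prob_space M for M :: "'w measure" +
  fixes \<xi> :: "nat \<Rightarrow> 'w \<Rightarrow> real^'n"
  assumes \<xi>_meas [measurable]: "\<And>k. \<xi> k \<in> borel_measurable M"
    and mdn: "martingale_difference_noise M \<xi>"
begin

abbreviation "\<F> \<equiv> natural_filtration M \<xi>"

lemma nth_meas [measurable]: "X \<in> borel_measurable N \<Longrightarrow> (\<lambda>\<omega>. X \<omega> $ i) \<in> borel_measurable N"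
  for X :: "'b \<Rightarrow> real^'n"
  by (rule measurable_compose[OF _ borel_measurable_continuous_onI]) (auto intro: continuous_intros)

lemma filtration_generators_subset: "(\<Union>i\<le>k. {\<xi> i -` A \<inter> space M |A. A \<in> sets borel}) \<subseteq> Pow (space M)"
  by auto

lemma space_filtration [simp]: "space (\<F> k) = space M"
  unfolding natural_filtration_def by (simp add: space_measure_of_conv)

lemma sets_filtration: "sets (\<F> k) = sigma_sets (space M) (\<Union>i\<le>k. {\<xi> i -` A \<inter> space M |A. A \<in> sets borel})"
  unfolding natural_filtration_def using filtration_generators_subset by (rule sets_measure_of)

lemma subalgebra_filtration: "subalgebra M (\<F> k)"
proof -
  have "(\<Union>i\<le>k. {\<xi> i -` A \<inter> space M |A. A \<in> sets borel}) \<subseteq> sets M"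
    using \<xi>_meas by (auto intro: measurable_sets)
  then have "sets (\<F> k) \<subseteq> sets M" unfolding sets_filtration by (rule sets.sigma_sets_subset)
  then show ?thesis unfolding subalgebra_def by simp
qed

lemma \<xi>_meas_filtration:
  assumes "i \<le> k"
  shows "\<xi> i \<in> borel_measurable (\<F> k)"
proof (rule measurableI)
  fix A :: "(real^'n) set" assume "A \<in> sets borel"
  then have "\<xi> i -` A \<inter> space M \<in> (\<Union>i\<le>k. {\<xi> i -` A \<inter> space M |A. A \<in> sets borel})" using assms by auto
  then show "\<xi> i -` A \<inter> space (\<F> k) \<in> sets (\<F> k)" unfolding sets_filtration by (simp add: sigma_sets.Basic)
qed auto

lemma finite_measure_subalgebra_filtration: "finite_measure_subalgebra M (\<F> k)"
  by unfold_locales (rule subalgebra_filtration)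

lemma meas_from_filtration: "Z \<in> borel_measurable (\<F> k) \<Longrightarrow> Z \<in> borel_measurable M"
  using measurable_from_subalg[OF subalgebra_filtration] .

text \<open>
  The form in which the martingale difference property is used: the weight \<open>Z\<close> will be a function
  of the partial sums of the noise, cut off where they are large.
\<close>
lemma noise_orthogonal:
  fixes Z :: "'w \<Rightarrow> real"
  assumes Z: "Z \<in> borel_measurable (\<F> k)" and B: "\<And>\<omega>. \<bar>Z \<omega>\<bar> \<le> B"
  shows "integrable M (\<lambda>\<omega>. Z \<omega> * \<xi> (Suc k) \<omega> $ i)" "expectation (\<lambda>\<omega>. Z \<omega> * \<xi> (Suc k) \<omega> $ i) = 0"
proof -
  interpret finite_measure_subalgebra M "\<F> k" by (rule finite_measure_subalgebra_filtration)
  have [measurable]: "Z \<in> borel_measurable M" using meas_from_filtration[OF Z] .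
  have \<xi>: "integrable M (\<xi> (Suc k))" "AE \<omega> in M. vec_cond_exp M (\<F> k) (\<xi> (Suc k)) \<omega> = 0"
    using mdn unfolding martingale_difference_noise_def by auto
  have "integrable M (\<lambda>\<omega>. B * norm (\<xi> (Suc k) \<omega>))" using \<xi>(1) by simp
  then show int: "integrable M (\<lambda>\<omega>. Z \<omega> * \<xi> (Suc k) \<omega> $ i)"
  proof (rule Bochner_Integration.integrable_bound)
    show "AE \<omega> in M. norm (Z \<omega> * \<xi> (Suc k) \<omega> $ i) \<le> norm (B * norm (\<xi> (Suc k) \<omega>))"
    proof (intro AE_I2)
      fix \<omega>
      have "\<bar>Z \<omega>\<bar> * \<bar>\<xi> (Suc k) \<omega> $ i\<bar> \<le> \<bar>B\<bar> * norm (\<xi> (Suc k) \<omega>)"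
        using B[of \<omega>] component_le_norm_cart[of "\<xi> (Suc k) \<omega>" i] by (intro mult_mono) auto
      then show "norm (Z \<omega> * \<xi> (Suc k) \<omega> $ i) \<le> norm (B * norm (\<xi> (Suc k) \<omega>))" by (simp add: abs_mult)
    qed
  qed measurable
  have "expectation (\<lambda>\<omega>. Z \<omega> * \<xi> (Suc k) \<omega> $ i) =
      expectation (\<lambda>\<omega>. Z \<omega> * real_cond_exp M (\<F> k) (\<lambda>\<omega>. \<xi> (Suc k) \<omega> $ i) \<omega>)"
    by (rule real_cond_exp_intg(2)[symmetric]) (use int Z in auto)
  also have "\<dots> = expectation (\<lambda>\<omega>. 0)"
  proof (rule integral_cong_AE)
    show "AE \<omega> in M. Z \<omega> * real_cond_exp M (\<F> k) (\<lambda>\<omega>. \<xi> (Suc k) \<omega> $ i) \<omega> = 0"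
      using \<xi>(2) by eventually_elim (simp add: vec_cond_exp_def vec_eq_iff)
  qed measurable
  finally show "expectation (\<lambda>\<omega>. Z \<omega> * \<xi> (Suc k) \<omega> $ i) = 0" by simp
qed

lemma below_threshold_in_filtration:
  fixes Y :: "nat \<Rightarrow> 'w \<Rightarrow> real"
  assumes "\<And>j. j \<le> n \<Longrightarrow> Y j \<in> borel_measurable (\<F> k)"
  shows "{\<omega> \<in> space M. \<forall>j\<le>n. Y j \<omega> < c} \<in> sets (\<F> k)"
proof -
  have "{\<omega> \<in> space (\<F> k). \<forall>j\<in>{..n}. Y j \<omega> < c} \<in> sets (\<F> k)"
  proof (rule sets.sets_Collect_finite_All')
    fix j assume "j \<in> {..n}"
    then have "Y j \<in> borel_measurable (\<F> k)" using assms by simp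
    then have "Y j -` {..<c} \<inter> space (\<F> k) \<in> sets (\<F> k)" by (rule measurable_sets) simp
    moreover have "{\<omega> \<in> space (\<F> k). Y j \<omega> < c} = Y j -` {..<c} \<inter> space (\<F> k)" by blast
    ultimately show "{\<omega> \<in> space (\<F> k). Y j \<omega> < c} \<in> sets (\<F> k)" by (simp only:)
  qed simp_all
  then show ?thesis by (simp only: space_filtration atMost_iff Ball_def)
qed

text \<open>
  Let \<open>\<theta>\<close> be proportional to \<open>1 / b\<close>. The process \<open>exp (\<theta> S n - V n)\<close>, where \<open>V n\<close> is the sum
  of the \<open>(\<theta> \<eta> k C)\<^sup>2\<close>, is a supermartingale, since \<open>exp u \<le> 1 + u + u\<^sup>2\<close> for \<open>\<bar>u\<bar> \<le> 1\<close> and the linear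
  term averages to zero. As long as the step sizes add up to at most 2, the correction \<open>V n\<close> is at
  most \<open>\<theta> \<alpha> / 2\<close>, so that reaching the height \<open>\<alpha>\<close> forces the process above \<open>exp (\<theta> \<alpha> / 2)\<close>.
\<close>
lemma bounded_noise_tail:
  assumes C: "C \<ge> 1" "\<And>k. AE \<omega> in M. norm (\<xi> k \<omega>) \<le> C" and \<tau>: "\<bar>\<tau>\<bar> = 1"
    and "s \<ge> 1" and \<eta>_pos: "\<And>k. \<eta> k > 0" and b: "\<And>k. k \<ge> s \<Longrightarrow> \<eta> k \<le> b" and \<alpha>: "0 < \<alpha>" "\<alpha> \<le> 1"
  shows "prob {\<omega> \<in> space M. \<exists>n. (\<Sum>k\<in>{s..<s + n}. \<eta> k) \<le> 2 \<and> (\<Sum>k\<in>{s..<s + n}. \<eta> k * (\<tau> * \<xi> k \<omega> $ i)) \<ge> \<alpha>}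
    \<le> exp (- (\<alpha>\<^sup>2 / (8 * C\<^sup>2 * b)))"
proof -
  have "b > 0" using \<eta>_pos[of s] b[of s] by simp
  \<comment> \<open>small enough that \<open>\<theta> \<eta> k C \<le> 1\<close>, and that \<open>2 \<theta> a C\<^sup>2\<close>, a bound for \<open>V n\<close>, is at most \<open>\<theta> \<alpha> / 2\<close>\<close>
  define a where "a = \<alpha> / (4 * C\<^sup>2)"
  define \<theta> where "\<theta> = a / b"
  have "a > 0" unfolding a_def using \<alpha> C by simp
  then have "\<theta> > 0" unfolding \<theta>_def using \<open>b > 0\<close> by simp
  have aC: "a * C \<le> 1"
  proof -
    have "\<alpha> * C \<le> 1 * C" using C \<alpha> by (intro mult_right_mono) auto
    also have "\<dots> \<le> 4 * C\<^sup>2" using C by (simp add: power2_eq_square)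
    finally show ?thesis unfolding a_def using C by (simp add: field_simps)
  qed
  have \<theta>\<eta>: "\<theta> * \<eta> k \<le> a" if "k \<ge> s" for k
    unfolding \<theta>_def using b[OF that] \<open>b > 0\<close> \<open>a > 0\<close> by (simp add: field_simps)
  define S where "S = (\<lambda>n \<omega>. \<Sum>k\<in>{s..<s + n}. \<eta> k * (\<tau> * \<xi> k \<omega> $ i))"
  define V where "V = (\<lambda>n. \<Sum>k\<in>{s..<s + n}. (\<theta> * \<eta> k * C)\<^sup>2)"
  define Y where "Y = (\<lambda>n \<omega>. exp (\<theta> * S n \<omega> - V n))"
  define c where "c = exp (\<alpha>\<^sup>2 / (8 * C\<^sup>2 * b))"
  have "c > 0" unfolding c_def by simp
  have S_meas: "S n \<in> borel_measurable (\<F> (s + n - 1))" for n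
    unfolding S_def
    by (intro borel_measurable_sum borel_measurable_times borel_measurable_const nth_meas \<xi>_meas_filtration) auto
  have Y_meas: "Y n \<in> borel_measurable (\<F> k)" if "s + n - 1 \<le> k" for n k
  proof -
    have "S n \<in> borel_measurable (\<F> k)"
      unfolding S_def using that
      by (intro borel_measurable_sum borel_measurable_times borel_measurable_const nth_meas \<xi>_meas_filtration) auto
    then show ?thesis unfolding Y_def by measurable
  qed
  have Y_measM [measurable]: "Y n \<in> borel_measurable M" for n by (rule meas_from_filtration[OF Y_meas[OF order_refl]])
  have SSuc: "S (Suc n) \<omega> = S n \<omega> + \<eta> (s + n) * (\<tau> * \<xi> (s + n) \<omega> $ i)" for n \<omega> unfolding S_def by simp
  have VSuc: "V (Suc n) = V n + (\<theta> * \<eta> (s + n) * C)\<^sup>2" for n unfolding V_def by simp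
  have main: "integrable M (\<lambda>\<omega>. indicator {\<omega> \<in> space M. \<forall>j\<le>n. Y j \<omega> < c} \<omega> * Y (Suc n) \<omega>) \<and>
      expectation (\<lambda>\<omega>. indicator {\<omega> \<in> space M. \<forall>j\<le>n. Y j \<omega> < c} \<omega> * Y (Suc n) \<omega>) \<le>
      expectation (\<lambda>\<omega>. indicator {\<omega> \<in> space M. \<forall>j\<le>n. Y j \<omega> < c} \<omega> * Y n \<omega>)" for n
  proof -
    define k where "k = s + n - 1"
    have k: "Suc k = s + n" unfolding k_def using \<open>s \<ge> 1\<close> by simp
    define A where "A = {\<omega> \<in> space M. \<forall>j\<le>n. Y j \<omega> < c}"
    have A: "A \<in> sets (\<F> k)"
      unfolding A_def by (intro below_threshold_in_filtration Y_meas) (simp add: k_def)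
    define Z where "Z = (\<lambda>\<omega>. indicator A \<omega> * Y n \<omega>)"
    have Zm: "Z \<in> borel_measurable (\<F> k)"
      unfolding Z_def using A by (intro borel_measurable_times borel_measurable_indicator Y_meas) (auto simp: k_def)
    have ZmM [measurable]: "Z \<in> borel_measurable M" using meas_from_filtration[OF Zm] .
    have Z0: "0 \<le> Z \<omega>" for \<omega> unfolding Z_def Y_def by simp
    have Zc: "\<bar>Z \<omega>\<bar> \<le> c" for \<omega>
      unfolding Z_def using \<open>c > 0\<close> by (auto simp: A_def indicator_def Y_def less_imp_le)
    define v where "v = (\<theta> * \<eta> (Suc k) * C)\<^sup>2"
    define X where "X = (\<lambda>\<omega>. \<theta> * \<eta> (Suc k) * (\<tau> * \<xi> (Suc k) \<omega> $ i))"
    have [measurable]: "X \<in> borel_measurable M" unfolding X_def by measurable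
    have YSuc: "indicator A \<omega> * Y (Suc n) \<omega> = Z \<omega> * exp (X \<omega> - v)" for \<omega>
      unfolding Z_def Y_def SSuc VSuc k[symmetric] X_def v_def
      by (simp add: exp_add[symmetric] algebra_simps)
    have Xb: "AE \<omega> in M. \<bar>X \<omega>\<bar> \<le> \<theta> * \<eta> (Suc k) * C"
      using C(2)[of "Suc k"]
    proof eventually_elim
      case (elim \<omega>)
      have "\<bar>\<tau> * \<xi> (Suc k) \<omega> $ i\<bar> \<le> C"
        using component_le_norm_cart[of "\<xi> (Suc k) \<omega>" i] elim \<tau> by (simp add: abs_mult)
      then show ?case unfolding X_def using \<open>\<theta> > 0\<close> \<eta>_pos[of "Suc k"] by (simp add: abs_mult)
    qed
    have small: "\<theta> * \<eta> (Suc k) * C \<le> 1"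
    proof -
      have "\<theta> * \<eta> (Suc k) * C \<le> a * C" using \<theta>\<eta>[of "Suc k"] k C(1) by (intro mult_right_mono) auto
      then show ?thesis using aC by linarith
    qed
    have ZX: "integrable M (\<lambda>\<omega>. Z \<omega> * X \<omega>)" "expectation (\<lambda>\<omega>. Z \<omega> * X \<omega>) = 0"
    proof -
      have eq: "Z \<omega> * X \<omega> = (\<theta> * \<eta> (Suc k) * \<tau>) * (Z \<omega> * \<xi> (Suc k) \<omega> $ i)" for \<omega> unfolding X_def by simp
      show "integrable M (\<lambda>\<omega>. Z \<omega> * X \<omega>)" "expectation (\<lambda>\<omega>. Z \<omega> * X \<omega>) = 0"
        unfolding eq using noise_orthogonal[OF Zm Zc] by simp_all
    qed
    have intZ: "integrable M Z" using Zc by (intro integrable_const_bound[of _ c]) auto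
    have rhs: "integrable M (\<lambda>\<omega>. exp (- v) * ((1 + v) * Z \<omega> + Z \<omega> * X \<omega>))"
      using intZ ZX(1) by auto
    have le: "AE \<omega> in M. Z \<omega> * exp (X \<omega> - v) \<le> exp (- v) * ((1 + v) * Z \<omega> + Z \<omega> * X \<omega>)"
      using Xb
    proof eventually_elim
      case (elim \<omega>)
      have "exp (X \<omega>) \<le> 1 + X \<omega> + (X \<omega>)\<^sup>2" using elim small by (intro exp_le_quadratic) auto
      also have "(X \<omega>)\<^sup>2 \<le> v" unfolding v_def using elim by (intro abs_le_square_iff[THEN iffD1]) auto
      finally have "Z \<omega> * exp (X \<omega>) \<le> Z \<omega> * (1 + X \<omega> + v)" using Z0 by (intro mult_left_mono) auto
      then have "exp (- v) * (Z \<omega> * exp (X \<omega>)) \<le> exp (- v) * (Z \<omega> * (1 + X \<omega> + v))"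
        by (rule mult_left_mono) simp
      then show ?case by (simp add: exp_diff exp_minus field_simps)
    qed
    have int: "integrable M (\<lambda>\<omega>. Z \<omega> * exp (X \<omega> - v))"
    proof (rule Bochner_Integration.integrable_bound[OF rhs])
      show "AE \<omega> in M. norm (Z \<omega> * exp (X \<omega> - v)) \<le> norm (exp (- v) * ((1 + v) * Z \<omega> + Z \<omega> * X \<omega>))"
        using le
      proof eventually_elim
        case (elim \<omega>)
        have "0 \<le> Z \<omega> * exp (X \<omega> - v)" using Z0[of \<omega>] by simp
        then show ?case using elim by simp
      qed
    qed measurable
    have "expectation (\<lambda>\<omega>. Z \<omega> * exp (X \<omega> - v)) \<le> expectation (\<lambda>\<omega>. exp (- v) * ((1 + v) * Z \<omega> + Z \<omega> * X \<omega>))"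
      by (rule integral_mono_AE[OF int rhs le])
    also have "\<dots> = exp (- v) * (1 + v) * expectation Z"
      using intZ ZX by simp
    also have "\<dots> \<le> 1 * expectation Z"
    proof (rule mult_right_mono)
      have "exp (- v) * (1 + v) \<le> exp (- v) * exp v" by (intro mult_left_mono exp_ge_add_one_self) auto
      then show "exp (- v) * (1 + v) \<le> 1" by (simp add: exp_minus)
      show "0 \<le> expectation Z" using Z0 by (intro integral_nonneg_AE) auto
    qed
    finally show ?thesis
      using int unfolding YSuc[symmetric] unfolding Z_def A_def by simp
  qed
  have "c * prob {\<omega> \<in> space M. \<exists>n. Y n \<omega> \<ge> c} \<le> 1"
    by (rule supermartingale_maximal_inequality) (use main \<open>c > 0\<close> in \<open>auto simp: Y_def S_def V_def\<close>)
  then have Pc: "prob {\<omega> \<in> space M. \<exists>n. Y n \<omega> \<ge> c} \<le> exp (- (\<alpha>\<^sup>2 / (8 * C\<^sup>2 * b)))"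
    unfolding c_def by (simp add: exp_minus field_simps)
  have "{\<omega> \<in> space M. \<exists>n. (\<Sum>k\<in>{s..<s + n}. \<eta> k) \<le> 2 \<and> S n \<omega> \<ge> \<alpha>} \<subseteq> {\<omega> \<in> space M. \<exists>n. Y n \<omega> \<ge> c}"
  proof safe
    fix \<omega> n assume n: "(\<Sum>k\<in>{s..<s + n}. \<eta> k) \<le> 2" "S n \<omega> \<ge> \<alpha>"
    have "V n \<le> (\<Sum>k\<in>{s..<s + n}. \<theta> * a * C\<^sup>2 * \<eta> k)"
      unfolding V_def
    proof (rule sum_mono)
      fix k assume "k \<in> {s..<s + n}"
      then have "\<theta> * \<eta> k \<le> a" using \<theta>\<eta> by simp
      then have "(\<theta> * \<eta> k) * (\<theta> * \<eta> k * C\<^sup>2) \<le> a * (\<theta> * \<eta> k * C\<^sup>2)"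
        using \<open>\<theta> > 0\<close> \<eta>_pos[of k] by (intro mult_right_mono) auto
      then show "(\<theta> * \<eta> k * C)\<^sup>2 \<le> \<theta> * a * C\<^sup>2 * \<eta> k" by (simp add: power2_eq_square algebra_simps)
    qed
    also have "\<dots> = \<theta> * a * C\<^sup>2 * (\<Sum>k\<in>{s..<s + n}. \<eta> k)" by (simp add: sum_distrib_left)
    also have "\<dots> \<le> \<theta> * a * C\<^sup>2 * 2" using n(1) \<open>\<theta> > 0\<close> \<open>a > 0\<close> by (intro mult_left_mono) auto
    also have "\<dots> = \<theta> * \<alpha> / 2" unfolding a_def using C by (simp add: field_simps)
    finally have "V n \<le> \<theta> * \<alpha> / 2" .
    moreover have "\<theta> * S n \<omega> \<ge> \<theta> * \<alpha>" using n(2) \<open>\<theta> > 0\<close> by simp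
    ultimately have "\<theta> * S n \<omega> - V n \<ge> \<theta> * \<alpha> / 2" by linarith
    moreover have "\<theta> * \<alpha> / 2 = \<alpha>\<^sup>2 / (8 * C\<^sup>2 * b)" unfolding \<theta>_def a_def by (simp add: power2_eq_square)
    ultimately show "\<exists>n. Y n \<omega> \<ge> c" unfolding Y_def c_def by (intro exI[of _ n]) simp
  qed
  then have "prob {\<omega> \<in> space M. \<exists>n. (\<Sum>k\<in>{s..<s + n}. \<eta> k) \<le> 2 \<and> S n \<omega> \<ge> \<alpha>} \<le>
      prob {\<omega> \<in> space M. \<exists>n. Y n \<omega> \<ge> c}"
    by (intro finite_measure_mono) measurable
  with Pc show ?thesis unfolding S_def by linarith
qed


definition vanishing_noise :: "(nat \<Rightarrow> real) \<Rightarrow> 'w \<Rightarrow> bool" where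
  "vanishing_noise \<eta> \<omega> \<longleftrightarrow> (\<forall>\<epsilon>>0. \<exists>N. \<forall>s\<ge>N. \<forall>i\<ge>s. (\<Sum>k\<in>{s..<i}. \<eta> k) \<le> 2 \<longrightarrow>
      norm (\<Sum>k\<in>{s..<i}. \<eta> k *\<^sub>R \<xi> k \<omega>) \<le> \<epsilon>)"

text \<open>
  If \<open>\<eta> k \<le> \<epsilon> / ln k\<close> with \<open>\<epsilon> = \<alpha>\<^sup>2 / (16 C\<^sup>2)\<close> for all late \<open>k\<close>, then the tail bound at the starting time
  \<open>s\<close> is \<open>s\<^sup>-\<^sup>2\<close>. This is summable, and Borel-Cantelli excludes large windows for all but
  finitely many starting times.
\<close>
lemma vanishing_bounded_noise:
  assumes bdd: "\<exists>C. \<forall>k. AE \<omega> in M. norm (\<xi> k \<omega>) \<le> C"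
    and \<eta>_pos: "\<And>k. \<eta> k > 0" and \<eta>: "\<eta> \<in> o(\<lambda>k. 1 / ln (real k))"
  shows "AE \<omega> in M. vanishing_noise \<eta> \<omega>"
proof -
  obtain C0 where C0: "\<And>k. AE \<omega> in M. norm (\<xi> k \<omega>) \<le> C0" using bdd by blast
  define C where "C = max C0 1"
  have C1: "C \<ge> 1" unfolding C_def by simp
  have C: "AE \<omega> in M. norm (\<xi> k \<omega>) \<le> C" for k using C0[of k] by eventually_elim (simp add: C_def)
  define E where "E = (\<lambda>(\<tau>::real) i \<alpha> s. {\<omega> \<in> space M. \<exists>n. (\<Sum>k\<in>{s..<s + n}. \<eta> k) \<le> 2 \<and>
      (\<Sum>k\<in>{s..<s + n}. \<eta> k * (\<tau> * \<xi> k \<omega> $ i)) \<ge> \<alpha>})"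
  have E_meas [measurable]: "E \<tau> i \<alpha> s \<in> sets M" for \<tau> i \<alpha> s unfolding E_def by measurable
  have BC: "AE \<omega> in M. eventually (\<lambda>s. \<omega> \<in> space M - E \<tau> i \<alpha> s) sequentially"
    if \<tau>: "\<bar>\<tau>\<bar> = 1" and \<alpha>: "0 < \<alpha>" "\<alpha> \<le> 1" for \<tau> i \<alpha>
  proof (rule borel_cantelli_AE1)
    define \<epsilon> where "\<epsilon> = \<alpha>\<^sup>2 / (16 * C\<^sup>2)"
    have "\<epsilon> > 0" unfolding \<epsilon>_def using \<alpha> C1 by simp
    then have "eventually (\<lambda>k. norm (\<eta> k) \<le> \<epsilon> * norm (1 / ln (real k))) sequentially"
      using landau_o.smallD[OF \<eta>] by blast
    then obtain N where N: "\<And>k. k \<ge> N \<Longrightarrow> norm (\<eta> k) \<le> \<epsilon> * norm (1 / ln (real k))"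
      unfolding eventually_sequentially by blast
    have "prob (E \<tau> i \<alpha> s) \<le> inverse (real s ^ 2)" if s: "s \<ge> max N 2" for s
    proof -
      have ln_s: "ln (real s) > 0" using s by simp
      define b where "b = \<epsilon> / ln (real s)"
      have b: "\<eta> k \<le> b" if "k \<ge> s" for k
      proof -
        have "ln (real s) \<le> ln (real k)" using that s by simp
        have "\<eta> k \<le> \<epsilon> * norm (1 / ln (real k))" using N[of k] that s \<eta>_pos[of k] by simp
        also have "\<dots> = \<epsilon> / ln (real k)" using \<open>ln (real s) \<le> ln (real k)\<close> ln_s by simp
        also have "\<dots> \<le> b" unfolding b_def using \<open>ln (real s) \<le> ln (real k)\<close> ln_s \<open>\<epsilon> > 0\<close>
          by (intro divide_left_mono) auto
        finally show ?thesis .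
      qed
      have "prob (E \<tau> i \<alpha> s) \<le> exp (- (\<alpha>\<^sup>2 / (8 * C\<^sup>2 * b)))"
        unfolding E_def using s by (intro bounded_noise_tail[OF C1 C \<tau> _ \<eta>_pos b \<alpha>]) auto
      also have "\<alpha>\<^sup>2 / (8 * C\<^sup>2 * b) = 2 * ln (real s)"
        unfolding b_def \<epsilon>_def using \<alpha> C1 by (simp add: field_simps)
      also have "exp (- (2 * ln (real s))) = inverse (real s ^ 2)"
        using s by (simp add: exp_minus exp_double)
      finally show ?thesis .
    qed
    then show "summable (\<lambda>s. prob (E \<tau> i \<alpha> s))"
      by (intro summable_comparison_test'[OF inverse_power_summable[of 2], of "max N 2"]) auto
    show "emeasure M (E \<tau> i \<alpha> s) < \<infinity>" for s by (simp add: emeasure_eq_measure)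
  qed measurable
  have "AE \<omega> in M. \<forall>i m. (\<forall>\<tau>\<in>{1, -1}. eventually (\<lambda>s. \<omega> \<in> space M - E \<tau> i (1 / real (Suc m)) s) sequentially)"
    unfolding AE_all_countable by (intro allI AE_finite_allI BC) auto
  then show ?thesis
  proof eventually_elim
    case (elim \<omega>)
    show "vanishing_noise \<eta> \<omega>"
      unfolding vanishing_noise_def
    proof (intro allI impI)
      fix \<epsilon> :: real assume "\<epsilon> > 0"
      obtain m where m: "1 / real (Suc m) < \<epsilon> / real CARD('n)"
        using reals_Archimedean[of "\<epsilon> / real CARD('n)"] \<open>\<epsilon> > 0\<close> by (auto simp: inverse_eq_divide)
      define \<alpha> where "\<alpha> = 1 / real (Suc m)"
      have "eventually (\<lambda>s. \<forall>i. \<omega> \<in> space M - E 1 i \<alpha> s \<and> \<omega> \<in> space M - E (-1) i \<alpha> s) sequentially"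
        using elim unfolding \<alpha>_def by (intro eventually_all_finite eventually_conj) auto
      then obtain N where N: "\<And>s i. s \<ge> N \<Longrightarrow> \<omega> \<in> space M - E 1 i \<alpha> s" "\<And>s i. s \<ge> N \<Longrightarrow> \<omega> \<in> space M - E (-1) i \<alpha> s"
        unfolding eventually_sequentially by blast
      have "norm (\<Sum>k\<in>{s..<j}. \<eta> k *\<^sub>R \<xi> k \<omega>) \<le> \<epsilon>" if s: "s \<ge> N" "j \<ge> s" "(\<Sum>k\<in>{s..<j}. \<eta> k) \<le> 2" for s j
      proof -
        define n where "n = j - s"
        have j: "j = s + n" unfolding n_def using s by simp
        have "\<bar>(\<Sum>k\<in>{s..<j}. \<eta> k *\<^sub>R \<xi> k \<omega>) $ i\<bar> \<le> \<alpha>" for i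
          using N(1)[OF s(1), of i] N(2)[OF s(1), of i] s(3) unfolding E_def j
          by (fastforce simp: sum_negf not_le)
        then have "norm (\<Sum>k\<in>{s..<j}. \<eta> k *\<^sub>R \<xi> k \<omega>) \<le> (\<Sum>i\<in>(UNIV::'n set). \<alpha>)"
          by (intro order_trans[OF norm_le_l1_cart] sum_mono)
        also have "\<dots> \<le> \<epsilon>" using m unfolding \<alpha>_def by (simp add: field_simps)
        finally show ?thesis .
      qed
      then show "\<exists>N. \<forall>s\<ge>N. \<forall>i\<ge>s. (\<Sum>k\<in>{s..<i}. \<eta> k) \<le> 2 \<longrightarrow>
          norm (\<Sum>k\<in>{s..<i}. \<eta> k *\<^sub>R \<xi> k \<omega>) \<le> \<epsilon>" by blast
    qed
  qed
qed

lemma second_moment_bound: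
  assumes \<sigma>: "AE \<omega> in M. nn_cond_exp M (\<F> k) (\<lambda>\<omega>'. ennreal ((norm (\<xi> (Suc k) \<omega>'))\<^sup>2)) \<omega> \<le> ennreal (\<sigma>\<^sup>2)"
    and A: "A \<in> sets (\<F> k)"
  shows "integrable M (\<lambda>\<omega>. indicator A \<omega> * (norm (\<xi> (Suc k) \<omega>))\<^sup>2)"
    and "expectation (\<lambda>\<omega>. indicator A \<omega> * (norm (\<xi> (Suc k) \<omega>))\<^sup>2) \<le> \<sigma>\<^sup>2 * prob A"
proof -
  interpret finite_measure_subalgebra M "\<F> k" by (rule finite_measure_subalgebra_filtration)
  have [measurable]: "A \<in> sets M" using A subalgebra_filtration[of k] unfolding subalgebra_def by blast
  have "(\<integral>\<^sup>+\<omega>. ennreal (indicator A \<omega> * (norm (\<xi> (Suc k) \<omega>))\<^sup>2) \<partial>M) =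
      (\<integral>\<^sup>+\<omega>. indicator A \<omega> * ennreal ((norm (\<xi> (Suc k) \<omega>))\<^sup>2) \<partial>M)"
    by (intro nn_integral_cong) (auto simp: indicator_def)
  also have "\<dots> = (\<integral>\<^sup>+\<omega>. indicator A \<omega> * nn_cond_exp M (\<F> k) (\<lambda>\<omega>'. ennreal ((norm (\<xi> (Suc k) \<omega>'))\<^sup>2)) \<omega> \<partial>M)"
    by (rule nn_cond_exp_intg[symmetric]) (use A in auto)
  also have "\<dots> \<le> (\<integral>\<^sup>+\<omega>. ennreal (\<sigma>\<^sup>2) * indicator A \<omega> \<partial>M)"
    by (rule nn_integral_mono_AE) (use \<sigma> in \<open>auto simp: indicator_def elim!: eventually_mono\<close>)
  also have "\<dots> = ennreal (\<sigma>\<^sup>2 * prob A)"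
    by (simp add: nn_integral_cmult emeasure_eq_measure ennreal_mult)
  finally have le: "(\<integral>\<^sup>+\<omega>. ennreal (indicator A \<omega> * (norm (\<xi> (Suc k) \<omega>))\<^sup>2) \<partial>M) \<le> ennreal (\<sigma>\<^sup>2 * prob A)" .
  show int: "integrable M (\<lambda>\<omega>. indicator A \<omega> * (norm (\<xi> (Suc k) \<omega>))\<^sup>2)"
    by (rule integrableI_nonneg) (use le in \<open>auto intro: le_less_trans\<close>)
  have "ennreal (expectation (\<lambda>\<omega>. indicator A \<omega> * (norm (\<xi> (Suc k) \<omega>))\<^sup>2)) \<le> ennreal (\<sigma>\<^sup>2 * prob A)"
    using le nn_integral_eq_integral[OF int] by auto
  then show "expectation (\<lambda>\<omega>. indicator A \<omega> * (norm (\<xi> (Suc k) \<omega>))\<^sup>2) \<le> \<sigma>\<^sup>2 * prob A"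
    by (simp add: ennreal_le_iff)
qed

text \<open>
  The squared norm of the partial sum, increased by the largest variance \<open>V n\<close> that the future
  steps can still add, is a nonnegative supermartingale with initial value \<open>V 0\<close>.
\<close>
lemma square_integrable_noise_tail:
  assumes \<sigma>: "\<And>k. AE \<omega> in M. nn_cond_exp M (\<F> k) (\<lambda>\<omega>'. ennreal ((norm (\<xi> (Suc k) \<omega>'))\<^sup>2)) \<omega> \<le> ennreal (\<sigma>\<^sup>2)"
    and summ: "summable (\<lambda>k. (\<eta> k)\<^sup>2)" and "s \<ge> 1" and "c > 0"
  shows "c * prob {\<omega> \<in> space M. \<exists>n. (norm (\<Sum>k\<in>{s..<s + n}. \<eta> k *\<^sub>R \<xi> k \<omega>))\<^sup>2 \<ge> c} \<le> \<sigma>\<^sup>2 * (\<Sum>k. (\<eta> (k + s))\<^sup>2)"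
proof -
  define S where "S = (\<lambda>n \<omega>. \<Sum>k\<in>{s..<s + n}. \<eta> k *\<^sub>R \<xi> k \<omega>)"
  define V where "V = (\<lambda>n. \<sigma>\<^sup>2 * (\<Sum>k. (\<eta> (k + (s + n)))\<^sup>2))"
  define Y where "Y = (\<lambda>n \<omega>. (norm (S n \<omega>))\<^sup>2 + V n)"
  have summ': "summable (\<lambda>k. (\<eta> (k + m))\<^sup>2)" for m using summable_ignore_initial_segment[OF summ] .
  have V0: "V n \<ge> 0" for n unfolding V_def by (intro mult_nonneg_nonneg suminf_nonneg summ') auto
  have VSuc: "V n = \<sigma>\<^sup>2 * (\<eta> (s + n))\<^sup>2 + V (Suc n)" for n
  proof -
    have "(\<Sum>k. (\<eta> (k + (s + n)))\<^sup>2) = (\<Sum>k. (\<eta> (Suc k + (s + n)))\<^sup>2) + (\<eta> (0 + (s + n)))\<^sup>2"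
      using suminf_split_head[OF summ'[of "s + n"]] by simp
    then show ?thesis unfolding V_def by (simp add: distrib_left)
  qed
  have S_meas: "S n \<in> borel_measurable (\<F> k)" if "s + n - 1 \<le> k" for n k
    unfolding S_def using that
    by (intro borel_measurable_sum borel_measurable_scaleR borel_measurable_const \<xi>_meas_filtration) auto
  have Y_meas: "Y n \<in> borel_measurable (\<F> k)" if "s + n - 1 \<le> k" for n k
    using S_meas[OF that] unfolding Y_def by measurable
  have [measurable]: "S n \<in> borel_measurable M" for n by (rule meas_from_filtration[OF S_meas[OF order_refl]])
  have Y_measM [measurable]: "Y n \<in> borel_measurable M" for n by (rule meas_from_filtration[OF Y_meas[OF order_refl]])
  have SSuc: "S (Suc n) \<omega> = S n \<omega> + \<eta> (s + n) *\<^sub>R \<xi> (s + n) \<omega>" for n \<omega> unfolding S_def by simp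
  have main: "integrable M (\<lambda>\<omega>. indicator {\<omega> \<in> space M. \<forall>j\<le>n. Y j \<omega> < c} \<omega> * Y (Suc n) \<omega>) \<and>
      expectation (\<lambda>\<omega>. indicator {\<omega> \<in> space M. \<forall>j\<le>n. Y j \<omega> < c} \<omega> * Y (Suc n) \<omega>) \<le>
      expectation (\<lambda>\<omega>. indicator {\<omega> \<in> space M. \<forall>j\<le>n. Y j \<omega> < c} \<omega> * Y n \<omega>)" for n
  proof -
    define k where "k = s + n - 1"
    have k: "Suc k = s + n" unfolding k_def using \<open>s \<ge> 1\<close> by simp
    define A where "A = {\<omega> \<in> space M. \<forall>j\<le>n. Y j \<omega> < c}"
    have A: "A \<in> sets (\<F> k)"
      unfolding A_def by (intro below_threshold_in_filtration Y_meas) (simp add: k_def)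
    have [measurable]: "A \<in> sets M" using A subalgebra_filtration[of k] unfolding subalgebra_def by blast
    have SA: "(norm (S n \<omega>))\<^sup>2 \<le> c" if "\<omega> \<in> A" for \<omega>
      using that V0[of n] unfolding A_def Y_def by force
    define Z where "Z = (\<lambda>i \<omega>. indicator A \<omega> * S n \<omega> $ i)"
    have Zm: "Z i \<in> borel_measurable (\<F> k)" for i
      unfolding Z_def using A by (intro borel_measurable_times borel_measurable_indicator nth_meas S_meas) (auto simp: k_def)
    have Zc: "\<bar>Z i \<omega>\<bar> \<le> c + 1" for i \<omega>
    proof (cases "\<omega> \<in> A")
      case True
      have "\<bar>S n \<omega> $ i\<bar> \<le> norm (S n \<omega>)" by (rule component_le_norm_cart)
      also have "\<dots> \<le> (norm (S n \<omega>))\<^sup>2 + 1"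
        using sum_squares_bound[of "norm (S n \<omega>)" 1] norm_ge_zero[of "S n \<omega>"] by (simp del: norm_ge_zero)
      also have "\<dots> \<le> c + 1" using SA[OF True] by simp
      finally show ?thesis unfolding Z_def using True by simp
    qed (use \<open>c > 0\<close> in \<open>auto simp: Z_def\<close>)
    define I1 where "I1 = (\<lambda>\<omega>. indicator A \<omega> * (norm (S n \<omega>))\<^sup>2)"
    define I2 where "I2 = (\<lambda>\<omega>. \<Sum>i\<in>UNIV. Z i \<omega> * \<xi> (Suc k) \<omega> $ i)"
    define I3 where "I3 = (\<lambda>\<omega>. indicator A \<omega> * (norm (\<xi> (Suc k) \<omega>))\<^sup>2)"
    define IA where "IA = (\<lambda>\<omega>. indicator A \<omega> :: real)"
    have i1: "integrable M I1"
      unfolding I1_def by (rule integrable_const_bound[of _ c]) (use SA \<open>c > 0\<close> in \<open>auto simp: indicator_def\<close>)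
    have i2: "integrable M I2" "expectation I2 = 0"
      unfolding I2_def using noise_orthogonal[OF Zm Zc] by (auto simp: Bochner_Integration.integral_sum)
    have i3: "integrable M I3" "expectation I3 \<le> \<sigma>\<^sup>2 * prob A"
      unfolding I3_def using second_moment_bound[OF \<sigma> A] by auto
    have iA: "integrable M IA" "expectation IA = prob A"
      unfolding IA_def by (auto intro!: integrable_real_indicator simp: emeasure_eq_measure)
    have eq: "indicator A \<omega> * Y (Suc n) \<omega> = I1 \<omega> + 2 * \<eta> (Suc k) * I2 \<omega> + (\<eta> (Suc k))\<^sup>2 * I3 \<omega> + V (Suc n) * IA \<omega>" for \<omega>
    proof (cases "\<omega> \<in> A")
      case True
      have "I2 \<omega> = S n \<omega> \<bullet> \<xi> (Suc k) \<omega>" unfolding I2_def Z_def inner_vec_def using True by simp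
      moreover have "(norm (S (Suc n) \<omega>))\<^sup>2 = (norm (S n \<omega>))\<^sup>2 + 2 * \<eta> (Suc k) * (S n \<omega> \<bullet> \<xi> (Suc k) \<omega>) + (\<eta> (Suc k))\<^sup>2 * (norm (\<xi> (Suc k) \<omega>))\<^sup>2"
        unfolding SSuc k[symmetric] power2_norm_eq_inner
        by (simp add: inner_add_left inner_add_right inner_commute power2_eq_square algebra_simps)
      ultimately show ?thesis using True by (simp add: Y_def I1_def I3_def IA_def)
    next
      case False
      then show ?thesis by (simp add: I1_def I2_def I3_def IA_def Z_def)
    qed
    have eq': "indicator A \<omega> * Y n \<omega> = I1 \<omega> + V n * IA \<omega>" for \<omega>
      unfolding I1_def IA_def Y_def by (simp add: algebra_simps)
    have "integrable M (\<lambda>\<omega>. I1 \<omega> + 2 * \<eta> (Suc k) * I2 \<omega> + (\<eta> (Suc k))\<^sup>2 * I3 \<omega> + V (Suc n) * IA \<omega>)"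
      using i1 i2(1) i3(1) iA(1) by auto
    moreover have "expectation (\<lambda>\<omega>. I1 \<omega> + 2 * \<eta> (Suc k) * I2 \<omega> + (\<eta> (Suc k))\<^sup>2 * I3 \<omega> + V (Suc n) * IA \<omega>) \<le>
        expectation (\<lambda>\<omega>. I1 \<omega> + V n * IA \<omega>)"
    proof -
      have "expectation (\<lambda>\<omega>. I1 \<omega> + 2 * \<eta> (Suc k) * I2 \<omega> + (\<eta> (Suc k))\<^sup>2 * I3 \<omega> + V (Suc n) * IA \<omega>) =
          expectation I1 + (\<eta> (Suc k))\<^sup>2 * expectation I3 + V (Suc n) * prob A"
        using i1 i2 i3(1) iA by simp
      also have "\<dots> \<le> expectation I1 + (\<eta> (Suc k))\<^sup>2 * (\<sigma>\<^sup>2 * prob A) + V (Suc n) * prob A"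
        using mult_left_mono[OF i3(2), of "(\<eta> (Suc k))\<^sup>2"] by simp
      also have "\<dots> = expectation I1 + V n * prob A"
        unfolding VSuc[of n] k[symmetric] by (simp add: algebra_simps)
      also have "\<dots> = expectation (\<lambda>\<omega>. I1 \<omega> + V n * IA \<omega>)" using i1 iA by simp
      finally show ?thesis .
    qed
    ultimately show ?thesis unfolding eq[symmetric] eq'[symmetric] unfolding A_def by blast
  qed
  have "c * prob {\<omega> \<in> space M. \<exists>n. Y n \<omega> \<ge> c} \<le> V 0"
    by (rule supermartingale_maximal_inequality) (use main V0 \<open>c > 0\<close> in \<open>auto simp: Y_def S_def\<close>)
  moreover have "prob {\<omega> \<in> space M. \<exists>n. (norm (S n \<omega>))\<^sup>2 \<ge> c} \<le> prob {\<omega> \<in> space M. \<exists>n. Y n \<omega> \<ge> c}"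
  proof (rule finite_measure_mono)
    have "(norm (S n \<omega>))\<^sup>2 \<le> Y n \<omega>" for n \<omega> using V0[of n] by (simp add: Y_def)
    then show "{\<omega> \<in> space M. \<exists>n. (norm (S n \<omega>))\<^sup>2 \<ge> c} \<subseteq> {\<omega> \<in> space M. \<exists>n. Y n \<omega> \<ge> c}"
      using order_trans by blast
  qed measurable
  ultimately have "c * prob {\<omega> \<in> space M. \<exists>n. (norm (S n \<omega>))\<^sup>2 \<ge> c} \<le> V 0"
    using mult_left_mono[of _ _ c] \<open>c > 0\<close> by (meson less_imp_le order_trans)
  then show ?thesis unfolding S_def V_def by simp
qed

text \<open>
  The tail bound tends to zero with the starting time, so that almost surely some starting time
  \<open>s\<close> has all its partial sums below \<open>\<epsilon>\<close>; a window that begins after \<open>s\<close> is a difference of two of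
  them.
\<close>
lemma vanishing_square_integrable_noise:
  assumes \<sigma>: "\<And>k. AE \<omega> in M. nn_cond_exp M (\<F> k) (\<lambda>\<omega>'. ennreal ((norm (\<xi> (Suc k) \<omega>'))\<^sup>2)) \<omega> \<le> ennreal (\<sigma>\<^sup>2)"
    and summ: "summable (\<lambda>k. (\<eta> k)\<^sup>2)"
  shows "AE \<omega> in M. vanishing_noise \<eta> \<omega>"
proof -
  define E where "E = (\<lambda>\<epsilon> s. {\<omega> \<in> space M. \<exists>n. (norm (\<Sum>k\<in>{s..<s + n}. \<eta> k *\<^sub>R \<xi> k \<omega>))\<^sup>2 \<ge> \<epsilon>\<^sup>2})"
  have E_meas [measurable]: "E \<epsilon> s \<in> sets M" for \<epsilon> s unfolding E_def by measurable
  have ae: "AE \<omega> in M. \<exists>s\<ge>1. \<omega> \<notin> E \<epsilon> s" if "\<epsilon> > 0" for \<epsilon>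
  proof -
    define B where "B = {\<omega> \<in> space M. \<forall>s\<ge>1. \<omega> \<in> E \<epsilon> s}"
    have [measurable]: "B \<in> sets M" unfolding B_def by measurable
    have "prob B \<le> \<sigma>\<^sup>2 / \<epsilon>\<^sup>2 * (\<Sum>k. (\<eta> (k + s))\<^sup>2)" if "s \<ge> 1" for s
    proof -
      have "B \<subseteq> E \<epsilon> s" unfolding B_def using that by blast
      then have "prob B \<le> prob (E \<epsilon> s)" by (intro finite_measure_mono) measurable
      moreover have "\<epsilon>\<^sup>2 * prob (E \<epsilon> s) \<le> \<sigma>\<^sup>2 * (\<Sum>k. (\<eta> (k + s))\<^sup>2)"
        unfolding E_def using \<open>\<epsilon> > 0\<close> that by (intro square_integrable_noise_tail[OF \<sigma> summ]) auto
      then have "prob (E \<epsilon> s) \<le> \<sigma>\<^sup>2 / \<epsilon>\<^sup>2 * (\<Sum>k. (\<eta> (k + s))\<^sup>2)" using \<open>\<epsilon> > 0\<close> by (simp add: field_simps)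
      ultimately show ?thesis by linarith
    qed
    moreover have "(\<lambda>s. \<sigma>\<^sup>2 / \<epsilon>\<^sup>2 * (\<Sum>k. (\<eta> (k + s))\<^sup>2)) \<longlonglongrightarrow> \<sigma>\<^sup>2 / \<epsilon>\<^sup>2 * 0"
      by (intro tendsto_mult_left suminf_exist_split2 summ)
    ultimately have "prob B \<le> 0" by (intro LIMSEQ_le_const[of _ "\<sigma>\<^sup>2 / \<epsilon>\<^sup>2 * 0", simplified]) auto
    then have "prob B = 0" using measure_nonneg[of M B] by linarith
    then have "AE \<omega> in M. \<omega> \<notin> B" by (subst (asm) prob_eq_0) auto
    then show ?thesis by (rule AE_mp) (auto simp: B_def intro!: AE_I2)
  qed
  have "AE \<omega> in M. \<forall>m. \<exists>s\<ge>1. \<omega> \<notin> E (1 / real (Suc m)) s"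
    unfolding AE_all_countable by (intro allI ae) simp
  then show ?thesis using AE_space
  proof eventually_elim
    case (elim \<omega>)
    show "vanishing_noise \<eta> \<omega>"
      unfolding vanishing_noise_def
    proof (intro allI impI)
      fix \<epsilon> :: real assume "\<epsilon> > 0"
      obtain m where m: "1 / real (Suc m) < \<epsilon> / 2"
        using reals_Archimedean[of "\<epsilon> / 2"] \<open>\<epsilon> > 0\<close> by (auto simp: inverse_eq_divide)
      obtain s where s: "\<omega> \<notin> E (1 / real (Suc m)) s" using elim by blast
      have tail: "norm (\<Sum>k\<in>{s..<i}. \<eta> k *\<^sub>R \<xi> k \<omega>) < \<epsilon> / 2" if "i \<ge> s" for i
      proof -
        have "\<not> (norm (\<Sum>k\<in>{s..<s + (i - s)}. \<eta> k *\<^sub>R \<xi> k \<omega>))\<^sup>2 \<ge> (1 / real (Suc m))\<^sup>2"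
          using s elim unfolding E_def by blast
        then have "norm (\<Sum>k\<in>{s..<i}. \<eta> k *\<^sub>R \<xi> k \<omega>) < 1 / real (Suc m)"
          using that power_mono[of "1 / real (Suc m)" "norm (\<Sum>k\<in>{s..<i}. \<eta> k *\<^sub>R \<xi> k \<omega>)" 2] by force
        then show ?thesis using m by linarith
      qed
      have "norm (\<Sum>k\<in>{a..<i}. \<eta> k *\<^sub>R \<xi> k \<omega>) \<le> \<epsilon>" if "a \<ge> s" "i \<ge> a" for a i
      proof -
        have "(\<Sum>k\<in>{s..<a}. \<eta> k *\<^sub>R \<xi> k \<omega>) + (\<Sum>k\<in>{a..<i}. \<eta> k *\<^sub>R \<xi> k \<omega>) = (\<Sum>k\<in>{s..<i}. \<eta> k *\<^sub>R \<xi> k \<omega>)"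
          by (rule sum.atLeastLessThan_concat) (use that in auto)
        then have "(\<Sum>k\<in>{a..<i}. \<eta> k *\<^sub>R \<xi> k \<omega>) = (\<Sum>k\<in>{s..<i}. \<eta> k *\<^sub>R \<xi> k \<omega>) - (\<Sum>k\<in>{s..<a}. \<eta> k *\<^sub>R \<xi> k \<omega>)"
          by (simp add: algebra_simps)
        then show ?thesis
          using norm_triangle_ineq4[of "\<Sum>k\<in>{s..<i}. \<eta> k *\<^sub>R \<xi> k \<omega>" "\<Sum>k\<in>{s..<a}. \<eta> k *\<^sub>R \<xi> k \<omega>"]
            tail[of i] tail[of a] that by simp
      qed
      then show "\<exists>N. \<forall>s\<ge>N. \<forall>i\<ge>s. (\<Sum>k\<in>{s..<i}. \<eta> k) \<le> 2 \<longrightarrow>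
          norm (\<Sum>k\<in>{s..<i}. \<eta> k *\<^sub>R \<xi> k \<omega>) \<le> \<epsilon>" by blast
    qed
  qed
qed

end

section \<open>The stochastic Bregman subgradient method\<close>

text \<open>
  If the gradients at \<open>x\<close> and \<open>y\<close> agree, the average of the two tangent inequalities at the
  midpoint contradicts strict convexity there.
\<close>
lemma inj_gradient:
  assumes sc: "strictly_convex \<phi>" and diff: "\<And>x. \<phi> differentiable (at x)"
  shows "inj (gradient \<phi>)"
proof (rule injI, rule ccontr)
  fix x y assume eq: "gradient \<phi> x = gradient \<phi> y" and "x \<noteq> y"
  define m where "m = (1 / 2) *\<^sub>R x + (1 / 2) *\<^sub>R y"
  have "\<phi> m \<ge> \<phi> x + gradient \<phi> x \<bullet> (m - x)" "\<phi> m \<ge> \<phi> y + gradient \<phi> x \<bullet> (m - y)"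
    using strictly_convex_tangent[OF sc gradient_gderiv[OF diff], of x m]
      strictly_convex_tangent[OF sc gradient_gderiv[OF diff], of y m] eq by simp_all
  moreover have "gradient \<phi> x \<bullet> (m - x) + gradient \<phi> x \<bullet> (m - y) = 0"
  proof -
    have "(m - x) + (m - y) = 0"
      unfolding m_def by (simp add: algebra_simps scaleR_2[symmetric] flip: scaleR_add_left)
    then show ?thesis by (metis inner_add_right inner_zero_right)
  qed
  moreover have "\<phi> m < \<phi> x / 2 + \<phi> y / 2"
    using sc[unfolded strictly_convex_def, rule_format, OF \<open>x \<noteq> y\<close>, of "1 / 2"] unfolding m_def by simp
  ultimately show False by linarith
qed

text \<open>
  For a constant curve the condition no longer depends on the time, and a condition that holds at
  almost every time holds at some time.
\<close>
lemma hessian_positive_everywhere: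
  fixes \<phi> :: "(real^'n) \<Rightarrow> real"
  assumes hess: "\<And>z. continuous_on {0..} z \<Longrightarrow> (\<And>T. T > 0 \<Longrightarrow> abs_continuous_on {0..T} z) \<Longrightarrow>
      AE s in lebesgue. s \<ge> 0 \<longrightarrow>
        gradient \<phi> differentiable (at (z s)) \<and> positive_definite (hessian \<phi> (z s))"
  shows "\<exists>H. (gradient \<phi> has_derivative H) (at u) \<and> (\<forall>v. v \<noteq> 0 \<longrightarrow> v \<bullet> H v > 0)"
proof -
  define P where "P \<longleftrightarrow> gradient \<phi> differentiable (at u) \<and> positive_definite (hessian \<phi> u)"
  have "0-lipschitz_on {0..T} (\<lambda>_::real. u)" for T by (rule lipschitz_onI) auto
  then have "AE s in lebesgue. (0::real) \<le> s \<longrightarrow> P"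
    unfolding P_def by (intro hess[of "\<lambda>_. u"] lipschitz_on_imp_abs_continuous_on continuous_on_const)
  then have "negligible {s::real. \<not> (0 \<le> s \<longrightarrow> P)}" by (rule negligible_if_AE_lebesgue)
  moreover have "\<not> negligible {0<..<1::real}" using open_not_negligible[of "{0<..<1::real}"] by auto
  ultimately have "\<not> {0<..<1} \<subseteq> {s::real. \<not> (0 \<le> s \<longrightarrow> P)}" using negligible_subset by blast
  then have P: P by auto
  define H where "H = frechet_derivative (gradient \<phi>) (at u)"
  have H: "(gradient \<phi> has_derivative H) (at u)"
    unfolding H_def using P frechet_derivative_works unfolding P_def by blast
  have "H v = hessian \<phi> u *v v" for v
    unfolding hessian_def H_def[symmetric] using has_derivative_linear[OF H]
    by (simp add: matrix_works linear_matrix_vector_mul_eq)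
  then show ?thesis using H P unfolding P_def positive_definite_def by auto
qed

theorem theorem4p1:
  fixes M :: "'w measure"
    and f \<phi> :: "(real^'n) \<Rightarrow> real"
    and D :: "(real^'n) \<Rightarrow> (real^'n) set"
    and \<eta> \<delta> \<nu> :: "nat \<Rightarrow> real"
    and x d \<xi> :: "nat \<Rightarrow> 'w \<Rightarrow> real^'n"
  assumes prob: "prob_space M"
    and f_lipschitz: "locally_lipschitz f"
    and \<eta>_pos: "\<And>k. \<eta> k > 0"
    and \<delta>_nonneg: "\<And>k. \<delta> k \<ge> 0"
    and \<nu>_nonneg: "\<And>k. \<nu> k \<ge> 0"
    and \<xi>_random: "\<And>k. \<xi> k \<in> borel_measurable M"
    and d_mem: "\<And>k \<omega>. \<omega> \<in> space M \<Longrightarrow> d k \<omega> \<in> enlargement D (\<delta> k) (x k \<omega>)"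
    and sbg_step: "\<And>k \<omega>. \<omega> \<in> space M \<Longrightarrow>
      nu_optimal (\<nu> k) (sbg_objective \<phi> (\<eta> k) (d k \<omega> + \<xi> k \<omega>) (x k \<omega>)) (x (Suc k) \<omega>)"
    and kernel: "legendre_kernel \<phi>" "supercoercive \<phi>"
    and grad_diff: "AE u in lebesgue. gradient \<phi> differentiable (at u)"
    and hessian_pos: "\<And>z. continuous_on {0..} z \<Longrightarrow> (\<And>T. T > 0 \<Longrightarrow> abs_continuous_on {0..T} z) \<Longrightarrow>
      AE s in lebesgue. s \<ge> 0 \<longrightarrow>
        gradient \<phi> differentiable (at (z s)) \<and> positive_definite (hessian \<phi> (z s))"
    and bounded: "AE \<omega> in M. bounded (range (\<lambda>k. x k \<omega>)) \<and>
      bounded (range (\<lambda>k. gradient \<phi> (x k \<omega>))) \<and> bounded (range (\<lambda>k. d k \<omega>))"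
    and noise: "martingale_difference_noise M \<xi>"
    and \<eta>_diverges: "filterlim (\<lambda>n. \<Sum>k<n. \<eta> k) at_top sequentially"
    and noise_cases:
      "((\<exists>C. \<forall>k. AE \<omega> in M. norm (\<xi> k \<omega>) \<le> C) \<and> \<eta> \<in> o(\<lambda>k. 1 / ln (real k))) \<or>
       ((\<exists>\<sigma>. \<forall>k. AE \<omega> in M. nn_cond_exp M (natural_filtration M \<xi> k)
            (\<lambda>\<omega>'. ennreal ((norm (\<xi> (Suc k) \<omega>'))\<^sup>2)) \<omega> \<le> ennreal (\<sigma>\<^sup>2)) \<and>
        summable (\<lambda>k. (\<eta> k)\<^sup>2))"
    and \<delta>_lim: "\<delta> \<longlonglongrightarrow> 0"
    and \<nu>_lim: "\<nu> \<longlonglongrightarrow> 0"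
    and f_bdd_below: "bdd_below (range f)"
    and D_conservative: "conservative_field f D"
    and D_convex: "\<And>y. convex (D y)"
    and critical_values: "interior {f y |y. 0 \<in> D y} = {}"
  shows "AE \<omega> in M. (\<forall>x'. cluster_point (\<lambda>k. x k \<omega>) x' \<longrightarrow> 0 \<in> D x') \<and>
    convergent (\<lambda>k. f (x k \<omega>))"
proof -
  interpret martingale_noise M \<xi>
    using prob \<xi>_random noise by (simp add: martingale_noise_def martingale_noise_axioms_def)
  have \<eta>_lim: "\<eta> \<longlonglongrightarrow> 0"
    using noise_cases
  proof
    assume "(\<exists>C. \<forall>k. AE \<omega> in M. norm (\<xi> k \<omega>) \<le> C) \<and> \<eta> \<in> o(\<lambda>k. 1 / ln (real k))"
    then have "eventually (\<lambda>k. norm (\<eta> k) \<le> 1 * norm (1 / ln (real k))) sequentially"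
      by (intro landau_o.smallD) auto
    moreover have "(\<lambda>k. 1 / ln (real k)) \<longlonglongrightarrow> 0" by real_asymp
    then have "(\<lambda>k. 1 * norm (1 / ln (real k))) \<longlonglongrightarrow> 0" by (simp only: mult_1 tendsto_norm_zero)
    ultimately show ?thesis by (rule Lim_null_comparison)
  next
    assume "(\<exists>\<sigma>. \<forall>k. AE \<omega> in M. nn_cond_exp M (natural_filtration M \<xi> k)
            (\<lambda>\<omega>'. ennreal ((norm (\<xi> (Suc k) \<omega>'))\<^sup>2)) \<omega> \<le> ennreal (\<sigma>\<^sup>2)) \<and> summable (\<lambda>k. (\<eta> k)\<^sup>2)"
    then have "(\<lambda>k. (\<eta> k)\<^sup>2) \<longlonglongrightarrow> 0" by (intro summable_LIMSEQ_zero) simp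
    then have "(\<lambda>k. sqrt ((\<eta> k)\<^sup>2)) \<longlonglongrightarrow> sqrt 0" by (rule tendsto_real_sqrt)
    then show ?thesis using \<eta>_pos by (simp add: less_imp_le)
  qed
  have vanish: "AE \<omega> in M. vanishing_noise \<eta> \<omega>"
    using noise_cases
  proof
    assume "(\<exists>C. \<forall>k. AE \<omega> in M. norm (\<xi> k \<omega>) \<le> C) \<and> \<eta> \<in> o(\<lambda>k. 1 / ln (real k))"
    then show ?thesis by (intro vanishing_bounded_noise \<eta>_pos) simp_all
  next
    assume "(\<exists>\<sigma>. \<forall>k. AE \<omega> in M. nn_cond_exp M (natural_filtration M \<xi> k)
            (\<lambda>\<omega>'. ennreal ((norm (\<xi> (Suc k) \<omega>'))\<^sup>2)) \<omega> \<le> ennreal (\<sigma>\<^sup>2)) \<and> summable (\<lambda>k. (\<eta> k)\<^sup>2)"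
    then obtain \<sigma> where "\<And>k. AE \<omega> in M. nn_cond_exp M (natural_filtration M \<xi> k)
            (\<lambda>\<omega>'. ennreal ((norm (\<xi> (Suc k) \<omega>'))\<^sup>2)) \<omega> \<le> ennreal (\<sigma>\<^sup>2)" "summable (\<lambda>k. (\<eta> k)\<^sup>2)" by blast
    then show ?thesis by (rule vanishing_square_integrable_noise)
  qed
  have G': "\<exists>H. (gradient \<phi> has_derivative H) (at u) \<and> (\<forall>v. v \<noteq> 0 \<longrightarrow> v \<bullet> H v > 0)" for u
    using hessian_positive_everywhere[OF hessian_pos] by blast
  show ?thesis
    using vanish bounded AE_space
  proof eventually_elim
    case (elim \<omega>)
    \<comment> \<open>the inexactness of the step, moved to the side of the noise\<close>
    define e where "e = (\<lambda>k. - ((d k \<omega> + \<xi> k \<omega>) + (1 / \<eta> k) *\<^sub>R (gradient \<phi> (x (Suc k) \<omega>) - gradient \<phi> (x k \<omega>))))"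
    have e: "norm (e k) \<le> \<nu> k" for k
      using sbg_step[OF elim(3), of k] nu_optimal_sbg_objective_iff[OF kernel(1) \<eta>_pos[of k]]
      unfolding e_def norm_minus_cancel by blast
    obtain R where R: "\<And>k. norm (d k \<omega>) \<le> R" using elim(2) unfolding bounded_iff by auto
    interpret perturbed_dual_iteration "gradient \<phi>" D \<eta> \<delta> "\<lambda>k. x k \<omega>" "\<lambda>k. d k \<omega>" "\<lambda>k. \<xi> k \<omega> + e k" R
    proof
      show "inj (gradient \<phi>)" using kernel(1) inj_gradient unfolding legendre_kernel_def by blast
      show "continuous_on UNIV (gradient \<phi>)" using kernel(1) unfolding legendre_kernel_def by blast
      show "closed {(x, v). v \<in> D x}" "\<And>y. closed (D y)" using D_conservative unfolding conservative_field_def by blast+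
      show "bounded (range (\<lambda>k. x k \<omega>))" using elim(2) by blast
      show "d k \<omega> \<in> enlargement D (\<delta> k) (x k \<omega>)" for k using d_mem[OF elim(3)] .
      show "gradient \<phi> (x (Suc k) \<omega>) = gradient \<phi> (x k \<omega>) - \<eta> k *\<^sub>R (d k \<omega> + (\<xi> k \<omega> + e k))" for k
      proof -
        have "d k \<omega> + (\<xi> k \<omega> + e k) = - ((1 / \<eta> k) *\<^sub>R (gradient \<phi> (x (Suc k) \<omega>) - gradient \<phi> (x k \<omega>)))"
          unfolding e_def by simp
        then show ?thesis using \<eta>_pos[of k] by simp
      qed
      fix \<epsilon> :: real assume "\<epsilon> > 0"
      obtain N1 where N1: "\<forall>s\<ge>N1. \<forall>i\<ge>s. (\<Sum>k\<in>{s..<i}. \<eta> k) \<le> 2 \<longrightarrow> norm (\<Sum>k\<in>{s..<i}. \<eta> k *\<^sub>R \<xi> k \<omega>) \<le> \<epsilon> / 2"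
        using elim(1) half_gt_zero[OF \<open>\<epsilon> > 0\<close>] unfolding vanishing_noise_def by blast
      have "eventually (\<lambda>k. \<nu> k < \<epsilon> / 4) sequentially" using order_tendstoD(2)[OF \<nu>_lim, of "\<epsilon> / 4"] \<open>\<epsilon> > 0\<close> by simp
      then obtain N2 where N2: "\<And>k. k \<ge> N2 \<Longrightarrow> \<nu> k < \<epsilon> / 4" unfolding eventually_sequentially by blast
      have "norm (\<Sum>k\<in>{s..<i}. \<eta> k *\<^sub>R (\<xi> k \<omega> + e k)) \<le> \<epsilon>"
        if s: "s \<ge> max N1 N2" "i \<ge> s" "(\<Sum>k\<in>{s..<i}. \<eta> k) \<le> 2" for s i
      proof -
        have "norm (\<Sum>k\<in>{s..<i}. \<eta> k *\<^sub>R e k) \<le> (\<Sum>k\<in>{s..<i}. \<eta> k * (\<epsilon> / 4))"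
        proof (rule sum_norm_le)
          fix k assume "k \<in> {s..<i}"
          then have "norm (e k) \<le> \<epsilon> / 4" using e[of k] N2[of k] s(1) by simp
          then show "norm (\<eta> k *\<^sub>R e k) \<le> \<eta> k * (\<epsilon> / 4)" using \<eta>_pos[of k] by simp
        qed
        also have "\<dots> = (\<Sum>k\<in>{s..<i}. \<eta> k) * (\<epsilon> / 4)" by (rule sum_distrib_right[symmetric])
        also have "\<dots> \<le> 2 * (\<epsilon> / 4)" using s(3) \<open>\<epsilon> > 0\<close> by (intro mult_right_mono) auto
        finally have "norm (\<Sum>k\<in>{s..<i}. \<eta> k *\<^sub>R e k) \<le> \<epsilon> / 2" by simp
        moreover have "norm (\<Sum>k\<in>{s..<i}. \<eta> k *\<^sub>R \<xi> k \<omega>) \<le> \<epsilon> / 2" using N1 s by simp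
        ultimately show ?thesis
          using norm_triangle_ineq[of "\<Sum>k\<in>{s..<i}. \<eta> k *\<^sub>R \<xi> k \<omega>" "\<Sum>k\<in>{s..<i}. \<eta> k *\<^sub>R e k"]
          by (simp add: scaleR_add_right sum.distrib)
      qed
      then show "\<exists>N. \<forall>s\<ge>N. \<forall>i\<ge>s. (\<Sum>k\<in>{s..<i}. \<eta> k) \<le> 2 \<longrightarrow> norm (\<Sum>k\<in>{s..<i}. \<eta> k *\<^sub>R (\<xi> k \<omega> + e k)) \<le> \<epsilon>"
        by blast
    qed (use \<eta>_pos \<eta>_lim \<eta>_diverges R \<delta>_nonneg \<delta>_lim D_convex in auto)
    show ?case
      using converges_to_stationary_set[OF f_lipschitz D_conservative G' critical_values] by blast
  qed
qed

end
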